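(* Let $\mathcal{A}$ be a unital $C^*$-algebra, let $\mathcal{M}_n$ be the algebra of complex $n\times n$ matrices, and let $\phi:\mathcal{A}\to\mathcal{M}_n$ be a positive unital linear map. Let $a\in\mathcal{A}$ be self-adjoint and let $f:I\to\mathbb{R}$ be a function whose domain is an open interval $I\subseteq\mathbb{R}$ which contains the spectrum of $a$. Then: 1. If $f$ is an operator convex function, then $f(\phi(a))\leq\phi(f(a))$. 2. If $f$ is a monotone convex function, then for every $i\in\{1,\dots,n\}$, $\lambda_i(f(\phi(a)))\leq\lambda_i(\phi(f(a)))$. 3. If $f$ is a convex function, then for every $k\in\{1,\dots,n\}$, $$\sum_{i=1}^k\lambda_i(f(\phi(a)))\leq\sum_{i=1}^k\lambda_i(\phi(f(a))).$$ Moreover, if $0\in I$ and $f(0)\leq 0$, then the following also hold when $\phi:\mathcal{A}\to\mathcal{M}_n$ is a contractive positive linear map (not necessarily unital): $f(\phi(a))\leq\phi(f(a))$ if $f$ is operator convex; $\lambda_i(f(\phi(a)))\leq\lambda_i(\phi(f(a)))$ for every $i\in\{1,\dots,n\}$ if $f$ is monotone convex; and $\sum_{i=1}^k\lambda_i(f(\phi(a)))\leq\sum_{i=1}^k\lambda_i(\phi(f(a)))$ for every $k\in\{1,\dots,n\}$ if $f$ is convex.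
   Context: A linear map between $C^*$-algebras is positive if it maps positive elements to positive elements; it is contractive if its norm is at most $1$. For a self-adjoint matrix $A\in\mathcal{M}_n$, $\lambda_1(A)\geq\dots\geq\lambda_n(A)$ are the eigenvalues of $A$ counted with multiplicity, in non-increasing order. $f(x)$ for self-adjoint $x$ is defined by continuous functional calculus. Monotone means non-decreasing or non-increasing. A continuous function $F:I\to\mathbb{R}$ is operator convex if $F(\lambda x+(1-\lambda)y)\leq\lambda F(x)+(1-\lambda)F(y)$ for each $\lambda\in[0,1]$ and every pair of self-adjoint bounded operators $x,y$ on an infinite dimensional Hilbert space with spectra in $I$. *)

theory Defs
  imports "HOL-Analysis.Analysis" "HOL-Computational_Algebra.Polynomial"
begin

class complex_vector = real_vector +
  fixes scaleC :: "complex \<Rightarrow> 'a \<Rightarrow> 'a"  (infixr "*\<^sub>C" 75)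
  assumes scaleC_add_right: "c *\<^sub>C (x + y) = c *\<^sub>C x + c *\<^sub>C y"
    and scaleC_add_left: "(c + d) *\<^sub>C x = c *\<^sub>C x + d *\<^sub>C x"
    and scaleC_scaleC: "c *\<^sub>C (d *\<^sub>C x) = (c * d) *\<^sub>C x"
    and scaleC_of_real: "complex_of_real r *\<^sub>C x = r *\<^sub>R x"

lemma scaleC_one [simp]: "1 *\<^sub>C (x::_::complex_vector) = x"
  using scaleC_of_real[of 1 x] by simp

lemma scaleC_zero_left [simp]: "0 *\<^sub>C (x::_::complex_vector) = 0"
  using scaleC_of_real[of 0 x] by simp

lemma scaleC_zero_right [simp]: "c *\<^sub>C 0 = 0"
  using scaleC_add_right[of c 0 0] by simp

lemma scaleC_minus_right: "c *\<^sub>C (- x) = - (c *\<^sub>C x)"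
  using scaleC_add_right[of c x "- x"] by (metis add.commute scaleC_zero_right eq_neg_iff_add_eq_0 right_minus)

lemma scaleC_diff_right: "c *\<^sub>C (x - y) = c *\<^sub>C x - c *\<^sub>C y"
  using scaleC_add_right[of c x "- y"] by (simp add: scaleC_minus_right)

(* The inner product is conjugate-linear in the first argument. Completeness comes from the class banach. *)
class complex_hilbert_space = complex_vector + banach +
  fixes cinner :: "'a \<Rightarrow> 'a \<Rightarrow> complex"
  assumes cinner_add_right: "cinner x (y + z) = cinner x y + cinner x z"
    and cinner_scaleC_right: "cinner x (c *\<^sub>C y) = c * cinner x y"
    and cinner_commute: "cinner x y = cnj (cinner y x)"
    and cinner_self: "cinner x x = complex_of_real ((norm x)\<^sup>2)"

lemma cinner_add_left: "cinner (x + y) z = cinner x z + cinner y z"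
  by (metis cinner_add_right cinner_commute complex_cnj_add)

lemma cinner_scaleC_left: "cinner (c *\<^sub>C x) y = cnj c * cinner x y"
  by (metis cinner_commute cinner_scaleC_right complex_cnj_mult)

lemma cinner_zero_right [simp]: "cinner x 0 = 0"
  using cinner_add_right[of x 0 0] by simp

lemma cinner_zero_left [simp]: "cinner 0 x = 0"
  using cinner_add_left[of 0 0 x] by simp

lemma cinner_minus_right: "cinner x (- y) = - cinner x y"
  using cinner_add_right[of x y "- y"] by (metis add.commute cinner_zero_right eq_neg_iff_add_eq_0 right_minus)

lemma cinner_minus_left: "cinner (- x) y = - cinner x y"
  by (metis cinner_commute cinner_minus_right complex_cnj_minus)

lemma cinner_diff_right: "cinner x (y - z) = cinner x y - cinner x z"
  using cinner_add_right[of x y "- z"] by (simp add: cinner_minus_right)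

lemma cinner_diff_left: "cinner (x - y) z = cinner x z - cinner y z"
  using cinner_add_left[of x "- y" z] by (simp add: cinner_minus_left)

lemma norm_sq_cinner: "(norm (x::_::complex_hilbert_space))\<^sup>2 = Re (cinner x x)"
  by (simp add: cinner_self)

lemma norm_scaleC_hilbert: "norm (c *\<^sub>C x) = cmod c * norm (x::_::complex_hilbert_space)"
proof -
  have "complex_of_real ((norm (c *\<^sub>C x))\<^sup>2) = cnj c * (c * cinner x x)"
    by (simp only: cinner_self[symmetric] cinner_scaleC_left cinner_scaleC_right mult.left_commute)
  also have "\<dots> = complex_of_real ((cmod c * norm x)\<^sup>2)"
    by (simp add: cinner_self power_mult_distrib complex_norm_square mult_ac del: of_real_power)
  finally have "(norm (c *\<^sub>C x))\<^sup>2 = (cmod c * norm x)\<^sup>2"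
    using of_real_eq_iff by blast
  thus ?thesis by (simp add: power2_eq_iff_nonneg)
qed

lemma cinner_decompose:
  assumes "v \<noteq> 0"
  shows "(norm (x - (cinner v x / cinner v v) *\<^sub>C v))\<^sup>2
       = (norm x)\<^sup>2 - (cmod (cinner v x))\<^sup>2 / (norm v)\<^sup>2"
proof -
  have nz: "complex_of_real ((norm v)\<^sup>2) \<noteq> 0" using assms by simp
  define t where "t = cinner v x / cinner v v"
  have tv: "t * cinner v v = cinner v x" using nz by (simp add: t_def cinner_self)
  have "cinner (x - t *\<^sub>C v) (x - t *\<^sub>C v)
      = cinner x x - t * cinner x v - cnj t * cinner v x + cnj t * (t * cinner v v)"
    by (simp add: cinner_diff_left cinner_diff_right cinner_scaleC_left cinner_scaleC_right algebra_simps)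
  also have "\<dots> = cinner x x - t * cinner x v" by (simp add: tv)
  also have "t * cinner x v = complex_of_real ((cmod (cinner v x))\<^sup>2 / (norm v)\<^sup>2)"
    unfolding t_def cinner_self cinner_commute[of x v] by (simp add: complex_norm_square del: of_real_power)
  finally have "complex_of_real ((norm (x - t *\<^sub>C v))\<^sup>2)
      = complex_of_real ((norm x)\<^sup>2 - (cmod (cinner v x))\<^sup>2 / (norm v)\<^sup>2)"
    by (simp add: cinner_self)
  thus ?thesis using of_real_eq_iff unfolding t_def by blast
qed

lemma cinner_Cauchy_Schwarz: "cmod (cinner x y) \<le> norm x * norm y"
proof (cases "x = 0")
  case False
  have "0 \<le> (norm y)\<^sup>2 - (cmod (cinner x y))\<^sup>2 / (norm x)\<^sup>2"
    using cinner_decompose[OF False, of y] by (metis zero_le_power2)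
  hence "(cmod (cinner x y))\<^sup>2 \<le> (norm x * norm y)\<^sup>2"
    using False by (simp add: field_simps power_mult_distrib)
  thus ?thesis by (rule power2_le_imp_le) simp
qed simp

lemma cinner_parallelogram:
  "(norm (x + (y::_::complex_hilbert_space)))\<^sup>2 + (norm (x - y))\<^sup>2 = 2 * (norm x)\<^sup>2 + 2 * (norm y)\<^sup>2"
  by (simp add: norm_sq_cinner cinner_add_left cinner_add_right cinner_diff_left cinner_diff_right)

lemma cinner_ext: "(\<And>y. cinner y x = cinner y z) \<Longrightarrow> x = z"
proof -
  assume *: "\<And>y. cinner y x = cinner y z"
  have "cinner (x - z) (x - z) = 0" by (simp add: cinner_diff_right *)
  thus "x = z" by (simp add: cinner_self)
qed

lemma cinner_ext_left: "(\<And>y. cinner x y = cinner z y) \<Longrightarrow> x = z"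
proof -
  assume *: "\<And>y. cinner x y = cinner z y"
  have "cinner (x - z) (x - z) = 0" by (simp add: cinner_diff_left *)
  thus "x = z" by (simp add: cinner_self)
qed

lemma riesz_representation:
  fixes g :: "'h::complex_hilbert_space \<Rightarrow> complex"
  assumes g: "bounded_linear g" and gC: "\<And>c x. g (c *\<^sub>C x) = c * g x"
  shows "\<exists>z. \<forall>x. g x = cinner z x"
proof (cases "\<forall>x. g x = 0")
  case True
  thus ?thesis by (intro exI[of _ 0]) simp
next
  case False
  interpret g: bounded_linear g by fact
  define K where "K = {x. g x = 1}"
  define d where "d = (INF x\<in>K. norm x)"
  from False obtain w where w: "g w \<noteq> 0" by auto
  have "(1 / g w) *\<^sub>C w \<in> K" by (simp add: K_def gC w)
  hence Kne: "K \<noteq> {}" by auto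
  have bdd: "bdd_below (norm ` K)" by (rule bdd_belowI[of _ 0]) auto
  have dle: "d \<le> norm x" if "x \<in> K" for x
    unfolding d_def by (rule cINF_lower[OF bdd that])
  have d0: "0 \<le> d" unfolding d_def by (rule cINF_greatest[OF Kne]) simp
  have close: "\<exists>x\<in>K. (norm x)\<^sup>2 < d\<^sup>2 + e" if "e > 0" for e
  proof -
    have "d < sqrt (d\<^sup>2 + e)" using that d0 by (simp add: real_less_rsqrt)
    then obtain x where "x \<in> K" "norm x < sqrt (d\<^sup>2 + e)"
      unfolding d_def using cINF_less_iff[OF Kne bdd] by auto
    thus ?thesis
      by (metis norm_ge_zero real_sqrt_less_iff real_sqrt_abs abs_of_nonneg)
  qed
  have "\<exists>x. \<forall>n. x n \<in> K \<and> (norm (x n))\<^sup>2 < d\<^sup>2 + inverse (real (Suc n))"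
    by (intro choice allI) (use close in \<open>simp add: Bex_def\<close>)
  then obtain x where xK: "\<And>n. x n \<in> K"
    and xn: "\<And>n. (norm (x n))\<^sup>2 < d\<^sup>2 + inverse (real (Suc n))" by auto
  have diff: "(norm (x m - x n))\<^sup>2 < 2 * inverse (real (Suc m)) + 2 * inverse (real (Suc n))" for m n
  proof -
    have "(1/2) *\<^sub>R (x m + x n) \<in> K" using xK[of m] xK[of n]
      by (simp add: K_def g.add g.scaleR scaleR_conv_of_real)
    hence "d \<le> norm ((1/2) *\<^sub>R (x m + x n))" by (rule dle)
    hence "2 * d \<le> norm (x m + x n)" by simp
    hence "(2 * d)\<^sup>2 \<le> (norm (x m + x n))\<^sup>2" using d0 by (intro power_mono) auto
    thus ?thesis using cinner_parallelogram[of "x m" "x n"] xn[of m] xn[of n]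
      by (simp add: power_mult_distrib)
  qed
  have "Cauchy x"
  proof (rule metric_CauchyI)
    fix e :: real assume e: "e > 0"
    hence "0 < e\<^sup>2 / 4" by simp
    then obtain N where N: "inverse (real (Suc N)) < e\<^sup>2 / 4" using reals_Archimedean by blast
    have "dist (x m) (x n) < e" if "N \<le> m" "N \<le> n" for m n
    proof -
      have "inverse (real (Suc m)) \<le> inverse (real (Suc N))"
        "inverse (real (Suc n)) \<le> inverse (real (Suc N))" using that by (auto intro!: le_imp_inverse_le)
      hence "(norm (x m - x n))\<^sup>2 < e\<^sup>2" using diff[of m n] N by linarith
      thus ?thesis unfolding dist_norm using e by (meson less_imp_le power_less_imp_less_base)
    qed
    thus "\<exists>N. \<forall>m\<ge>N. \<forall>n\<ge>N. dist (x m) (x n) < e" by blast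
  qed
  then obtain p where p: "x \<longlonglongrightarrow> p" using Cauchy_convergent_iff convergent_def by blast
  have "(\<lambda>n. g (x n)) \<longlonglongrightarrow> g p" by (rule g.tendsto[OF p])
  moreover have "(\<lambda>n. g (x n)) = (\<lambda>n. 1)" using xK by (auto simp: K_def)
  ultimately have gp: "g p = 1" by (simp add: LIMSEQ_const_iff)
  have pd: "(norm p)\<^sup>2 \<le> d\<^sup>2"
  proof (rule LIMSEQ_le)
    show "(\<lambda>n. (norm (x n))\<^sup>2) \<longlonglongrightarrow> (norm p)\<^sup>2" by (intro tendsto_intros p)
    show "(\<lambda>n. d\<^sup>2 + inverse (real (Suc n))) \<longlonglongrightarrow> d\<^sup>2"
      using tendsto_add[OF tendsto_const LIMSEQ_inverse_real_of_nat] by simp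
    show "\<exists>N. \<forall>n\<ge>N. (norm (x n))\<^sup>2 \<le> d\<^sup>2 + inverse (real (Suc n))" using xn less_imp_le by blast
  qed
  have ker: "cinner p v = 0" if v: "g v = 0" for v
  proof (cases "v = 0")
    case nz: False
    let ?t = "cinner v p / cinner v v"
    have "p - ?t *\<^sub>C v \<in> K" by (simp add: K_def g.diff gC gp v)
    hence "d\<^sup>2 \<le> (norm (p - ?t *\<^sub>C v))\<^sup>2" using d0 dle by (intro power_mono) auto
    with cinner_decompose[OF nz, of p] pd have "(cmod (cinner v p))\<^sup>2 / (norm v)\<^sup>2 \<le> 0" by linarith
    hence "cinner v p = 0" using nz by (simp add: divide_le_0_iff)
    thus ?thesis by (metis cinner_commute complex_cnj_zero)
  qed simp
  have pnz: "cinner p p \<noteq> 0" using gp by (auto simp: cinner_self g.zero)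
  show ?thesis
  proof (intro exI[of _ "(1 / cnj (cinner p p)) *\<^sub>C p"] allI)
    fix y
    have "g (y - g y *\<^sub>C p) = 0" by (simp add: g.diff gC gp)
    hence "cinner p (y - g y *\<^sub>C p) = 0" by (rule ker)
    hence "cinner p y = g y * cinner p p" by (simp add: cinner_diff_right cinner_scaleC_right)
    thus "g y = cinner ((1 / cnj (cinner p p)) *\<^sub>C p) y"
      using pnz by (simp add: cinner_scaleC_left)
  qed
qed

instantiation complex :: complex_hilbert_space
begin
definition scaleC_complex :: "complex \<Rightarrow> complex \<Rightarrow> complex" where "scaleC_complex c x = c * x"
definition cinner_complex :: "complex \<Rightarrow> complex \<Rightarrow> complex" where "cinner_complex x y = cnj x * y"
instance
  by standard (auto simp: scaleC_complex_def cinner_complex_def algebra_simps scaleR_conv_of_real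
     complex_norm_square simp flip: of_real_power)
end

instantiation vec :: (complex_vector, finite) complex_vector
begin
definition scaleC_vec :: "complex \<Rightarrow> 'a^'b \<Rightarrow> 'a^'b" where "scaleC_vec c x = (\<chi> i. c *\<^sub>C x $ i)"
instance
  by standard (auto simp: scaleC_vec_def vec_eq_iff scaleC_add_left scaleC_add_right scaleC_scaleC scaleC_of_real)
end

instantiation vec :: (complex_hilbert_space, finite) complex_hilbert_space
begin
definition cinner_vec :: "'a^'b \<Rightarrow> 'a^'b \<Rightarrow> complex" where
  "cinner_vec x y = (\<Sum>i\<in>UNIV. cinner (x $ i) (y $ i))"
instance
proof
  fix x y z :: "'a^'b" and c
  show "cinner x (y + z) = cinner x y + cinner x z"
    by (simp add: cinner_vec_def cinner_add_right sum.distrib)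
  show "cinner x (c *\<^sub>C y) = c * cinner x y"
    by (simp add: cinner_vec_def scaleC_vec_def cinner_scaleC_right sum_distrib_left)
  show "cinner x y = cnj (cinner y x)"
    unfolding cinner_vec_def cnj_sum by (rule sum.cong[OF refl cinner_commute])
  show "cinner x x = complex_of_real ((norm x)\<^sup>2)"
    by (simp add: cinner_vec_def cinner_self norm_vec_def L2_set_def sum_nonneg)
qed
end

(* 1 = 0 is not excluded, so that the zero algebra is an instance; this is why the class extends
   monoid_mult rather than real_normed_algebra_1. *)
class unital_cstar_algebra = complex_vector + real_normed_algebra + monoid_mult + banach +
  fixes star :: "'a \<Rightarrow> 'a"
  assumes mult_scaleC_left: "(c *\<^sub>C x) * y = c *\<^sub>C (x * y)"
    and mult_scaleC_right: "x * (c *\<^sub>C y) = c *\<^sub>C (x * y)"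
    and norm_scaleC: "norm (c *\<^sub>C x) = cmod c * norm x"
    and star_star: "star (star x) = x"
    and star_add: "star (x + y) = star x + star y"
    and star_scaleC: "star (c *\<^sub>C x) = cnj c *\<^sub>C star x"
    and star_mult: "star (x * y) = star y * star x"
    and norm_star_mult_self: "norm (star x * x) = (norm x)\<^sup>2"

(* The C*-algebra B(H) of bounded complex-linear operators; the library type of bounded linear
   functions only asks for real linearity. *)
typedef (overloaded) ('h::complex_hilbert_space) bounded_op =
  "{T :: 'h \<Rightarrow>\<^sub>L 'h. \<forall>c x. blinfun_apply T (c *\<^sub>C x) = c *\<^sub>C blinfun_apply T x}"
  morphisms blinfun_of_op Op
  by (rule exI[of _ 0]) simp

setup_lifting type_definition_bounded_op

definition op_apply :: "'h::complex_hilbert_space bounded_op \<Rightarrow> 'h \<Rightarrow> 'h" where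
  "op_apply T = blinfun_apply (blinfun_of_op T)"

lemma op_eqI: "(\<And>x. op_apply S x = op_apply T x) \<Longrightarrow> S = T"
  unfolding op_apply_def by (simp add: blinfun_of_op_inject[symmetric] blinfun_eqI)

lemma op_apply_scaleC: "op_apply T (c *\<^sub>C x) = c *\<^sub>C op_apply T x"
  unfolding op_apply_def using blinfun_of_op[of T] by simp

lemma bounded_linear_op_apply: "bounded_linear (op_apply T)"
  unfolding op_apply_def by (rule blinfun.bounded_linear_right)

lemma ex_op:
  assumes "bounded_linear f" "\<And>c x. f (c *\<^sub>C x) = c *\<^sub>C f x"
  shows "\<exists>T. op_apply T = f"
proof (intro exI)
  show "op_apply (Op (Blinfun f)) = f"
    unfolding op_apply_def using assms by (simp add: Op_inverse bounded_linear_Blinfun_apply)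
qed

lemma ex_adjoint_op: "\<exists>S. \<forall>x y. cinner (op_apply S x) y = cinner x (op_apply T y)"
proof -
  have "\<exists>z. \<forall>y. cinner x (op_apply T y) = cinner z y" for x
  proof (rule riesz_representation)
    interpret T: bounded_linear "op_apply T" by (rule bounded_linear_op_apply)
    obtain K where K: "\<And>y. norm (op_apply T y) \<le> norm y * K" using T.bounded by blast
    show "bounded_linear (\<lambda>y. cinner x (op_apply T y))"
    proof (rule bounded_linear_intro[where K = "norm x * K"])
      fix y
      show "norm (cinner x (op_apply T y)) \<le> norm y * (norm x * K)"
        using order_trans[OF cinner_Cauchy_Schwarz mult_left_mono[OF K norm_ge_zero]]
        by (simp add: mult_ac)
    qed (simp_all add: T.add op_apply_scaleC cinner_add_right cinner_scaleC_right scaleC_complex_def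
        flip: scaleC_of_real)
  next
    fix c y show "cinner x (op_apply T (c *\<^sub>C y)) = c * cinner x (op_apply T y)"
      by (simp add: op_apply_scaleC cinner_scaleC_right)
  qed
  then obtain s where s: "\<And>x y. cinner (s x) y = cinner x (op_apply T y)" by metis
  have addC: "s (x + y) = s x + s y" for x y
    by (rule cinner_ext_left) (simp add: s cinner_add_left)
  have scC: "s (c *\<^sub>C x) = c *\<^sub>C s x" for c x
    by (rule cinner_ext_left) (simp add: s cinner_scaleC_left)
  obtain K where K: "\<And>y. norm (op_apply T y) \<le> norm y * K"
    using bounded_linear.bounded[OF bounded_linear_op_apply] by blast
  have "bounded_linear s"
  proof (rule bounded_linear_intro[where K = K])
    fix x
    have "(norm (s x))\<^sup>2 = cmod (cinner x (op_apply T (s x)))"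
      by (simp add: s[symmetric] cinner_self norm_power)
    also have "\<dots> \<le> norm x * (norm (s x) * K)"
      using order_trans[OF cinner_Cauchy_Schwarz mult_left_mono[OF K norm_ge_zero]] .
    finally have *: "norm (s x) * norm (s x) \<le> (norm x * K) * norm (s x)"
      by (simp add: power2_eq_square mult_ac)
    show "norm (s x) \<le> norm x * K"
    proof (cases "s x = 0")
      case True
      have "0 \<le> norm x * K" using order_trans[OF norm_ge_zero K] .
      thus ?thesis using True by simp
    next
      case False
      thus ?thesis using * by simp
    qed
  qed (simp_all add: addC scC flip: scaleC_of_real)
  then obtain S where "op_apply S = s" using ex_op scC by blast
  thus ?thesis using s by auto
qed

instantiation bounded_op :: (complex_hilbert_space) real_normed_vector
begin

lift_definition zero_bounded_op :: "'a bounded_op" is 0 by simp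
lift_definition plus_bounded_op :: "'a bounded_op \<Rightarrow> 'a bounded_op \<Rightarrow> 'a bounded_op" is "(+)"
  by (simp add: blinfun.add_left scaleC_add_right)
lift_definition minus_bounded_op :: "'a bounded_op \<Rightarrow> 'a bounded_op \<Rightarrow> 'a bounded_op" is "(-)"
  by (simp add: blinfun.diff_left scaleC_diff_right)
lift_definition uminus_bounded_op :: "'a bounded_op \<Rightarrow> 'a bounded_op" is uminus
  by (simp add: blinfun.minus_left scaleC_minus_right)
lift_definition scaleR_bounded_op :: "real \<Rightarrow> 'a bounded_op \<Rightarrow> 'a bounded_op" is "(*\<^sub>R)"
  by (simp add: blinfun.scaleR_left scaleC_scaleC mult.commute flip: scaleC_of_real)
lift_definition norm_bounded_op :: "'a bounded_op \<Rightarrow> real" is norm .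

definition dist_bounded_op :: "'a bounded_op \<Rightarrow> 'a bounded_op \<Rightarrow> real" where
  "dist_bounded_op S T = norm (S - T)"
definition sgn_bounded_op :: "'a bounded_op \<Rightarrow> 'a bounded_op" where
  "sgn_bounded_op T = inverse (norm T) *\<^sub>R T"
definition uniformity_bounded_op :: "('a bounded_op \<times> 'a bounded_op) filter" where
  "uniformity_bounded_op = (INF e\<in>{0 <..}. principal {(S, T). dist S T < e})"
definition open_bounded_op :: "'a bounded_op set \<Rightarrow> bool" where
  "open_bounded_op U = (\<forall>S\<in>U. \<forall>\<^sub>F (S', T) in uniformity. S' = S \<longrightarrow> T \<in> U)"

lemma op_apply_zero: "op_apply 0 x = 0"
  and op_apply_add: "op_apply (S + T) x = op_apply S x + op_apply T x"
  and op_apply_diff: "op_apply (S - T) x = op_apply S x - op_apply T x"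
  and op_apply_minus: "op_apply (- T) x = - op_apply T x"
  and op_apply_scaleR: "op_apply (r *\<^sub>R T) x = r *\<^sub>R op_apply T x"
  unfolding op_apply_def
  by (transfer; simp add: blinfun.add_left blinfun.diff_left blinfun.minus_left blinfun.scaleR_left)+

instance
proof
  fix R S T :: "'a bounded_op" and r s :: real
  note ops = op_apply_zero op_apply_add op_apply_diff op_apply_minus op_apply_scaleR
  show "R + S + T = R + (S + T)" "R + S = S + R" "0 + S = S" "- S + S = 0" "S - T = S + - T"
    "r *\<^sub>R (S + T) = r *\<^sub>R S + r *\<^sub>R T" "(r + s) *\<^sub>R T = r *\<^sub>R T + s *\<^sub>R T"
    "r *\<^sub>R s *\<^sub>R T = (r * s) *\<^sub>R T" "1 *\<^sub>R T = T"
    by (rule op_eqI; simp add: ops algebra_simps)+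
  show "dist S T = norm (S - T)" by (rule dist_bounded_op_def)
  show "sgn T = inverse (norm T) *\<^sub>R T" by (rule sgn_bounded_op_def)
  show "uniformity = (INF e\<in>{0 <..}. principal {(S, T :: 'a bounded_op). dist S T < e})"
    by (rule uniformity_bounded_op_def)
  show "open U = (\<forall>S\<in>U. \<forall>\<^sub>F (S', T) in uniformity. S' = S \<longrightarrow> T \<in> U)" for U :: "'a bounded_op set"
    by (rule open_bounded_op_def)
  show "norm T = 0 \<longleftrightarrow> T = 0" by transfer simp
  show "norm (S + T) \<le> norm S + norm T" by transfer (rule norm_triangle_ineq)
  show "norm (r *\<^sub>R T) = \<bar>r\<bar> * norm T" by transfer simp
qed

end

instantiation bounded_op :: (complex_hilbert_space) unital_cstar_algebra
begin

lift_definition one_bounded_op :: "'a bounded_op" is id_blinfun by simp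
lift_definition times_bounded_op :: "'a bounded_op \<Rightarrow> 'a bounded_op \<Rightarrow> 'a bounded_op" is "(o\<^sub>L)"
  by simp

definition scaleC_bounded_op :: "complex \<Rightarrow> 'a bounded_op \<Rightarrow> 'a bounded_op" where
  "scaleC_bounded_op c T = (THE S. \<forall>x. op_apply S x = c *\<^sub>C op_apply T x)"
definition star_bounded_op :: "'a bounded_op \<Rightarrow> 'a bounded_op" where
  "star_bounded_op T = (THE S. \<forall>x y. cinner (op_apply S x) y = cinner x (op_apply T y))"

lemma op_apply_one: "op_apply 1 x = x"
  and op_apply_mult: "op_apply (S * T) x = op_apply S (op_apply T x)"
  unfolding op_apply_def by (transfer; simp)+

lemma op_apply_scaleC_left: "op_apply (c *\<^sub>C T) x = c *\<^sub>C op_apply T x"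
proof -
  interpret T: bounded_linear "op_apply T" by (rule bounded_linear_op_apply)
  obtain K where K: "\<And>y. norm (op_apply T y) \<le> norm y * K" using T.bounded by blast
  have "bounded_linear (\<lambda>x. c *\<^sub>C op_apply T x)"
  proof (rule bounded_linear_intro[where K = "cmod c * K"])
    fix x show "norm (c *\<^sub>C op_apply T x) \<le> norm x * (cmod c * K)"
      using mult_left_mono[OF K norm_ge_zero, of c x] by (simp add: norm_scaleC_hilbert mult_ac)
  qed (simp_all add: T.add op_apply_scaleC scaleC_add_right scaleC_scaleC mult.commute flip: scaleC_of_real)
  moreover have "c *\<^sub>C op_apply T (d *\<^sub>C x) = d *\<^sub>C c *\<^sub>C op_apply T x" for d x
    by (simp add: op_apply_scaleC scaleC_scaleC mult.commute)
  ultimately obtain S where S: "op_apply S = (\<lambda>x. c *\<^sub>C op_apply T x)"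
    using ex_op[of "\<lambda>x. c *\<^sub>C op_apply T x"] by auto
  have "\<exists>!S. \<forall>x. op_apply S x = c *\<^sub>C op_apply T x"
  proof (rule ex1I[of _ S])
    fix S' assume "\<forall>x. op_apply S' x = c *\<^sub>C op_apply T x"
    thus "S' = S" by (intro op_eqI) (simp add: S)
  qed (simp add: S)
  from theI'[OF this] show ?thesis unfolding scaleC_bounded_op_def by blast
qed

lemma cinner_star_left: "cinner (op_apply (star T) x) y = cinner x (op_apply T y)"
proof -
  from ex_adjoint_op[of T]
  obtain S where S: "\<forall>x y. cinner (op_apply S x) y = cinner x (op_apply T y)" ..
  have "\<exists>!S. \<forall>x y. cinner (op_apply S x) y = cinner x (op_apply T y)"
  proof (rule ex1I[of _ S])
    fix S' assume S': "\<forall>x y. cinner (op_apply S' x) y = cinner x (op_apply T y)"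
    show "S' = S"
      by (rule op_eqI, rule cinner_ext_left) (simp add: S S')
  qed (rule S)
  from theI'[OF this] show ?thesis unfolding star_bounded_op_def by blast
qed

lemma norm_op_apply: "norm (op_apply T x) \<le> norm T * norm x"
  unfolding op_apply_def by transfer (rule norm_blinfun)

lemma norm_op_bound: "0 \<le> b \<Longrightarrow> (\<And>x. norm (op_apply T x) \<le> b * norm x) \<Longrightarrow> norm T \<le> b"
  unfolding op_apply_def by transfer (rule norm_blinfun_bound)

instance
proof
  fix R S T :: "'a bounded_op" and c d :: complex and r s :: real
  note ops = op_apply_zero op_apply_one op_apply_add op_apply_diff op_apply_minus op_apply_mult
     op_apply_scaleR op_apply_scaleC_left
  have lin: "linear (op_apply T)" for T :: "'a bounded_op"
    by (rule bounded_linear.linear[OF bounded_linear_op_apply])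
  note lins = linear_add[OF lin] linear_diff[OF lin] linear_cmul[OF lin] op_apply_scaleC
  have starr: "cinner x (op_apply (star T) y) = cinner (op_apply T x) y" for x y and T :: "'a bounded_op"
    using cinner_star_left[of T y x] cinner_commute[of x "op_apply (star T) y"]
      cinner_commute[of y "op_apply T x"] by simp
  have ext: "S = T" if "\<And>x y. cinner y (op_apply S x) = cinner y (op_apply T x)" for S T :: "'a bounded_op"
    by (rule op_eqI, rule cinner_ext, rule that)
  show "R * S * T = R * (S * T)" "1 * T = T" "T * 1 = T"
    "(R + S) * T = R * T + S * T" "R * (S + T) = R * S + R * T"
    "r *\<^sub>R S * T = r *\<^sub>R (S * T)" "S * r *\<^sub>R T = r *\<^sub>R (S * T)"
    by (rule op_eqI; simp add: ops lins)+
  show "c *\<^sub>C (S + T) = c *\<^sub>C S + c *\<^sub>C T" "(c + d) *\<^sub>C T = c *\<^sub>C T + d *\<^sub>C T"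
    "c *\<^sub>C d *\<^sub>C T = (c * d) *\<^sub>C T" "complex_of_real r *\<^sub>C T = r *\<^sub>R T"
    "c *\<^sub>C S * T = c *\<^sub>C (S * T)" "S * c *\<^sub>C T = c *\<^sub>C (S * T)"
    by (rule op_eqI; simp add: ops lins scaleC_add_left scaleC_add_right scaleC_scaleC scaleC_of_real)+
  show "star (star T) = T"
    by (rule ext) (simp add: starr cinner_star_left)
  show "star (S + T) = star S + star T"
    by (rule ext) (simp add: starr ops cinner_add_left cinner_add_right)
  show "star (c *\<^sub>C T) = cnj c *\<^sub>C star T"
    by (rule ext) (simp add: starr ops cinner_scaleC_left cinner_scaleC_right)
  show "star (S * T) = star T * star S"
    by (rule ext) (simp add: starr ops)
  show mult: "norm (S * T) \<le> norm S * norm T" for S T :: "'a bounded_op"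
    by transfer (rule norm_blinfun_compose)
  have nn: "0 \<le> norm T" for T :: "'a bounded_op" by transfer simp
  have le: "norm (c *\<^sub>C T) \<le> cmod c * norm T" for c and T :: "'a bounded_op"
    by (rule norm_op_bound)
      (simp_all add: ops nn norm_scaleC_hilbert mult.assoc mult_left_mono norm_op_apply)
  show "norm (c *\<^sub>C T) = cmod c * norm T"
  proof (cases "c = 0")
    case True
    have "c *\<^sub>C T = 0" by (rule op_eqI) (simp add: ops True)
    moreover have "norm (0 :: 'a bounded_op) = 0" by transfer simp
    ultimately show ?thesis using True by simp
  next
    case False
    have "inverse c *\<^sub>C c *\<^sub>C T = T" by (rule op_eqI) (simp add: ops scaleC_scaleC False)
    hence "norm T \<le> cmod (inverse c) * norm (c *\<^sub>C T)" using le[of "inverse c" "c *\<^sub>C T"] by simp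
    hence "cmod c * norm T \<le> norm (c *\<^sub>C T)" using False by (simp add: norm_divide field_simps)
    thus ?thesis using le[of c T] by simp
  qed
  have sq: "(norm T)\<^sup>2 \<le> norm (star T * T)" for T :: "'a bounded_op"
  proof -
    have "norm T \<le> sqrt (norm (star T * T))"
    proof (rule norm_op_bound)
      fix x
      have "(norm (op_apply T x))\<^sup>2 = cmod (cinner x (op_apply (star T * T) x))"
        by (simp add: ops starr cinner_self norm_power)
      also have "\<dots> \<le> norm x * (norm (star T * T) * norm x)"
        by (rule order_trans[OF cinner_Cauchy_Schwarz mult_left_mono[OF norm_op_apply norm_ge_zero]])
      also have "\<dots> = (sqrt (norm (star T * T)) * norm x)\<^sup>2"
        using nn by (simp add: power2_eq_square mult_ac)
      finally show "norm (op_apply T x) \<le> sqrt (norm (star T * T)) * norm x"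
        by (rule power2_le_imp_le) (simp add: nn)
    qed (simp add: nn)
    hence "(norm T)\<^sup>2 \<le> (sqrt (norm (star T * T)))\<^sup>2" by (rule power_mono) (rule nn)
    thus ?thesis using nn by simp
  qed
  have nstar: "norm T \<le> norm (star T)" for T :: "'a bounded_op"
  proof -
    have "norm T * norm T \<le> norm (star T) * norm T"
      using order_trans[OF sq mult] by (simp add: power2_eq_square)
    thus ?thesis using nn[of T] nn[of "star T"] by (cases "norm T = 0") auto
  qed
  have "norm (star T) = norm T" using nstar[of T] nstar[of "star T"]
    by (metis \<open>star (star T) = T\<close> order_antisym)
  thus "norm (star T * T) = (norm T)\<^sup>2"
    using sq[of T] mult[of "star T" T] by (simp add: power2_eq_square)
next
  fix X :: "nat \<Rightarrow> 'a bounded_op"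
  assume X: "Cauchy X"
  have dst: "dist (blinfun_of_op S) (blinfun_of_op T) = dist S T" for S T :: "'a bounded_op"
    unfolding dist_norm dist_bounded_op_def by transfer simp
  have *: "\<exists>M. \<forall>m\<ge>M. \<forall>n\<ge>M. dist (X m) (X n) < e" if "e > 0" for e
    using X that by (simp add: Cauchy_def dist_bounded_op_def)
  have "Cauchy (\<lambda>n. blinfun_of_op (X n))"
    by (rule metric_CauchyI) (simp add: dst *)
  then obtain L where L: "(\<lambda>n. blinfun_of_op (X n)) \<longlonglongrightarrow> L"
    using Cauchy_convergent_iff convergent_def by blast
  have "blinfun_apply L (c *\<^sub>C x) = c *\<^sub>C blinfun_apply L x" for c x
  proof (rule LIMSEQ_unique)
    have app: "(\<lambda>n. blinfun_apply (blinfun_of_op (X n)) y) \<longlonglongrightarrow> blinfun_apply L y" for y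
      by (intro blinfun.tendsto L tendsto_const)
    show "(\<lambda>n. blinfun_apply (blinfun_of_op (X n)) (c *\<^sub>C x)) \<longlonglongrightarrow> blinfun_apply L (c *\<^sub>C x)"
      by (rule app)
    have "bounded_linear (\<lambda>x::'a. c *\<^sub>C x)"
      by (rule bounded_linear_intro[where K = "cmod c"])
        (simp_all add: scaleC_add_right scaleC_scaleC norm_scaleC_hilbert mult.commute flip: scaleC_of_real)
    from bounded_linear.tendsto[OF this app[of x]]
    show "(\<lambda>n. blinfun_apply (blinfun_of_op (X n)) (c *\<^sub>C x)) \<longlonglongrightarrow> c *\<^sub>C blinfun_apply L x"
      by (simp add: op_apply_scaleC[unfolded op_apply_def])
  qed
  then obtain T where T: "blinfun_of_op T = L" using Op_inverse[of L] by auto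
  have "X \<longlonglongrightarrow> T"
    using L by (simp add: lim_sequentially dst flip: T)
  thus "convergent X" by (auto simp: convergent_def)
qed
end

(* The C*-algebra M_n with n = CARD('n). A separate type is needed because multiplication and the norm
   on complex^'n^'n are already instantiated in the library as the entrywise product and the
   Frobenius norm; here they are the matrix product and the operator norm. *)
typedef ('n::finite) cmatrix = "UNIV :: (complex^'n^'n) set"
  morphisms array_of Cmatrix
  by simp

setup_lifting type_definition_cmatrix

lemma matrix_vector_mult_scaleC: "A *v (c *\<^sub>C x) = c *\<^sub>C (A *v x)" for A :: "complex^'n^'m"
  by (simp add: matrix_vector_mult_def scaleC_vec_def scaleC_complex_def vec_eq_iff sum_distrib_left mult_ac)

lemma bounded_linear_matrix_vector_mult: "bounded_linear ((*v) A)" for A :: "complex^'n^'m"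
proof (rule linear_conv_bounded_linear[THEN iffD1], rule linearI)
  fix x y :: "complex^'n" and r :: real
  show "A *v (x + y) = A *v x + A *v y" by (rule matrix_vector_right_distrib)
  show "A *v (r *\<^sub>R x) = r *\<^sub>R (A *v x)"
    using matrix_vector_mult_scaleC[of A "complex_of_real r" x] by (simp add: scaleC_of_real)
qed

definition op_of_matrix :: "'n::finite cmatrix \<Rightarrow> (complex^'n) bounded_op" where
  "op_of_matrix A = (THE T. op_apply T = (*v) (array_of A))"

lemma op_apply_op_of_matrix: "op_apply (op_of_matrix A) = (*v) (array_of A)"
proof -
  obtain T where "op_apply T = (*v) (array_of A)"
    using ex_op[OF bounded_linear_matrix_vector_mult matrix_vector_mult_scaleC] by blast
  hence "\<exists>!T. op_apply T = (*v) (array_of A)" by (metis op_eqI)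
  thus ?thesis unfolding op_of_matrix_def by (rule theI')
qed

lemma op_of_matrix_inject: "op_of_matrix A = op_of_matrix B \<Longrightarrow> A = B"
  by (metis op_apply_op_of_matrix array_of_inject matrix_eq)

lemma op_of_matrix_surj: "\<exists>A. op_of_matrix A = T" for T :: "(complex^'n::finite) bounded_op"
proof -
  have "Vector_Spaces.linear (*s) (*s) (op_apply T)"
  proof unfold_locales
    fix x y :: "complex^'n" and c :: complex
    show "op_apply T (x + y) = op_apply T x + op_apply T y"
      by (rule linear_add[OF bounded_linear.linear[OF bounded_linear_op_apply]])
    show "op_apply T (c *s x) = c *s op_apply T x"
      using op_apply_scaleC[of T c x] by (simp add: scaleC_vec_def scaleC_complex_def vector_scalar_mult_def)
  qed
  hence "op_apply T x = matrix (op_apply T) *v x" for x by (simp add: matrix_works)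
  hence "op_of_matrix (Cmatrix (matrix (op_apply T))) = T"
    by (intro op_eqI) (simp add: op_apply_op_of_matrix Cmatrix_inverse)
  thus ?thesis by blast
qed

instantiation cmatrix :: (finite) real_normed_vector
begin

lift_definition zero_cmatrix :: "'a cmatrix" is 0 .
lift_definition plus_cmatrix :: "'a cmatrix \<Rightarrow> 'a cmatrix \<Rightarrow> 'a cmatrix" is "(+)" .
lift_definition minus_cmatrix :: "'a cmatrix \<Rightarrow> 'a cmatrix \<Rightarrow> 'a cmatrix" is "(-)" .
lift_definition uminus_cmatrix :: "'a cmatrix \<Rightarrow> 'a cmatrix" is uminus .
lift_definition scaleR_cmatrix :: "real \<Rightarrow> 'a cmatrix \<Rightarrow> 'a cmatrix" is "(*\<^sub>R)" .
lift_definition norm_cmatrix :: "'a cmatrix \<Rightarrow> real" is "\<lambda>A. onorm ((*v) A)" .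

definition dist_cmatrix :: "'a cmatrix \<Rightarrow> 'a cmatrix \<Rightarrow> real" where
  "dist_cmatrix A B = norm (A - B)"
definition sgn_cmatrix :: "'a cmatrix \<Rightarrow> 'a cmatrix" where
  "sgn_cmatrix A = inverse (norm A) *\<^sub>R A"
definition uniformity_cmatrix :: "('a cmatrix \<times> 'a cmatrix) filter" where
  "uniformity_cmatrix = (INF e\<in>{0 <..}. principal {(A, B). dist A B < e})"
definition open_cmatrix :: "'a cmatrix set \<Rightarrow> bool" where
  "open_cmatrix U = (\<forall>A\<in>U. \<forall>\<^sub>F (A', B) in uniformity. A' = A \<longrightarrow> B \<in> U)"

lemma op_of_matrix_zero: "op_of_matrix 0 = 0"
  by (rule op_eqI) (simp add: op_apply_op_of_matrix zero_cmatrix.rep_eq op_apply_zero)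

lemma op_of_matrix_add: "op_of_matrix (A + B) = op_of_matrix A + op_of_matrix B"
  by (rule op_eqI)
    (simp add: op_apply_op_of_matrix plus_cmatrix.rep_eq op_apply_add matrix_vector_mult_add_rdistrib)

lemma op_of_matrix_diff: "op_of_matrix (A - B) = op_of_matrix A - op_of_matrix B"
  by (rule op_eqI)
    (simp add: op_apply_op_of_matrix minus_cmatrix.rep_eq op_apply_diff matrix_vector_mult_diff_rdistrib)

lemma op_of_matrix_minus: "op_of_matrix (- A) = - op_of_matrix A"
  by (rule op_eqI)
    (simp add: op_apply_op_of_matrix uminus_cmatrix.rep_eq op_apply_minus matrix_vector_mult_def
       vec_eq_iff sum_negf)

lemma op_of_matrix_scaleR: "op_of_matrix (r *\<^sub>R A) = r *\<^sub>R op_of_matrix A"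
  by (rule op_eqI)
    (simp add: op_apply_op_of_matrix scaleR_cmatrix.rep_eq op_apply_scaleR matrix_vector_mult_def
       vec_eq_iff scaleR_sum_right)

lemma norm_op_of_matrix: "norm (op_of_matrix A) = norm A"
proof -
  have "norm T = onorm (op_apply T)" for T :: "(complex^'a) bounded_op"
    unfolding op_apply_def by transfer (rule norm_blinfun.rep_eq)
  thus ?thesis by (simp add: op_apply_op_of_matrix norm_cmatrix.rep_eq)
qed

instance
proof
  fix A B C :: "'a cmatrix" and r s :: real
  note ops = op_of_matrix_zero op_of_matrix_add op_of_matrix_diff op_of_matrix_minus op_of_matrix_scaleR
  show "A + B + C = A + (B + C)" "A + B = B + A" "0 + A = A" "- A + A = 0" "A - B = A + - B"
    "r *\<^sub>R (A + B) = r *\<^sub>R A + r *\<^sub>R B" "(r + s) *\<^sub>R A = r *\<^sub>R A + s *\<^sub>R A"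
    "r *\<^sub>R s *\<^sub>R A = (r * s) *\<^sub>R A" "1 *\<^sub>R A = A"
    by (rule op_of_matrix_inject; simp add: ops algebra_simps)+
  show "dist A B = norm (A - B)" by (rule dist_cmatrix_def)
  show "sgn A = inverse (norm A) *\<^sub>R A" by (rule sgn_cmatrix_def)
  show "uniformity = (INF e\<in>{0 <..}. principal {(A, B :: 'a cmatrix). dist A B < e})"
    by (rule uniformity_cmatrix_def)
  show "open U = (\<forall>A\<in>U. \<forall>\<^sub>F (A', B) in uniformity. A' = A \<longrightarrow> B \<in> U)" for U :: "'a cmatrix set"
    by (rule open_cmatrix_def)
  show "norm A = 0 \<longleftrightarrow> A = 0"
    by (metis norm_op_of_matrix norm_eq_zero op_of_matrix_inject op_of_matrix_zero)
  show "norm (A + B) \<le> norm A + norm B"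
    by (simp add: ops norm_triangle_ineq flip: norm_op_of_matrix)
  show "norm (r *\<^sub>R A) = \<bar>r\<bar> * norm A"
    by (simp add: ops flip: norm_op_of_matrix)
qed

end

instantiation cmatrix :: (finite) unital_cstar_algebra
begin

lift_definition one_cmatrix :: "'a cmatrix" is "mat 1" .
lift_definition times_cmatrix :: "'a cmatrix \<Rightarrow> 'a cmatrix \<Rightarrow> 'a cmatrix" is "(**)" .
lift_definition scaleC_cmatrix :: "complex \<Rightarrow> 'a cmatrix \<Rightarrow> 'a cmatrix" is "(*\<^sub>C)" .
lift_definition star_cmatrix :: "'a cmatrix \<Rightarrow> 'a cmatrix" is "\<lambda>A. \<chi> i j. cnj (A $ j $ i)" .

lemma op_of_matrix_one: "op_of_matrix 1 = 1"
  by (rule op_eqI) (simp add: op_apply_op_of_matrix one_cmatrix.rep_eq op_apply_one)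

lemma op_of_matrix_mult: "op_of_matrix (A * B) = op_of_matrix A * op_of_matrix B"
  by (rule op_eqI)
    (simp add: op_apply_op_of_matrix times_cmatrix.rep_eq op_apply_mult matrix_vector_mul_assoc)

lemma op_of_matrix_scaleC: "op_of_matrix (c *\<^sub>C A) = c *\<^sub>C op_of_matrix A"
  by (rule op_eqI)
    (simp add: op_apply_op_of_matrix scaleC_cmatrix.rep_eq op_apply_scaleC_left matrix_vector_mult_def
       vec_eq_iff scaleC_vec_def scaleC_complex_def sum_distrib_left mult_ac)

lemma op_of_matrix_star: "op_of_matrix (star A) = star (op_of_matrix A)"
proof (rule op_eqI, rule cinner_ext)
  fix x y :: "complex^'a"
  have "cinner y (op_apply (star (op_of_matrix A)) x) = cinner (array_of A *v y) x"
    by (metis cinner_star_left cinner_commute op_apply_op_of_matrix)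
  also have "\<dots> = (\<Sum>i\<in>UNIV. \<Sum>j\<in>UNIV. cnj (array_of A $ i $ j) * cnj (y $ j) * x $ i)"
    by (simp add: cinner_vec_def cinner_complex_def matrix_vector_mult_def sum_distrib_right)
  also have "\<dots> = (\<Sum>j\<in>UNIV. \<Sum>i\<in>UNIV. cnj (array_of A $ i $ j) * cnj (y $ j) * x $ i)"
    by (rule sum.swap)
  also have "\<dots> = cinner y (op_apply (op_of_matrix (star A)) x)"
    by (simp add: cinner_vec_def cinner_complex_def matrix_vector_mult_def sum_distrib_left
        op_apply_op_of_matrix star_cmatrix.rep_eq mult_ac)
  finally show "cinner y (op_apply (op_of_matrix (star A)) x)
      = cinner y (op_apply (star (op_of_matrix A)) x)" ..
qed

lemmas op_of_matrix_simps =
  op_of_matrix_zero op_of_matrix_one op_of_matrix_add op_of_matrix_diff op_of_matrix_minus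
  op_of_matrix_mult op_of_matrix_scaleC op_of_matrix_scaleR op_of_matrix_star

instance
proof
  fix A B C :: "'a cmatrix" and c d :: complex and r s :: real
  show "A * B * C = A * (B * C)" "1 * A = A" "A * 1 = A"
    "(A + B) * C = A * C + B * C" "A * (B + C) = A * B + A * C"
    "r *\<^sub>R A * B = r *\<^sub>R (A * B)" "A * r *\<^sub>R B = r *\<^sub>R (A * B)"
    "c *\<^sub>C (A + B) = c *\<^sub>C A + c *\<^sub>C B" "(c + d) *\<^sub>C A = c *\<^sub>C A + d *\<^sub>C A"
    "c *\<^sub>C d *\<^sub>C A = (c * d) *\<^sub>C A" "complex_of_real r *\<^sub>C A = r *\<^sub>R A"
    "c *\<^sub>C A * B = c *\<^sub>C (A * B)" "A * c *\<^sub>C B = c *\<^sub>C (A * B)"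
    "star (star A) = A" "star (A + B) = star A + star B" "star (c *\<^sub>C A) = cnj c *\<^sub>C star A"
    "star (A * B) = star B * star A"
    by (rule op_of_matrix_inject; simp add: op_of_matrix_simps algebra_simps scaleC_add_left
        scaleC_add_right scaleC_scaleC scaleC_of_real mult_scaleC_left mult_scaleC_right
        star_star star_add star_scaleC star_mult)+
  show "norm (c *\<^sub>C A) = cmod c * norm A" "norm (A * B) \<le> norm A * norm B" "norm (star A * A) = (norm A)\<^sup>2"
    by (simp_all add: op_of_matrix_simps norm_scaleC norm_mult_ineq norm_star_mult_self
        flip: norm_op_of_matrix)
next
  fix X :: "nat \<Rightarrow> 'a cmatrix"
  assume X: "Cauchy X"
  have dst: "dist (op_of_matrix A) (op_of_matrix B) = dist A B" for A B :: "'a cmatrix"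
    by (simp add: dist_norm dist_cmatrix_def norm_op_of_matrix flip: op_of_matrix_diff)
  have *: "\<exists>M. \<forall>m\<ge>M. \<forall>n\<ge>M. dist (X m) (X n) < e" if "e > 0" for e
    using X that by (simp add: Cauchy_def)
  have "Cauchy (\<lambda>n. op_of_matrix (X n))"
    by (rule metric_CauchyI) (simp add: dst *)
  then obtain L where L: "(\<lambda>n. op_of_matrix (X n)) \<longlonglongrightarrow> L"
    using Cauchy_convergent_iff convergent_def by blast
  obtain A where A: "op_of_matrix A = L" using op_of_matrix_surj by blast
  have "X \<longlonglongrightarrow> A"
    using L by (simp add: lim_sequentially dst flip: A)
  thus "convergent X" by (auto simp: convergent_def)
qed

end

definition complex_linear :: "('a::complex_vector \<Rightarrow> 'b::complex_vector) \<Rightarrow> bool" where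
  "complex_linear \<phi> \<longleftrightarrow>
     (\<forall>x y. \<phi> (x + y) = \<phi> x + \<phi> y) \<and> (\<forall>c x. \<phi> (c *\<^sub>C x) = c *\<^sub>C \<phi> x)"

definition self_adjoint :: "'a::unital_cstar_algebra \<Rightarrow> bool" where
  "self_adjoint a \<longleftrightarrow> star a = a"

(* Also for self-adjoint elements the spectrum is a set of complex numbers; real intervals are
   compared with it through their image under complex_of_real. *)
definition cstar_spectrum :: "'a::unital_cstar_algebra \<Rightarrow> complex set" where
  "cstar_spectrum a = {z. \<not> (\<exists>b. (a - z *\<^sub>C 1) * b = 1 \<and> b * (a - z *\<^sub>C 1) = 1)}"

definition cstar_positive :: "'a::unital_cstar_algebra \<Rightarrow> bool" where
  "cstar_positive a \<longleftrightarrow> self_adjoint a \<and> cstar_spectrum a \<subseteq> complex_of_real ` {0..}"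

definition cstar_le :: "'a::unital_cstar_algebra \<Rightarrow> 'a \<Rightarrow> bool"  (infix "\<preceq>" 50) where
  "a \<preceq> b \<longleftrightarrow> cstar_positive (b - a)"

definition positive_map :: "('a::unital_cstar_algebra \<Rightarrow> 'b::unital_cstar_algebra) \<Rightarrow> bool" where
  "positive_map \<phi> \<longleftrightarrow> (\<forall>x. cstar_positive x \<longrightarrow> cstar_positive (\<phi> x))"

definition contractive :: "('a::real_normed_vector \<Rightarrow> 'b::real_normed_vector) \<Rightarrow> bool" where
  "contractive \<phi> \<longleftrightarrow> (\<forall>x. norm (\<phi> x) \<le> norm x)"

(* Phi is a unital *-homomorphism from C(spectrum of a) to the algebra, sending the identity
   function to a. An element of C(spectrum of a) is represented by any total function that extends it,
   and the last clause says that the choice of the extension is irrelevant. Homomorphisms between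
   C*-algebras are continuous, so Phi is unique on functions that are continuous on the spectrum. *)
definition is_functional_calculus ::
    "'a::unital_cstar_algebra \<Rightarrow> ((complex \<Rightarrow> complex) \<Rightarrow> 'a) \<Rightarrow> bool" where
  "is_functional_calculus a \<Phi> \<longleftrightarrow>
     \<Phi> (\<lambda>z. z) = a \<and> \<Phi> (\<lambda>z. 1) = 1 \<and>
     (\<forall>g c. continuous_on (cstar_spectrum a) g \<longrightarrow>
        \<Phi> (\<lambda>z. c * g z) = c *\<^sub>C \<Phi> g \<and> \<Phi> (\<lambda>z. cnj (g z)) = star (\<Phi> g)) \<and>
     (\<forall>g h. continuous_on (cstar_spectrum a) g \<longrightarrow> continuous_on (cstar_spectrum a) h \<longrightarrow>
        \<Phi> (\<lambda>z. g z + h z) = \<Phi> g + \<Phi> h \<and> \<Phi> (\<lambda>z. g z * h z) = \<Phi> g * \<Phi> h \<and>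
        ((\<forall>z\<in>cstar_spectrum a. g z = h z) \<longrightarrow> \<Phi> g = \<Phi> h))"

(* f(a) for self-adjoint a and f continuous on the (real) spectrum of a. *)
definition functional_calculus :: "(real \<Rightarrow> real) \<Rightarrow> 'a::unital_cstar_algebra \<Rightarrow> 'a" where
  "functional_calculus f a =
     (THE b. \<exists>\<Phi>. is_functional_calculus a \<Phi> \<and> \<Phi> (\<lambda>z. complex_of_real (f (Re z))) = b)"

(* The infinite-dimensional Hilbert space H on which the operators act is given by the type 'h.
   Real and complex dimension are infinite simultaneously, so the real span can be used. *)
definition operator_convex :: "'h::complex_hilbert_space itself \<Rightarrow> real set \<Rightarrow> (real \<Rightarrow> real) \<Rightarrow> bool" where
  "operator_convex H I F \<longleftrightarrow>
     (\<nexists>B :: 'h set. finite B \<and> span B = UNIV) \<and>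
     continuous_on I F \<and>
     (\<forall>(x :: 'h bounded_op) y. \<forall>t\<in>{0..1}.
        self_adjoint x \<and> cstar_spectrum x \<subseteq> complex_of_real ` I \<and>
        self_adjoint y \<and> cstar_spectrum y \<subseteq> complex_of_real ` I \<longrightarrow>
        functional_calculus F (t *\<^sub>R x + (1 - t) *\<^sub>R y)
          \<preceq> t *\<^sub>R functional_calculus F x + (1 - t) *\<^sub>R functional_calculus F y)"

definition characteristic_poly :: "'n::finite cmatrix \<Rightarrow> complex poly" where
  "characteristic_poly A = det (mat [:0, 1:] - (\<chi> i j. [:array_of A $ i $ j:]))"

(* lambda_i for a self-adjoint matrix: the i-th entry, counting from 1, of the non-increasing list of
   roots of the characteristic polynomial repeated according to multiplicity. The roots are real, so Re
   only changes the type. *)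
definition nth_eigenvalue :: "nat \<Rightarrow> 'n::finite cmatrix \<Rightarrow> real" where
  "nth_eigenvalue i A =
     rev (sorted_list_of_multiset (image_mset Re (proots (characteristic_poly A)))) ! (i - 1)"

end

theory Submission
  imports Defs "HOL-Computational_Algebra.Fundamental_Theorem_Algebra"
begin

text \<open>
  Adding the atom \<open>1 - \<phi>(1)\<close> at a point \<open>t\<^sub>0\<close> turns \<open>g \<mapsto> \<phi>(g(a))\<close> into a positive unital map \<open>\<psi>\<close> from
  \<open>C[m,M]\<close> to the matrices. A support line of a convex \<open>f\<close> gives \<open>f(\<langle>\<psi>(id)x,x\<rangle>) \<le> \<langle>\<psi>(f)x,x\<rangle>\<close> for unit
  vectors \<open>x\<close>; applied to eigenvectors of \<open>\<psi>(id)\<close>, this yields the eigenvalue inequalities by the Courant--Fischer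
  and Ky Fan principles. For operator convex \<open>f\<close>, a partition of unity into hat functions replaces \<open>\<psi>\<close> by
  finitely many rank one matrices placed at points \<open>t\<^sub>p\<close>; these dilate to an orthonormal family in the
  infinite-dimensional Hilbert space, and operator convexity is applied to the diagonal operator \<open>D\<close> with
  eigenvalues \<open>t\<^sub>p\<close> and to its reflection \<open>U D U\<close>.
\<close>

section \<open>Spectra of self-adjoint elements\<close>

text \<open>The two halves of the theorem differ only in the atom: it contributes
  \<open>f t0\<close> times the positive matrix \<open>1 - \<phi> 1\<close>, which vanishes for
  unital maps and can only lower the form of \<open>\<psi> f\<close> when
  \<open>f t0 \<le> 0\<close>. Operator convexity is a hypothesis about operators on the single
  space behind 'h, so matrices cannot be inserted into it directly. The partition of unity makes the
  dilation finite, so that a finite orthonormal family suffices and the dimension of 'h, beyond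
  being infinite, does not matter. The functional calculus is a definite description over an
  abstract algebra, so a *-homomorphism must first be constructed and shown to be unique. The crux
  is that the norm of a self-adjoint element is attained on its spectrum. Complex function theory
  and Gelfand's radius formula are replaced by averaging resolvents over roots of unity, along
  exponents that are powers of two, where the C*-identity gives the norms of powers exactly. The
  zero algebra is an instance of the class and its spectra are empty; this is why
  \<open>1 \<noteq> 0\<close> appears as a hypothesis or as a case distinction.\<close>

lemma scaleC_minus_left: "(- c) *\<^sub>C x = - (c *\<^sub>C (x :: 'a::complex_vector))"
  using scaleC_add_left[of c "-c" x] by (simp add: eq_neg_iff_add_eq_0 add.commute)

lemma scaleC_diff_left: "(c - d) *\<^sub>C x = c *\<^sub>C x - d *\<^sub>C (x :: 'a::complex_vector)"
  using scaleC_add_left[of c "-d" x] by (simp add: scaleC_minus_left)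

lemma star_zero [simp]: "star (0 :: 'a::unital_cstar_algebra) = 0"
  using star_add[of 0 0] by simp

lemma star_minus: "star (- x) = - star (x :: 'a::unital_cstar_algebra)"
  using star_add[of x "- x"] by (simp add: eq_neg_iff_add_eq_0 add.commute)

lemma star_diff: "star (x - y) = star x - star (y :: 'a::unital_cstar_algebra)"
  using star_add[of x "- y"] by (simp add: star_minus)

lemma star_one [simp]: "star (1 :: 'a::unital_cstar_algebra) = 1"
  by (metis mult_1_right star_mult star_star)

lemma star_scaleR: "star (r *\<^sub>R x) = r *\<^sub>R star (x :: 'a::unital_cstar_algebra)"
  by (metis complex_cnj_complex_of_real scaleC_of_real star_scaleC)

text \<open>The C*-identity and submultiplicativity give one inequality for every x; applying it to
  \<open>star x\<close> gives the other.\<close>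

lemma norm_star: "norm (star x) = norm (x :: 'a::unital_cstar_algebra)"
proof -
  have le: "norm x \<le> norm (star x)" for x :: 'a
  proof (cases "x = 0")
    case False
    have "norm x * norm x \<le> norm (star x) * norm x"
      using norm_mult_ineq[of "star x" x] by (simp add: norm_star_mult_self power2_eq_square)
    thus ?thesis using False by simp
  qed simp
  show ?thesis using le[of x] le[of "star x"] by (simp add: star_star)
qed

text \<open>An inequality only, because 1 has norm 0 in the zero algebra.\<close>

lemma norm_one_le: "norm (1 :: 'a::unital_cstar_algebra) \<le> 1"
proof (cases "norm (1::'a) = 0")
  case False
  thus ?thesis using norm_star_mult_self[of "1::'a"] by (simp add: power2_eq_square)
qed simp

lemma norm_power_le: "norm ((x :: 'a::unital_cstar_algebra) ^ n) \<le> norm x ^ n"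
proof (induction n)
  case 0
  show ?case by (simp add: norm_one_le)
next
  case (Suc n)
  have "norm (x ^ Suc n) \<le> norm x * norm (x ^ n)" by (simp add: norm_mult_ineq)
  also have "\<dots> \<le> norm x * norm x ^ n" by (rule mult_left_mono[OF Suc norm_ge_zero])
  finally show ?case by simp
qed

lemma self_adjoint_simps:
  fixes a b :: "'a::unital_cstar_algebra"
  shows "self_adjoint (0::'a)" "self_adjoint (1::'a)"
    "self_adjoint a \<Longrightarrow> self_adjoint b \<Longrightarrow> self_adjoint (a + b)"
    "self_adjoint a \<Longrightarrow> self_adjoint b \<Longrightarrow> self_adjoint (a - b)"
    "self_adjoint a \<Longrightarrow> self_adjoint (r *\<^sub>R a)"
    "self_adjoint a \<Longrightarrow> self_adjoint (complex_of_real r *\<^sub>C a)"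
  by (simp_all add: self_adjoint_def star_add star_diff star_scaleR scaleC_of_real)

lemma norm_self_adjoint_square:
  "self_adjoint a \<Longrightarrow> norm (a * a) = (norm (a :: 'a::unital_cstar_algebra))\<^sup>2"
  by (metis norm_star_mult_self self_adjoint_def)

text \<open>Squaring is where the C*-identity applies, so iterating it reaches exactly the exponents
  \<open>2 ^ k\<close>.\<close>

lemma norm_self_adjoint_power:
  assumes "self_adjoint (a :: 'a::unital_cstar_algebra)"
  shows "norm (a ^ 2 ^ k) = norm a ^ 2 ^ k"
proof (induction k)
  case (Suc k)
  have "star (a ^ m) = a ^ m" for m
    using assms by (induction m) (simp_all add: self_adjoint_def star_mult power_commutes)
  hence "norm (a ^ 2 ^ k * a ^ 2 ^ k) = (norm (a ^ 2 ^ k))\<^sup>2"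
    by (intro norm_self_adjoint_square) (simp add: self_adjoint_def)
  thus ?case using Suc by (simp add: power_mult power2_eq_square flip: power_add mult_2)
qed simp

(* The square x^2 + y^2 is (x + i y)* (x + i y), and x is the self-adjoint part of x + i y. *)
lemma norm_square_le_sum_squares:
  fixes x y :: "'a::unital_cstar_algebra"
  assumes x: "self_adjoint x" and y: "self_adjoint y" and xy: "x * y = y * x"
  shows "(norm x)\<^sup>2 \<le> norm (x * x + y * y)"
proof -
  let ?w = "x + \<i> *\<^sub>C y"

  have one: "\<i> *\<^sub>C \<i> *\<^sub>C z = - z" for z :: 'a
    using scaleC_of_real[of "-1" z] by (simp add: scaleC_scaleC)
  have s: "star ?w = x - \<i> *\<^sub>C y"
    using x y by (simp add: self_adjoint_def star_add star_scaleC scaleC_minus_left)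
  have sq: "star ?w * ?w = x * x + y * y"
    unfolding s by (simp add: algebra_simps mult_scaleC_left mult_scaleC_right scaleC_diff_right one xy)
  have "norm (x + x) = norm (?w + star ?w)" by (simp add: s)
  also have "\<dots> \<le> 2 * norm ?w" using norm_triangle_ineq[of ?w "star ?w"] by (simp add: norm_star)
  finally have "norm x \<le> norm ?w" by (simp flip: scaleR_2)
  hence "(norm x)\<^sup>2 \<le> (norm ?w)\<^sup>2" by (simp add: power_mono)
  thus ?thesis by (simp add: sq flip: norm_star_mult_self)
qed

section \<open>Invertible elements and the location of the spectrum\<close>

definition inverse_pair :: "'a::unital_cstar_algebra \<Rightarrow> 'a \<Rightarrow> bool" where
  "inverse_pair x y \<longleftrightarrow> x * y = 1 \<and> y * x = 1"

lemma inverse_pairD: "inverse_pair x y \<Longrightarrow> x * y = 1" "inverse_pair x y \<Longrightarrow> y * x = 1"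
  by (simp_all add: inverse_pair_def)

lemma not_in_spectrum_iff: "z \<notin> cstar_spectrum a \<longleftrightarrow> (\<exists>b. inverse_pair (a - z *\<^sub>C 1) b)"
  by (simp add: cstar_spectrum_def inverse_pair_def)

lemma inverse_pair_scaleC:
  assumes "inverse_pair x y" "c \<noteq> 0"
  shows "inverse_pair (c *\<^sub>C x) (inverse c *\<^sub>C y)"
  using assms by (simp add: inverse_pair_def mult_scaleC_left mult_scaleC_right scaleC_scaleC)

lemma inverse_pair_mult:
  assumes "inverse_pair x y" "inverse_pair z w"
  shows "inverse_pair (x * z) (w * y)"
proof -
  have "(x * z) * (w * y) = x * (z * w) * y" "(w * y) * (x * z) = w * (y * x) * z"
    by (simp_all add: mult.assoc)
  thus ?thesis using assms by (simp add: inverse_pair_def)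
qed

lemma Neumann_series:
  fixes x :: "'a::unital_cstar_algebra"
  assumes "norm x < 1"
  shows "\<exists>y. inverse_pair (1 - x) y"
proof -
  have s: "summable (\<lambda>n. x ^ n)"
    by (rule summable_comparison_test'[of "\<lambda>n. norm x ^ n" 0])
      (use assms in \<open>simp_all add: summable_geometric norm_power_le\<close>)
  define y where "y = (\<Sum>n. x ^ n)"
  have "y = 1 + (\<Sum>n. x ^ Suc n)" using suminf_split_head[OF s] by (simp add: y_def)
  moreover have "(\<Sum>n. x ^ Suc n) = x * y" using suminf_mult[OF s, of x] by (simp add: y_def)
  moreover have "(\<Sum>n. x ^ Suc n) = y * x" using suminf_mult2[OF s, of x]
    by (simp add: y_def power_commutes)
  ultimately have "y - x * y = 1" "y - y * x = 1" by (simp_all add: algebra_simps)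
  thus ?thesis by (intro exI[of _ y]) (simp add: inverse_pair_def left_diff_distrib right_diff_distrib)
qed

text \<open>For z of modulus larger than the norm, the Neumann series inverts 1 - a/z, and a - z is
  -z times this element.\<close>

lemma norm_le_of_in_spectrum:
  fixes a :: "'a::unital_cstar_algebra"
  assumes "z \<in> cstar_spectrum a"
  shows "cmod z \<le> norm a"
proof (rule ccontr)
  assume n: "\<not> cmod z \<le> norm a"
  hence z: "z \<noteq> 0" by (auto simp: not_le intro: le_less_trans[OF norm_ge_zero])
  have "norm (inverse z *\<^sub>C a) < 1" using n z by (simp add: norm_scaleC norm_divide divide_simps inverse_eq_divide)
  from Neumann_series[OF this] obtain y where "inverse_pair (1 - inverse z *\<^sub>C a) y" ..
  from inverse_pair_scaleC[OF this, of "- z"] z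
  have "inverse_pair ((- z) *\<^sub>C (1 - inverse z *\<^sub>C a)) (inverse (- z) *\<^sub>C y)" by simp
  moreover have "(- z) *\<^sub>C (1 - inverse z *\<^sub>C a) = a - z *\<^sub>C 1"
    using z by (simp add: scaleC_diff_right scaleC_scaleC scaleC_minus_left)
  ultimately show False using assms not_in_spectrum_iff by metis
qed

text \<open>If b inverts a - z, then a - w = (a - z)(1 - (w - z) b), and the second factor is
  invertible once |w - z| |b| < 1. The 1 added to the norm of b keeps the radius defined for b =
  0.\<close>

lemma closed_spectrum: "closed (cstar_spectrum (a :: 'a::unital_cstar_algebra))"
  unfolding closed_def open_dist
proof
  fix z assume "z \<in> - cstar_spectrum a"
  then obtain b where b: "inverse_pair (a - z *\<^sub>C 1) b" using not_in_spectrum_iff by blast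
  show "\<exists>e>0. \<forall>w. dist w z < e \<longrightarrow> w \<in> - cstar_spectrum a"
  proof (intro exI[of _ "inverse (norm b + 1)"] conjI allI impI)
    fix w assume w: "dist w z < inverse (norm b + 1)"
    have "dist w z * (norm b + 1) < 1" using w
      by (metis add_nonneg_pos inverse_inverse_eq inverse_positive_iff_positive norm_ge_zero
          pos_less_divide_eq zero_less_one divide_inverse mult.left_neutral)
    hence "cmod (w - z) * norm b < 1" by (simp add: dist_norm algebra_simps)
      (smt (verit) norm_ge_zero)
    hence "norm ((w - z) *\<^sub>C b) < 1" by (simp add: norm_scaleC)
    from Neumann_series[OF this] obtain y where y: "inverse_pair (1 - (w - z) *\<^sub>C b) y" ..
    have "(a - z *\<^sub>C 1) * (1 - (w - z) *\<^sub>C b) = a - z *\<^sub>C 1 - (w - z) *\<^sub>C 1"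
      using inverse_pairD[OF b] by (simp add: right_diff_distrib mult_scaleC_right)
    also have "\<dots> = a - w *\<^sub>C 1" by (simp add: scaleC_diff_left)
    finally have "(a - z *\<^sub>C 1) * (1 - (w - z) *\<^sub>C b) = a - w *\<^sub>C 1" .
    thus "w \<in> - cstar_spectrum a" using inverse_pair_mult[OF b y] not_in_spectrum_iff by auto
  qed (simp add: add_nonneg_pos)
qed

lemma compact_spectrum: "compact (cstar_spectrum (a :: 'a::unital_cstar_algebra))"
  unfolding compact_eq_bounded_closed
  by (auto simp: closed_spectrum intro!: boundedI norm_le_of_in_spectrum)

lemma in_spectrum_shift:
  "z \<in> cstar_spectrum (a + c *\<^sub>C 1) \<longleftrightarrow> z - c \<in> cstar_spectrum (a :: 'a::unital_cstar_algebra)"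
proof -
  have "a + c *\<^sub>C 1 - z *\<^sub>C 1 = a - (z - c) *\<^sub>C 1"
    by (simp add: scaleC_diff_left)
  thus ?thesis unfolding cstar_spectrum_def mem_Collect_eq by (simp only:)
qed

(* If z = p + i q is in the spectrum, then |p + i (q + s)|^2 is at most the norm of a^2 + s^2 for all s. *)
lemma self_adjoint_spectrum_real:
  fixes a :: "'a::unital_cstar_algebra"
  assumes a: "self_adjoint a" and z: "z \<in> cstar_spectrum a"
  shows "Im z = 0"
proof -
  have le: "(Re z)\<^sup>2 + (Im z + s)\<^sup>2 \<le> (norm a)\<^sup>2 + s\<^sup>2" for s
  proof -
    define w where "w = a + (\<i> * of_real s) *\<^sub>C 1"

    have sq: "(\<i> * complex_of_real s) *\<^sub>C (\<i> * complex_of_real s) *\<^sub>C (1::'a) = - ((s\<^sup>2) *\<^sub>R 1)"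
    proof -
      have "(\<i> * complex_of_real s) * (\<i> * complex_of_real s) = complex_of_real (- (s\<^sup>2))"
        by (simp add: power2_eq_square algebra_simps)
      thus ?thesis unfolding scaleC_scaleC by (simp only: scaleC_of_real) simp
    qed
    have "star w = a - (\<i> * of_real s) *\<^sub>C 1"
      using a by (simp add: w_def self_adjoint_def star_add star_scaleC scaleC_minus_left)
    hence "star w * w = (a - (\<i> * of_real s) *\<^sub>C 1) * (a + (\<i> * of_real s) *\<^sub>C 1)" by (simp add: w_def)
    also have "\<dots> = a * a + s\<^sup>2 *\<^sub>R 1"
      by (simp add: algebra_simps mult_scaleC_left mult_scaleC_right scaleC_diff_right sq)
    finally have ww: "star w * w = a * a + s\<^sup>2 *\<^sub>R 1" .
    have "z + \<i> * of_real s \<in> cstar_spectrum w" using z by (simp add: w_def in_spectrum_shift)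
    hence "(cmod (z + \<i> * of_real s))\<^sup>2 \<le> (norm w)\<^sup>2"
      by (intro power_mono norm_le_of_in_spectrum) simp_all
    also have "\<dots> = norm (a * a + s\<^sup>2 *\<^sub>R 1)" by (simp add: ww flip: norm_star_mult_self)
    also have "\<dots> \<le> norm (a * a) + s\<^sup>2 * norm (1::'a)" by (rule order_trans[OF norm_triangle_ineq]) simp
    also have "\<dots> \<le> (norm a)\<^sup>2 + s\<^sup>2"
      using mult_left_mono[OF norm_one_le[where 'a='a], of "s\<^sup>2"]
      by (simp add: norm_self_adjoint_square[OF a])
    finally show ?thesis by (simp add: cmod_power2)
  qed
  show ?thesis
  proof (rule ccontr)
    assume n: "Im z \<noteq> 0"
    have "(norm a)\<^sup>2 \<ge> 2 * Im z * s" for s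
      using le[of s] by (simp add: power2_sum) (smt (verit) zero_le_power2)
    \<comment> \<open>The quadratic terms in s have cancelled, so the bound is linear in s; this s
      makes its right side exceed the squared norm of a by 1.\<close>
    from this[of "((norm a)\<^sup>2 + 1) / (2 * Im z)"] n show False by simp
  qed
qed

text \<open>The partial fraction 2/(1 - x^2) = 1/(1 - x) + 1/(1 + x), in a form that is valid in a
  noncommutative algebra.\<close>

lemma inverse_pair_average:
  fixes x :: "'a::unital_cstar_algebra"
  assumes u: "inverse_pair (1 - x) u" and v: "inverse_pair (1 + x) v"
  shows "inverse_pair (1 - x * x) ((1/2) *\<^sub>R (u + v))"
proof -
  have f: "1 - x * x = (1 + x) * (1 - x)" "1 - x * x = (1 - x) * (1 + x)" by (simp_all add: algebra_simps)
  have "(1 - x * x) * u = 1 + x" "u * (1 - x * x) = 1 + x" "(1 - x * x) * v = 1 - x" "v * (1 - x * x) = 1 - x"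
    using inverse_pairD[OF u] inverse_pairD[OF v]
    by (metis f mult.assoc mult_1_left mult_1_right)+
  moreover have "(1 + x) + (1 - x) = (2::real) *\<^sub>R (1::'a)" by (simp add: scaleR_2)
  ultimately show ?thesis by (simp add: inverse_pair_def distrib_left distrib_right)
qed

(* Averaging over roots of unity: the inverse G k z of 1 - (z a)^(2^k) is an average of values of
   the inverse of 1 - w a over |w| = |z|, hence equicontinuous in k along each ray. *)
lemma iterated_resolvent:
  fixes a :: "'a::unital_cstar_algebra"
  assumes G0: "\<And>z. cmod z \<le> R \<Longrightarrow> inverse_pair (1 - z *\<^sub>C a) (G0 z)"
    and close: "\<And>w. cmod w = 1 \<Longrightarrow> norm (G0 (w * s) - G0 (w * s')) \<le> e"
  shows "\<exists>G. (\<forall>z. cmod z \<le> R \<longrightarrow> inverse_pair (1 - z ^ 2 ^ k *\<^sub>C a ^ 2 ^ k) (G z)) \<and>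
    (\<forall>w. cmod w = 1 \<longrightarrow> norm (G (w * s) - G (w * s')) \<le> e)"
proof (induction k)
  case 0
  show ?case using G0 close by auto
next
  case (Suc k)
  then obtain G where G: "\<And>z. cmod z \<le> R \<Longrightarrow> inverse_pair (1 - z ^ 2 ^ k *\<^sub>C a ^ 2 ^ k) (G z)"
    and Gc: "\<And>w. cmod w = 1 \<Longrightarrow> norm (G (w * s) - G (w * s')) \<le> e" by blast
  \<comment> \<open>A root of unity with \<open>\<zeta> ^ 2 ^ k = -1\<close>: replacing z by \<zeta>
    z changes the sign of the power of z and keeps its modulus, so the partial fraction identity
    applies.\<close>
  define \<zeta> where "\<zeta> = cis (pi / 2 ^ k)"
  have "\<zeta> ^ 2 ^ k = cis (real (2 ^ k) * (pi / 2 ^ k))" unfolding \<zeta>_def by (rule Complex.DeMoivre)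
  hence zk: "\<zeta> ^ 2 ^ k = -1" by simp
  have z1: "cmod \<zeta> = 1" by (simp add: \<zeta>_def)
  define G' where "G' z = (1/2) *\<^sub>R (G z + G (\<zeta> * z))" for z
  show ?case
  proof (intro exI[of _ G'] conjI allI impI)
    fix z assume z: "cmod z \<le> R"
    have "inverse_pair (1 + z ^ 2 ^ k *\<^sub>C a ^ 2 ^ k) (G (\<zeta> * z))"
      using G[of "\<zeta> * z"] z by (simp add: norm_mult z1 power_mult_distrib zk scaleC_minus_left)
    from inverse_pair_average[OF G[OF z] this]
    show "inverse_pair (1 - z ^ 2 ^ Suc k *\<^sub>C a ^ 2 ^ Suc k) (G' z)"
      by (simp add: G'_def mult_scaleC_left mult_scaleC_right scaleC_scaleC mult_2 flip: power_add)
  next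
    fix w assume w: "cmod w = 1"
    have "G' (w * s) - G' (w * s') = (1/2) *\<^sub>R ((G (w * s) - G (w * s')) + (G (\<zeta> * w * s) - G (\<zeta> * w * s')))"
      by (simp add: G'_def algebra_simps)
    also have "norm \<dots> \<le> (1/2) * (norm (G (w * s) - G (w * s')) + norm (G (\<zeta> * w * s) - G (\<zeta> * w * s')))"
      using norm_triangle_ineq by (simp add: divide_right_mono)
    also have "\<dots> \<le> e" using Gc[OF w] Gc[of "\<zeta> * w"] w z1 by (simp add: norm_mult)
    finally show "norm (G' (w * s) - G' (w * s')) \<le> e" .
  qed
qed

text \<open>The resolvent identity g y - g x = g y (f x - f y) g x reduces continuity to local
  boundedness of g. That is not given in advance, and is extracted from the same identity as the
  bound 2 |g x| near x.\<close>

lemma continuous_on_inverse_pair: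
  fixes f g :: "'b::metric_space \<Rightarrow> 'a::unital_cstar_algebra"
  assumes f: "continuous_on S f" and g: "\<And>x. x \<in> S \<Longrightarrow> inverse_pair (f x) (g x)"
  shows "continuous_on S g"
  unfolding continuous_on_def
proof
  fix x assume x: "x \<in> S"
  have fx: "(f \<longlongrightarrow> f x) (at x within S)" using f x by (simp add: continuous_on_def)
  have diff: "g y - g x = g y * (f x - f y) * g x" if "y \<in> S" for y
  proof -
    have "g y * (f x - f y) * g x = g y * (f x * g x) - (g y * f y) * g x"
      by (simp add: algebra_simps)
    thus ?thesis using inverse_pairD[OF g[OF x]] inverse_pairD[OF g[OF that]] by simp
  qed
  have bd: "norm (g y) \<le> 2 * norm (g x)" if "y \<in> S" "norm (f y - f x) * norm (g x) < 1/2" for y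
  proof -
    have "norm (g y) \<le> norm (g x) + norm (g y - g x)" by (metis norm_triangle_sub)
    also have "norm (g y - g x) \<le> norm (g y) * (norm (f y - f x) * norm (g x))"
      unfolding diff[OF that(1)] using norm_mult_ineq[of "g y * (f x - f y)" "g x"]
        mult_right_mono[OF norm_mult_ineq[of "g y" "f x - f y"], of "norm (g x)"]
      by (simp add: norm_minus_commute mult.assoc)
    also have "\<dots> \<le> norm (g y) * (1/2)" using that(2) by (intro mult_left_mono) auto
    finally show ?thesis by simp
  qed
  have "((\<lambda>y. norm (f y - f x) * norm (g x)) \<longlongrightarrow> norm (f x - f x) * norm (g x)) (at x within S)"
    by (intro tendsto_intros fx)
  hence ev: "\<forall>\<^sub>F y in at x within S. norm (f y - f x) * norm (g x) < 1/2"
    by (rule order_tendstoD) simp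
  have "((\<lambda>y. g y - g x) \<longlongrightarrow> 0) (at x within S)"
  proof (rule Lim_null_comparison)
    show "((\<lambda>y. 2 * norm (g x) * norm (f y - f x) * norm (g x)) \<longlongrightarrow> 0) (at x within S)"
      using tendsto_mult[OF tendsto_mult[OF tendsto_const[of "2 * norm (g x)"]
          tendsto_norm_zero[OF LIM_zero[OF fx]]] tendsto_const[of "norm (g x)"]] by simp
    show "\<forall>\<^sub>F y in at x within S. norm (g y - g x) \<le> 2 * norm (g x) * norm (f y - f x) * norm (g x)"
    proof (rule eventually_elim2[OF ev, where Q = "\<lambda>y. y \<in> S"])
      show "\<forall>\<^sub>F y in at x within S. y \<in> S" by (simp add: eventually_at_filter)
      fix y assume y: "norm (f y - f x) * norm (g x) < 1/2" "y \<in> S"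
      have "norm (g y - g x) \<le> norm (g y) * norm (f y - f x) * norm (g x)"
        unfolding diff[OF y(2)] using norm_mult_ineq[of "g y * (f x - f y)" "g x"]
          mult_right_mono[OF norm_mult_ineq[of "g y" "f x - f y"], of "norm (g x)"]
        by (simp add: norm_minus_commute)
      also have "\<dots> \<le> 2 * norm (g x) * norm (f y - f x) * norm (g x)"
        using bd[OF y(2,1)] by (intro mult_right_mono) auto
      finally show "norm (g y - g x) \<le> 2 * norm (g x) * norm (f y - f x) * norm (g x)" .
    qed
  qed
  thus "(g \<longlongrightarrow> g x) (at x within S)" by (rule LIM_zero_cancel)
qed

(* At z = 1/|a| the element (z a)^(2^k) has norm 1, while for slightly smaller z it tends to 0; the inverses
   of 1 - (z a)^(2^k) would nevertheless stay uniformly close if they all existed. *)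
lemma norm_attained_on_spectrum:
  fixes a :: "'a::unital_cstar_algebra"
  assumes a: "self_adjoint a" and nz: "(1::'a) \<noteq> 0"
  shows "\<exists>z\<in>cstar_spectrum a. cmod z = norm a"
proof (cases "a = 0")
  case True
  have "\<not> inverse_pair (0::'a) b" for b using nz by (simp add: inverse_pair_def)
  hence "0 \<in> cstar_spectrum a" using not_in_spectrum_iff[of 0 a] True by auto
  thus ?thesis using True by force
next
  case False
  hence r: "norm a > 0" by simp
  define r where "r = norm a"
  note r = r[folded r_def]
  show ?thesis
  proof (rule ccontr)
    assume *: "\<not> (\<exists>z\<in>cstar_spectrum a. cmod z = norm a)"
    have "\<exists>b. inverse_pair (1 - z *\<^sub>C a) b" if z: "cmod z \<le> 1 / r" for z
    proof (cases "z = 0")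
      case True
      thus ?thesis by (auto simp: inverse_pair_def intro: exI[of _ 1])
    next
      case False
      \<comment> \<open>Moduli above r are outside the spectrum by the norm bound, and modulus
        exactly r by the assumption to be refuted; so 1 - z a is invertible on the whole closed
        disc.\<close>
      have "r \<le> cmod (inverse z)" using z r False by (simp add: norm_divide inverse_eq_divide field_simps)
      hence "inverse z \<notin> cstar_spectrum a"
        using * norm_le_of_in_spectrum[of "inverse z" a] by (force simp: r_def)
      then obtain b where "inverse_pair (a - inverse z *\<^sub>C 1) b" using not_in_spectrum_iff by blast
      from inverse_pair_scaleC[OF this, of "- z"] False show ?thesis
        by (auto simp: scaleC_diff_right scaleC_minus_left scaleC_scaleC)
    qed
    then obtain G0 where G0: "\<And>z. cmod z \<le> 1 / r \<Longrightarrow> inverse_pair (1 - z *\<^sub>C a) (G0 z)" by metis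
    have "continuous_on (cball 0 (1/r)) (\<lambda>z. 1 - z *\<^sub>C a)"
    proof -
      have "bounded_linear (\<lambda>z::complex. z *\<^sub>C a)"
        by (rule bounded_linear_intro[where K = "norm a"])
          (simp_all add: scaleC_add_left norm_scaleC scaleC_scaleC scaleR_conv_of_real flip: scaleC_of_real)
      thus ?thesis by (intro continuous_intros bounded_linear.continuous_on[where g = "\<lambda>x. x"])
    qed
    hence "continuous_on (cball 0 (1/r)) G0"
      by (rule continuous_on_inverse_pair) (simp add: G0)
    hence "uniformly_continuous_on (cball 0 (1/r)) G0"
      by (rule compact_uniformly_continuous) simp
    \<comment> \<open>The constants 1/8 and 1/9 fit together: |y| \<le> 1/9 gives |h - 1| \<le> (|h
      - 1| + 1)/9, hence |h - 1| \<le> 1/8. Together with |g - h| \<le> 1/8 this yields |g - 1|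
      \<le> 1/4, and then |x| \<le> |1 - x|/4 \<le> 1/2, against |x| = 1.\<close>
    then obtain d where d: "d > 0" and
      dG: "\<And>z z'. cmod z \<le> 1/r \<Longrightarrow> cmod z' \<le> 1/r \<Longrightarrow> dist z' z < d \<Longrightarrow> dist (G0 z') (G0 z) < 1/8"
      unfolding uniformly_continuous_on_def by (auto simp: dest!: spec[of _ "1/8"])
    define s where "s = 1 / r"
    \<comment> \<open>Strictly inside the disc but less than d away from s; the maximum covers the
      case d/2 > s.\<close>
    define s' where "s' = max 0 (s - d/2)"
    have s: "0 < s" "0 \<le> s'" "s' < s" "s - s' < d" using r d by (auto simp: s_def s'_def)
    have "s' * r < 1" using s r by (simp add: s_def field_simps)
    hence "\<exists>k. (s' * r) ^ k < 1/9" using s r by (intro real_arch_pow_inv) auto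
    then obtain k0 where k0: "(s' * r) ^ k0 < 1/9" ..
    have "(s' * r) ^ 2 ^ k0 \<le> (s' * r) ^ k0"
      using s r \<open>s' * r < 1\<close> by (intro power_decreasing) auto
    with k0 have small: "(s' * r) ^ 2 ^ k0 \<le> 1/9" by simp
    have close: "norm (G0 (w * of_real s) - G0 (w * of_real s')) \<le> 1/8" if "cmod w = 1" for w
    proof -
      have "dist (w * complex_of_real s') (w * complex_of_real s) = s - s'"
        unfolding dist_norm using s that
        by (simp add: norm_mult flip: right_diff_distrib of_real_diff)
      hence "dist (G0 (w * of_real s)) (G0 (w * of_real s')) < 1/8"
        using s that by (subst dist_commute, intro dG) (auto simp: norm_mult norm_divide s_def)
      thus ?thesis by (simp add: dist_norm)
    qed
    from iterated_resolvent[OF G0 close, where k = k0]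
    obtain G where G: "\<And>z. cmod z \<le> 1/r \<Longrightarrow> inverse_pair (1 - z ^ 2 ^ k0 *\<^sub>C a ^ 2 ^ k0) (G z)"
      and Gc: "\<And>w. cmod w = 1 \<Longrightarrow> norm (G (w * of_real s) - G (w * of_real s')) \<le> 1/8" by blast
    define x where "x = complex_of_real s ^ 2 ^ k0 *\<^sub>C a ^ 2 ^ k0"
    define y where "y = complex_of_real s' ^ 2 ^ k0 *\<^sub>C a ^ 2 ^ k0"
    have nx: "norm x = 1" using s r
      by (simp add: x_def norm_scaleC norm_self_adjoint_power[OF a] norm_power norm_divide s_def power_one_over flip: r_def)
    have ny: "norm y \<le> 1/9" using s small
      by (simp add: y_def norm_scaleC norm_self_adjoint_power[OF a] norm_power power_mult_distrib flip: r_def)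
    let ?g = "G (of_real s)" and ?h = "G (of_real s')"
    have g: "inverse_pair (1 - x) ?g" unfolding x_def using s by (intro G) (simp add: s_def norm_divide)
    have h: "inverse_pair (1 - y) ?h" unfolding y_def using s by (intro G) (simp add: s_def norm_divide)
    have "norm (?g - ?h) \<le> 1/8" using Gc[of 1] by simp
    have h1: "?h - 1 = y * ?h" using inverse_pairD[OF h] by (simp add: left_diff_distrib algebra_simps)
    have "norm (?h - 1) \<le> 1/9 * norm ?h"
      unfolding h1 using order_trans[OF norm_mult_ineq mult_right_mono[OF ny norm_ge_zero]] .
    moreover have "norm ?h \<le> norm (?h - 1) + 1"
      using norm_triangle_ineq[of "?h - 1" 1] norm_one_le[where 'a='a] by simp
    ultimately have "norm (?h - 1) \<le> 1/8" by simp
    hence d4: "norm (?g - 1) \<le> 1/4"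
      using \<open>norm (?g - ?h) \<le> 1/8\<close> norm_triangle_ineq[of "?g - ?h" "?h - 1"] by simp
    have x1: "x = (1 - x) * (?g - 1)" using inverse_pairD[OF g] by (simp add: right_diff_distrib)
    have "norm x \<le> norm (1 - x) * (1/4)"
      by (subst x1) (rule order_trans[OF norm_mult_ineq mult_left_mono[OF d4 norm_ge_zero]])
    also have "norm (1 - x) \<le> 2"
      using norm_triangle_ineq4[of 1 x] norm_one_le[where 'a='a] nx by simp
    finally show False using nx by simp
  qed
qed

section \<open>Continuous functional calculus\<close>

text \<open>Horner's scheme, with complex coefficients and an argument from a noncommutative
  algebra.\<close>

definition peval :: "'a::unital_cstar_algebra \<Rightarrow> complex poly \<Rightarrow> 'a" where
  "peval a p = fold_coeffs (\<lambda>c b. c *\<^sub>C 1 + a * b) p 0"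

lemma peval_0 [simp]: "peval a 0 = 0"
  by (simp add: peval_def)

lemma peval_pCons [simp]: "peval a (pCons c p) = c *\<^sub>C 1 + a * peval a p"
  by (cases "p = 0 \<and> c = 0") (auto simp: peval_def)

lemma peval_add: "peval a (p + q) = peval a p + peval a q"
  by (induction p q rule: poly_induct2) (simp_all add: scaleC_add_left algebra_simps)

lemma peval_smult: "peval a (smult c p) = c *\<^sub>C peval a p"
  by (induction p) (simp_all add: scaleC_add_right scaleC_scaleC mult_scaleC_right)

lemma peval_diff: "peval a (p - q) = peval a p - peval a q"
  using peval_add[of a "p - q" q] by (simp add: eq_diff_eq)

lemma peval_mult: "peval a (p * q) = peval a p * peval a q"
  by (induction p) (simp_all add: peval_add peval_smult mult_scaleC_left algebra_simps)

lemma peval_commutes: "a * peval a p = peval a p * a"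
  by (induction p)
    (simp_all add: mult_scaleC_left mult_scaleC_right distrib_left distrib_right, metis mult.assoc)

lemma star_peval:
  assumes "self_adjoint a"
  shows "star (peval a p) = peval a (map_poly cnj p)"
proof (induction p)
  case (pCons c p)
  thus ?case using assms
    by (simp add: star_add star_scaleC star_mult map_poly_pCons self_adjoint_def peval_commutes)
qed simp

lemma cnj_in_spectrum:
  "self_adjoint a \<Longrightarrow> z \<in> cstar_spectrum a \<Longrightarrow> cnj z = z"
  using self_adjoint_spectrum_real[of a z] by (simp add: complex_eq_iff)

text \<open>Over the complex numbers p splits into linear factors, and each a - w is invertible
  because its root w lies outside the spectrum.\<close>

lemma inverse_pair_peval:
  assumes "p \<noteq> 0" "\<And>w. w \<in> cstar_spectrum a \<Longrightarrow> poly p w \<noteq> 0"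
  shows "\<exists>b. inverse_pair (peval a p) b"
  using assms
proof (induction "degree p" arbitrary: p)
  case 0
  then obtain c where "p = [:c:]" "c \<noteq> 0" by (metis degree_eq_zeroE pCons_eq_0_iff)
  thus ?case using inverse_pair_scaleC[of 1 1 c] by (auto simp: inverse_pair_def)
next
  case (Suc n)
  then obtain w where w: "poly p w = 0"
    using fundamental_theorem_of_algebra[of p] constant_degree[of p] by auto
  then obtain q where q: "p = [:- w, 1:] * q" by (auto simp: poly_eq_0_iff_dvd)
  have "q \<noteq> 0" using q Suc.prems by auto
  moreover from this have "degree p = Suc (degree q)" unfolding q by (subst degree_mult_eq) auto
  ultimately obtain b where b: "inverse_pair (peval a q) b"
    using Suc.hyps Suc.prems q by (metis mult_zero_right poly_mult nat.inject)
  have "w \<notin> cstar_spectrum a" using w Suc.prems by blast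
  then obtain c where "inverse_pair (a - w *\<^sub>C 1) c" using not_in_spectrum_iff by blast
  from inverse_pair_mult[OF this b] show ?case
    by (auto simp: q peval_mult peval_add peval_smult scaleC_minus_left left_diff_distrib mult_scaleC_left
        simp del: mult_pCons_left)
qed

lemma spectrum_peval:
  assumes a: "self_adjoint a" and z: "z \<in> cstar_spectrum (peval a p)"
  shows "\<exists>w\<in>cstar_spectrum a. z = poly p w"
proof (rule ccontr)
  assume n: "\<not> ?thesis"
  have e: "peval a (p - [:z:]) = peval a p - z *\<^sub>C 1" by (simp add: peval_diff)
  \<comment> \<open>If p were the constant z, the assumption \<open>n\<close> would say that the
    spectrum of a is empty. This happens only in the zero algebra, where every element is invertible
    and z could not lie in a spectrum either.\<close>
  have "p - [:z:] \<noteq> 0"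
  proof
    assume "p - [:z:] = 0"
    hence p: "p = [:z:]" by simp
    have "(1::'a) = 0"
    proof (rule ccontr)
      assume "(1::'a) \<noteq> 0"
      with norm_attained_on_spectrum[OF a] n p show False by auto
    qed
    hence "x = y" for x y :: 'a by (metis mult_1_left mult_zero_left)
    hence "inverse_pair (peval a p - z *\<^sub>C 1) 0" by (simp add: inverse_pair_def)
    thus False using z not_in_spectrum_iff by blast
  qed
  from inverse_pair_peval[OF this] n obtain b where "inverse_pair (peval a (p - [:z:])) b" by auto
  thus False using z unfolding e using not_in_spectrum_iff by blast
qed

text \<open>For nonreal coefficients \<open>peval a p\<close> need not be self-adjoint. The
  C*-identity passes to the product of p with its conjugate, whose value is self-adjoint and which
  equals |p|^2 on the real spectrum.\<close>

lemma norm_peval_le: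
  assumes a: "self_adjoint a" and c: "c \<ge> 0" "\<And>z. z \<in> cstar_spectrum a \<Longrightarrow> cmod (poly p z) \<le> c"
  shows "norm (peval a p) \<le> c"
proof (cases "(1::'a) = 0")
  case True
  have "peval a p = 0" using True by (metis mult_1_left mult_zero_left)
  thus ?thesis using c by simp
next
  case False
  let ?q = "map_poly cnj p * p"
  have q: "peval a ?q = star (peval a p) * peval a p" by (simp add: peval_mult star_peval[OF a])
  hence "self_adjoint (peval a ?q)" by (simp add: self_adjoint_def star_mult star_star)
  from norm_attained_on_spectrum[OF this False] obtain z where
    z: "z \<in> cstar_spectrum (peval a ?q)" "cmod z = norm (peval a ?q)" by blast
  from spectrum_peval[OF a z(1)] obtain w where w: "w \<in> cstar_spectrum a" "z = poly ?q w" by blast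
  have "(norm (peval a p))\<^sup>2 = cmod z" using z q by (simp add: norm_star_mult_self)
  also have "\<dots> = (cmod (poly p w))\<^sup>2"
    using cnj_in_spectrum[OF a w(1)] by (simp add: w(2) norm_mult power2_eq_square)
  also have "\<dots> \<le> c\<^sup>2" using c(2)[OF w(1)] by (simp add: power_mono)
  finally show ?thesis using c(1) power2_le_imp_le by blast
qed

text \<open>One sequence of polynomials witnesses both limits. Kept as a relation, so that the
  algebraic laws can be proved before choosing a value; single-valuedness follows from the norm
  bound.\<close>

definition cfc_limit :: "'a::unital_cstar_algebra \<Rightarrow> (complex \<Rightarrow> complex) \<Rightarrow> 'a \<Rightarrow> bool" where
  "cfc_limit a g b \<longleftrightarrow> (\<exists>P. uniform_limit (cstar_spectrum a) (\<lambda>n. poly (P n)) g sequentially \<and>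
     (\<lambda>n. peval a (P n)) \<longlonglongrightarrow> b)"

lemma cfc_limit_norm_le:
  assumes a: "self_adjoint a" and b: "cfc_limit a g b"
    and c: "c \<ge> 0" "\<And>z. z \<in> cstar_spectrum a \<Longrightarrow> cmod (g z) \<le> c"
  shows "norm b \<le> c"
proof (rule field_le_epsilon)
  fix e :: real assume e: "e > 0"
  from b obtain P where P: "uniform_limit (cstar_spectrum a) (\<lambda>n. poly (P n)) g sequentially"
    "(\<lambda>n. peval a (P n)) \<longlonglongrightarrow> b" unfolding cfc_limit_def by blast
  show "norm b \<le> c + e"
  proof (rule Lim_norm_ubound[OF _ P(2)])
    have "\<forall>\<^sub>F n in sequentially. \<forall>z\<in>cstar_spectrum a. dist (poly (P n) z) (g z) < e"
      using P(1) e by (rule uniform_limitD)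
    thus "\<forall>\<^sub>F n in sequentially. norm (peval a (P n)) \<le> c + e"
    proof (rule eventually_mono)
      fix n assume *: "\<forall>z\<in>cstar_spectrum a. dist (poly (P n) z) (g z) < e"
      show "norm (peval a (P n)) \<le> c + e"
      proof (rule norm_peval_le[OF a])
        fix z assume "z \<in> cstar_spectrum a"
        with * c(2)[of z] norm_triangle_sub[of "poly (P n) z" "g z"]
        show "cmod (poly (P n) z) \<le> c + e" by (force simp: dist_norm)
      qed (use c e in simp)
    qed
  qed simp
qed

lemma cfc_limit_diff:
  assumes "cfc_limit a g b" "cfc_limit a h c"
  shows "cfc_limit a (\<lambda>z. g z - h z) (b - c)"
proof -
  from assms obtain P Q where *:
    "uniform_limit (cstar_spectrum a) (\<lambda>n. poly (P n)) g sequentially" "(\<lambda>n. peval a (P n)) \<longlonglongrightarrow> b"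
    "uniform_limit (cstar_spectrum a) (\<lambda>n. poly (Q n)) h sequentially" "(\<lambda>n. peval a (Q n)) \<longlonglongrightarrow> c"
    unfolding cfc_limit_def by blast
  show ?thesis unfolding cfc_limit_def
    by (rule exI[of _ "\<lambda>n. P n - Q n"])
      (use uniform_limit_minus[OF *(1,3)] tendsto_diff[OF *(2,4)] in \<open>simp add: peval_diff poly_diff[abs_def]\<close>)
qed

lemma cfc_limit_unique:
  assumes a: "self_adjoint a" and "cfc_limit a g b" "cfc_limit a h c"
    and "\<And>z. z \<in> cstar_spectrum a \<Longrightarrow> g z = h z"
  shows "b = c"
  using cfc_limit_norm_le[OF a cfc_limit_diff[OF assms(2,3)], of 0] assms(4) by simp

text \<open>The spectrum is real, so Weierstrass approximation of the real and imaginary parts on a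
  compact set of reals is enough. The norm bound for polynomials turns uniform convergence on the
  spectrum into a Cauchy sequence in the algebra.\<close>

lemma cfc_limit_exists:
  assumes a: "self_adjoint a" and g: "continuous_on (cstar_spectrum a) g"
  shows "\<exists>b. cfc_limit a g b"
proof -
  let ?S = "cstar_spectrum a"
  define K where "K = Re ` ?S"
  have K: "compact K" unfolding K_def
    by (intro compact_continuous_image compact_spectrum continuous_intros)
  have ofRe: "complex_of_real (Re z) = z" if "z \<in> ?S" for z
    using self_adjoint_spectrum_real[OF a that] by (simp add: complex_eq_iff)
  have Kc: "continuous_on K (\<lambda>t. g (complex_of_real t))"
    by (rule continuous_on_compose2[OF g]) (auto simp: K_def ofRe intro!: continuous_intros)
  have real_poly: "\<exists>p. \<forall>t\<in>K. cmod (poly p (complex_of_real t) - complex_of_real (h t)) < e"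
    if h: "continuous_on K h" and e: "e > 0" for h :: "real \<Rightarrow> real" and e
  proof -
    obtain q where q: "real_polynomial_function q" "\<And>t. t \<in> K \<Longrightarrow> \<bar>h t - q t\<bar> < e"
      using Stone_Weierstrass_real_polynomial_function[OF K h e] by blast
    then obtain c n where c: "q = (\<lambda>t. \<Sum>i\<le>n. c i * t ^ i)"
      using real_polynomial_function_iff_sum by blast
    have "poly (\<Sum>i\<le>n. monom (complex_of_real (c i)) i) (complex_of_real t) = complex_of_real (q t)" for t
      by (simp add: c poly_sum poly_monom)
    hence "cmod (poly (\<Sum>i\<le>n. monom (complex_of_real (c i)) i) (complex_of_real t) - complex_of_real (h t)) < e"
      if "t \<in> K" for t
      using q(2)[OF that] by (simp add: abs_minus_commute flip: of_real_diff)
    thus ?thesis by blast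
  qed
  have "\<exists>p. \<forall>z\<in>?S. cmod (poly p z - g z) < e" if e: "e > 0" for e
  proof -
    have "continuous_on K (\<lambda>t. Re (g (complex_of_real t)))" by (intro continuous_intros Kc)
    from real_poly[OF this half_gt_zero[OF e]] obtain p1 where p1: "\<And>t. t \<in> K \<Longrightarrow> cmod (poly p1 (of_real t) - of_real (Re (g (of_real t)))) < e/2"
      by blast
    have "continuous_on K (\<lambda>t. Im (g (complex_of_real t)))" by (intro continuous_intros Kc)
    from real_poly[OF this half_gt_zero[OF e]] obtain p2 where p2: "\<And>t. t \<in> K \<Longrightarrow> cmod (poly p2 (of_real t) - of_real (Im (g (of_real t)))) < e/2"
      by blast
    show ?thesis
    proof (intro exI[of _ "p1 + smult \<i> p2"] ballI)
      fix z assume z: "z \<in> ?S"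
      hence t: "Re z \<in> K" by (simp add: K_def)
      have "poly (p1 + smult \<i> p2) z - g z
          = (poly p1 z - of_real (Re (g z))) + \<i> * (poly p2 z - of_real (Im (g z)))"
        by (simp add: algebra_simps complex_eq_iff)
      also have "cmod \<dots> \<le> cmod (poly p1 z - of_real (Re (g z))) + cmod (poly p2 z - of_real (Im (g z)))"
        by (rule order_trans[OF norm_triangle_ineq]) (simp add: norm_mult)
      also have "\<dots> < e" using p1[OF t] p2[OF t] by (simp add: ofRe[OF z])
      finally show "cmod (poly (p1 + smult \<i> p2) z - g z) < e" .
    qed
  qed
  hence "\<exists>P. \<forall>n. \<forall>z\<in>?S. cmod (poly (P n) z - g z) < inverse (real (Suc n))"
    by (intro choice allI) simp
  then obtain P where P: "\<And>n z. z \<in> ?S \<Longrightarrow> cmod (poly (P n) z - g z) < inverse (real (Suc n))" by blast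
  have ul: "uniform_limit ?S (\<lambda>n. poly (P n)) g sequentially"
  proof (rule uniform_limitI)
    fix e :: real assume "e > 0"
    hence "\<forall>\<^sub>F n in sequentially. inverse (real (Suc n)) < e"
      using LIMSEQ_inverse_real_of_nat by (rule order_tendstoD(2)[rotated])
    thus "\<forall>\<^sub>F n in sequentially. \<forall>z\<in>?S. dist (poly (P n) z) (g z) < e"
      by (rule eventually_mono) (use P less_trans in \<open>unfold dist_norm, blast\<close>)
  qed
  have "Cauchy (\<lambda>n. peval a (P n))"
  proof (rule metric_CauchyI)
    fix e :: real assume e: "e > 0"
    then obtain N where N: "inverse (real (Suc N)) < e / 4" using reals_Archimedean[of "e/4"] by auto
    have "dist (peval a (P m)) (peval a (P n)) < e" if "N \<le> m" "N \<le> n" for m n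
    proof -
      have "inverse (real (Suc m)) \<le> inverse (real (Suc N))"
        "inverse (real (Suc n)) \<le> inverse (real (Suc N))" using that by (auto intro!: le_imp_inverse_le)
      hence mn: "inverse (real (Suc m)) < e/4" "inverse (real (Suc n)) < e/4" using N by linarith+
      have "norm (peval a (P m - P n)) \<le> e / 2"
      proof (rule norm_peval_le[OF a])
        fix z assume z: "z \<in> ?S"
        have "poly (P m - P n) z = (poly (P m) z - g z) - (poly (P n) z - g z)" by simp
        also have "cmod \<dots> \<le> cmod (poly (P m) z - g z) + cmod (poly (P n) z - g z)"
          by (rule norm_triangle_ineq4)
        also have "\<dots> \<le> e / 2" using P[OF z, of m] P[OF z, of n] mn by linarith
        finally show "cmod (poly (P m - P n) z) \<le> e / 2" .
      qed (use e in simp)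
      thus ?thesis using e by (simp add: dist_norm peval_diff)
    qed
    thus "\<exists>M. \<forall>m\<ge>M. \<forall>n\<ge>M. dist (peval a (P m)) (peval a (P n)) < e" by blast
  qed
  then obtain b where "(\<lambda>n. peval a (P n)) \<longlonglongrightarrow> b" using Cauchy_convergent_iff convergent_def by blast
  thus ?thesis using ul unfolding cfc_limit_def by blast
qed

section \<open>The constructed calculus and its algebraic laws\<close>

definition cfc :: "'a::unital_cstar_algebra \<Rightarrow> (complex \<Rightarrow> complex) \<Rightarrow> 'a" where
  "cfc a g = (THE b. cfc_limit a g b)"

lemma cfc_limit_cfc:
  assumes "self_adjoint a" "continuous_on (cstar_spectrum a) g"
  shows "cfc_limit a g (cfc a g)"
  unfolding cfc_def
  using theI'[of "cfc_limit a g"] cfc_limit_exists[OF assms] cfc_limit_unique[OF assms(1)] by blast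

lemma cfc_eqI:
  assumes "self_adjoint a" "cfc_limit a g b"
  shows "cfc a g = b"
  unfolding cfc_def using assms(2) cfc_limit_unique[OF assms(1)] by blast

lemma cfc_limit_peval: "cfc_limit a (poly p) (peval a p)"
  unfolding cfc_limit_def by (rule exI[of _ "\<lambda>_. p"]) (simp add: uniform_limit_const)

lemma cfc_limit_add:
  assumes "cfc_limit a g b" "cfc_limit a h c"
  shows "cfc_limit a (\<lambda>z. g z + h z) (b + c)"
proof -
  from assms obtain P Q where *:
    "uniform_limit (cstar_spectrum a) (\<lambda>n. poly (P n)) g sequentially" "(\<lambda>n. peval a (P n)) \<longlonglongrightarrow> b"
    "uniform_limit (cstar_spectrum a) (\<lambda>n. poly (Q n)) h sequentially" "(\<lambda>n. peval a (Q n)) \<longlonglongrightarrow> c"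
    unfolding cfc_limit_def by blast
  show ?thesis unfolding cfc_limit_def
    by (rule exI[of _ "\<lambda>n. P n + Q n"])
      (use uniform_limit_add[OF *(1,3)] tendsto_add[OF *(2,4)] in \<open>simp add: peval_add poly_add[abs_def]\<close>)
qed

lemma cfc_limit_mult:
  assumes "cfc_limit a g b" "cfc_limit a h c"
    and g: "continuous_on (cstar_spectrum a) g" and h: "continuous_on (cstar_spectrum a) h"
  shows "cfc_limit a (\<lambda>z. g z * h z) (b * c)"
proof -
  from assms obtain P Q where *:
    "uniform_limit (cstar_spectrum a) (\<lambda>n. poly (P n)) g sequentially" "(\<lambda>n. peval a (P n)) \<longlonglongrightarrow> b"
    "uniform_limit (cstar_spectrum a) (\<lambda>n. poly (Q n)) h sequentially" "(\<lambda>n. peval a (Q n)) \<longlonglongrightarrow> c"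
    unfolding cfc_limit_def by blast
  \<comment> \<open>Products of uniformly convergent sequences converge uniformly when the limits
    are bounded; compactness of the spectrum provides this.\<close>
  have bd: "bounded (g ` cstar_spectrum a)" "bounded (h ` cstar_spectrum a)"
    using g h by (auto intro!: compact_imp_bounded compact_continuous_image compact_spectrum)
  show ?thesis unfolding cfc_limit_def
    by (rule exI[of _ "\<lambda>n. P n * Q n"])
      (use uniform_lim_mult[OF *(1,3) bd] tendsto_mult[OF *(2,4)] in \<open>simp add: peval_mult poly_mult[abs_def]\<close>)
qed

lemma cfc_limit_star:
  assumes a: "self_adjoint a" and "cfc_limit a g b"
  shows "cfc_limit a (\<lambda>z. cnj (g z)) (star b)"
proof -
  from assms obtain P where *:
    "uniform_limit (cstar_spectrum a) (\<lambda>n. poly (P n)) g sequentially" "(\<lambda>n. peval a (P n)) \<longlonglongrightarrow> b"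
    unfolding cfc_limit_def by blast
  have bl: "bounded_linear (star :: 'a \<Rightarrow> 'a)"
    by (rule bounded_linear_intro[where K = 1]) (simp_all add: star_add star_scaleR norm_star)
  have "uniform_limit (cstar_spectrum a) (\<lambda>n z. cnj (poly (P n) z)) (\<lambda>z. cnj (g z)) sequentially"
    by (rule bounded_linear.uniform_limit[OF bounded_linear_cnj *(1)])
  \<comment> \<open>Conjugating a value of a polynomial amounts to conjugating its coefficients only
    at real arguments, hence the restriction to the spectrum.\<close>
  also have "?this \<longleftrightarrow> uniform_limit (cstar_spectrum a) (\<lambda>n. poly (map_poly cnj (P n))) (\<lambda>z. cnj (g z)) sequentially"
  proof (intro uniform_limit_cong' refl)
    fix n z assume "z \<in> cstar_spectrum a"
    from cnj_in_spectrum[OF a this] show "cnj (poly (P n) z) = poly (map_poly cnj (P n)) z" by simp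
  qed
  finally have 1: "uniform_limit (cstar_spectrum a) (\<lambda>n. poly (map_poly cnj (P n))) (\<lambda>z. cnj (g z)) sequentially" .
  have 2: "(\<lambda>n. peval a (map_poly cnj (P n))) \<longlonglongrightarrow> star b"
    using bounded_linear.tendsto[OF bl *(2)] by (simp add: star_peval[OF a])
  show ?thesis unfolding cfc_limit_def
    by (rule exI[of _ "\<lambda>n. map_poly cnj (P n)"]) (intro conjI 1 2)
qed

lemma cfc_add:
  assumes "self_adjoint a" "continuous_on (cstar_spectrum a) g" "continuous_on (cstar_spectrum a) h"
  shows "cfc a (\<lambda>z. g z + h z) = cfc a g + cfc a h"
  by (intro cfc_eqI cfc_limit_add cfc_limit_cfc assms)

lemma cfc_mult:
  assumes "self_adjoint a" "continuous_on (cstar_spectrum a) g" "continuous_on (cstar_spectrum a) h"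
  shows "cfc a (\<lambda>z. g z * h z) = cfc a g * cfc a h"
  by (intro cfc_eqI cfc_limit_mult cfc_limit_cfc assms)

lemma cfc_star:
  assumes "self_adjoint a" "continuous_on (cstar_spectrum a) g"
  shows "cfc a (\<lambda>z. cnj (g z)) = star (cfc a g)"
  by (intro cfc_eqI cfc_limit_star cfc_limit_cfc assms)

lemma cfc_const:
  assumes "self_adjoint a"
  shows "cfc a (\<lambda>z. c) = c *\<^sub>C 1"
  using cfc_eqI[OF assms cfc_limit_peval[of a "[:c:]"]] by (simp add: poly_pCons[abs_def])

lemma cfc_id:
  assumes "self_adjoint a"
  shows "cfc a (\<lambda>z. z) = a"
  using cfc_eqI[OF assms cfc_limit_peval[of a "[:0, 1:]"]] by (simp add: poly_pCons[abs_def])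

lemma cfc_cong:
  assumes "self_adjoint a" "continuous_on (cstar_spectrum a) g"
    and "\<And>z. z \<in> cstar_spectrum a \<Longrightarrow> g z = h z"
  shows "cfc a g = cfc a h"
proof -
  have "continuous_on (cstar_spectrum a) h" using assms(2,3) continuous_on_cong by metis
  thus ?thesis using cfc_limit_unique[OF assms(1) cfc_limit_cfc cfc_limit_cfc] assms by blast
qed

lemma cfc_scaleC:
  assumes "self_adjoint a" "continuous_on (cstar_spectrum a) g"
  shows "cfc a (\<lambda>z. c * g z) = c *\<^sub>C cfc a g"
  using cfc_mult[OF assms(1) continuous_on_const[of _ c] assms(2)]
  by (simp add: cfc_const[OF assms(1)] mult_scaleC_left)

section \<open>Agreement with the functional calculus of the definitions\<close>

lemma is_functional_calculus_cfc:
  assumes "self_adjoint a"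
  shows "is_functional_calculus a (cfc a)"
  unfolding is_functional_calculus_def
  using assms by (simp add: cfc_id cfc_const cfc_scaleC cfc_star cfc_add cfc_mult) (blast intro: cfc_cong)

(* A functional calculus is contractive: with x = |g| and y = sqrt (c^2 - |g|^2) one has x^2 + y^2 = c^2. *)
lemma is_functional_calculus_norm_le:
  fixes a :: "'a::unital_cstar_algebra"
  assumes F: "is_functional_calculus a \<Phi>" and g: "continuous_on (cstar_spectrum a) g"
    and c: "c \<ge> 0" "\<And>z. z \<in> cstar_spectrum a \<Longrightarrow> cmod (g z) \<le> c"
  shows "norm (\<Phi> g) \<le> c"
proof -
  let ?S = "cstar_spectrum a"
  note F' = F[unfolded is_functional_calculus_def]
  have mult: "\<Phi> (\<lambda>z. u z * v z) = \<Phi> u * \<Phi> v" and add: "\<Phi> (\<lambda>z. u z + v z) = \<Phi> u + \<Phi> v"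
    if "continuous_on ?S u" "continuous_on ?S v" for u v using F' that by blast+
  have cong: "\<Phi> u = \<Phi> v" if "continuous_on ?S u" "continuous_on ?S v" "\<And>z. z \<in> ?S \<Longrightarrow> u z = v z" for u v
    using F' that by blast
  have st: "\<Phi> (\<lambda>z. cnj (u z)) = star (\<Phi> u)" if "continuous_on ?S u" for u using F' that by blast
  define u where "u z = complex_of_real (cmod (g z))" for z
  define v where "v z = complex_of_real (sqrt (c\<^sup>2 - (cmod (g z))\<^sup>2))" for z
  have u: "continuous_on ?S u" unfolding u_def by (intro continuous_intros g)
  have v: "continuous_on ?S v" unfolding v_def by (intro continuous_intros g)
  have sa: "self_adjoint (\<Phi> u)" "self_adjoint (\<Phi> v)"
  proof -
    have "(\<lambda>z. cnj (u z)) = u" "(\<lambda>z. cnj (v z)) = v" by (simp_all add: u_def v_def fun_eq_iff)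
    thus "self_adjoint (\<Phi> u)" "self_adjoint (\<Phi> v)"
      using st[OF u] st[OF v] by (simp_all add: self_adjoint_def)
  qed
  have comm: "\<Phi> u * \<Phi> v = \<Phi> v * \<Phi> u"
    using mult[OF u v] mult[OF v u] by (simp add: mult.commute)
  have gg: "star (\<Phi> g) * \<Phi> g = \<Phi> u * \<Phi> u"
  proof -
    have "star (\<Phi> g) * \<Phi> g = \<Phi> (\<lambda>z. cnj (g z) * g z)"
      using st[OF g] mult[OF continuous_on_cnj[OF g] g] by simp
    also have "\<dots> = \<Phi> (\<lambda>z. u z * u z)"
    proof (rule cong)
      fix z show "cnj (g z) * g z = u z * u z"
        using complex_norm_square[of "g z"] by (simp add: u_def power2_eq_square mult.commute)
    qed (intro continuous_intros g u)+
    finally show ?thesis using mult[OF u u] by simp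
  qed
  have "\<Phi> u * \<Phi> u + \<Phi> v * \<Phi> v = \<Phi> (\<lambda>z. u z * u z + v z * v z)"
    using mult[OF u u] mult[OF v v] add[OF continuous_on_mult[OF u u] continuous_on_mult[OF v v]] by simp
  also have "\<dots> = \<Phi> (\<lambda>z. complex_of_real (c\<^sup>2) * 1)"
  proof (rule cong)
    fix z assume "z \<in> ?S"
    hence "(cmod (g z))\<^sup>2 \<le> c\<^sup>2" using c by (simp add: power_mono)
    thus "u z * u z + v z * v z = complex_of_real (c\<^sup>2) * 1"
      by (simp add: u_def v_def power2_eq_square flip: of_real_mult of_real_add)
  qed (auto intro!: continuous_intros u v)
  also have "\<dots> = complex_of_real (c\<^sup>2) *\<^sub>C \<Phi> (\<lambda>z. 1)"
    using F' continuous_on_const[of ?S "1::complex"] by blast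
  also have "\<Phi> (\<lambda>z. 1) = 1" using F' by blast
  finally have sum: "\<Phi> u * \<Phi> u + \<Phi> v * \<Phi> v = c\<^sup>2 *\<^sub>R 1" by (simp only: scaleC_of_real)
  have "(norm (\<Phi> g))\<^sup>2 = norm (\<Phi> u * \<Phi> u)" by (simp add: gg flip: norm_star_mult_self)
  also have "\<dots> = (norm (\<Phi> u))\<^sup>2" by (rule norm_self_adjoint_square[OF sa(1)])
  also have "\<dots> \<le> norm (c\<^sup>2 *\<^sub>R (1::'a))" using norm_square_le_sum_squares[OF sa comm] by (simp add: sum)
  also have "\<dots> \<le> c\<^sup>2" using mult_left_mono[OF norm_one_le[where 'a='a], of "c\<^sup>2"] by simp
  finally show ?thesis using c(1) power2_le_imp_le by blast
qed

text \<open>The algebraic axioms determine \<Phi> on polynomials. Continuity is not among the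
  axioms, but contractivity, which they imply, carries the agreement over to uniform limits.\<close>

lemma is_functional_calculus_unique:
  assumes a: "self_adjoint a" and F: "is_functional_calculus a \<Phi>" and g: "continuous_on (cstar_spectrum a) g"
  shows "\<Phi> g = cfc a g"
proof -
  let ?S = "cstar_spectrum a"
  note F' = F[unfolded is_functional_calculus_def]
  have mult: "\<Phi> (\<lambda>z. u z * v z) = \<Phi> u * \<Phi> v" and add: "\<Phi> (\<lambda>z. u z + v z) = \<Phi> u + \<Phi> v"
    if "continuous_on ?S u" "continuous_on ?S v" for u v using F' that by blast+
  have sc: "\<Phi> (\<lambda>z. c * u z) = c *\<^sub>C \<Phi> u" if "continuous_on ?S u" for u c using F' that by blast
  have id: "\<Phi> (\<lambda>z. z) = a" and one: "\<Phi> (\<lambda>z. 1) = 1" using F' by blast+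
  have const: "\<Phi> (\<lambda>z. c) = c *\<^sub>C 1" for c using sc[of "\<lambda>z. 1" c] one by simp
  have pc: "continuous_on ?S (poly p)" for p by (intro continuous_intros)
  have P: "\<Phi> (poly p) = peval a p" for p
  proof (induction p)
    case 0
    show ?case using const[of 0] by (simp add: fun_eq_iff[THEN iffD2, of "poly 0" "\<lambda>z. 0"])
  next
    case (pCons c p)
    have "poly (pCons c p) = (\<lambda>z. c + z * poly p z)" by (simp add: fun_eq_iff)
    hence "\<Phi> (poly (pCons c p)) = \<Phi> (\<lambda>z. c + z * poly p z)" by (rule arg_cong)
    also have "\<dots> = c *\<^sub>C 1 + a * peval a p"
      using add[of "\<lambda>z. c" "\<lambda>z. z * poly p z"] mult[of "\<lambda>z. z" "poly p"] pCons pc const id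
      by (simp add: continuous_on_mult continuous_on_id)
    finally show ?case by (simp only: peval_pCons)
  qed
  obtain Q where Q: "uniform_limit ?S (\<lambda>n. poly (Q n)) g sequentially" "(\<lambda>n. peval a (Q n)) \<longlonglongrightarrow> cfc a g"
    using cfc_limit_cfc[OF a g] unfolding cfc_limit_def by blast
  have "(\<lambda>n. peval a (Q n)) \<longlonglongrightarrow> \<Phi> g"
    unfolding tendsto_iff
  proof (intro allI impI)
    fix e :: real assume e: "e > 0"
    hence "\<forall>\<^sub>F n in sequentially. \<forall>z\<in>?S. dist (poly (Q n) z) (g z) < e/2"
      using uniform_limitD[OF Q(1), of "e/2"] by simp
    thus "\<forall>\<^sub>F n in sequentially. dist (peval a (Q n)) (\<Phi> g) < e"
    proof (rule eventually_mono)
      fix n assume *: "\<forall>z\<in>?S. dist (poly (Q n) z) (g z) < e/2"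
      have "norm (\<Phi> (\<lambda>z. poly (Q n) z + (-1) * g z)) \<le> e/2"
        by (rule is_functional_calculus_norm_le[OF F])
          (use * e g in \<open>auto simp: dist_norm less_imp_le intro!: continuous_intros\<close>)
      also have "\<Phi> (\<lambda>z. poly (Q n) z + (-1) * g z) = \<Phi> (poly (Q n)) + (-1) *\<^sub>C \<Phi> g"
        using add[OF pc, of "\<lambda>z. (-1) * g z" "Q n"] sc[OF g, of "-1"] g
        by (simp add: continuous_on_minus)
      finally show "dist (peval a (Q n)) (\<Phi> g) < e" using e by (simp add: P dist_norm scaleC_minus_left)
    qed
  qed
  thus ?thesis using Q(2) LIMSEQ_unique by blast
qed

lemma functional_calculus_eq_cfc:
  assumes a: "self_adjoint a" and f: "continuous_on (Re ` cstar_spectrum a) f"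
  shows "functional_calculus f a = cfc a (\<lambda>z. complex_of_real (f (Re z)))"
proof -
  have "continuous_on (cstar_spectrum a) (\<lambda>z. complex_of_real (f (Re z)))"
    by (intro continuous_intros continuous_on_compose2[OF f]) auto
  thus ?thesis unfolding functional_calculus_def
    using is_functional_calculus_cfc[OF a] is_functional_calculus_unique[OF a] by blast
qed

section \<open>Calculus of real functions on a set containing the spectrum\<close>

lemma Re_spectrum_subset:
  "cstar_spectrum a \<subseteq> complex_of_real ` S \<Longrightarrow> Re ` cstar_spectrum a \<subseteq> S"
  by force

lemma spectrum_subset_of_real:
  assumes "self_adjoint a" "Re ` cstar_spectrum a \<subseteq> S"
  shows "cstar_spectrum a \<subseteq> complex_of_real ` S"
proof
  fix z assume z: "z \<in> cstar_spectrum a"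
  hence "z = complex_of_real (Re z)" "Re z \<in> S"
    using self_adjoint_spectrum_real[OF assms(1) z] assms(2) by (auto simp: complex_eq_iff)
  thus "z \<in> complex_of_real ` S" by blast
qed

lemma continuous_on_Re_spectrum:
  assumes "cstar_spectrum a \<subseteq> complex_of_real ` S" "continuous_on S f"
  shows "continuous_on (cstar_spectrum a) (\<lambda>z. complex_of_real (f (Re z)))"
    "continuous_on (Re ` cstar_spectrum a) f"
  using continuous_on_subset[OF assms(2) Re_spectrum_subset[OF assms(1)]]
  by (auto intro!: continuous_intros continuous_on_compose2[of "Re ` cstar_spectrum a" f])

context
  fixes a :: "'a::unital_cstar_algebra" and S :: "real set"
  assumes a: "self_adjoint a" and S: "cstar_spectrum a \<subseteq> complex_of_real ` S"
begin

lemma functional_calculus_cfc: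
  "continuous_on S f \<Longrightarrow> functional_calculus f a = cfc a (\<lambda>z. complex_of_real (f (Re z)))"
  by (intro functional_calculus_eq_cfc a continuous_on_Re_spectrum(2)[OF S])

lemma functional_calculus_cong:
  assumes "continuous_on S f" "\<And>t. t \<in> S \<Longrightarrow> f t = g t"
  shows "functional_calculus f a = functional_calculus g a"
proof -
  have "continuous_on S g" using assms continuous_on_cong by metis
  thus ?thesis using Re_spectrum_subset[OF S]
    by (subst (1 2) functional_calculus_cfc)
      (auto intro!: cfc_cong a continuous_on_Re_spectrum(1)[OF S] assms)
qed

lemma functional_calculus_add:
  "continuous_on S f \<Longrightarrow> continuous_on S g \<Longrightarrow>
    functional_calculus (\<lambda>t. f t + g t) a = functional_calculus f a + functional_calculus g a"
  using cfc_add[OF a continuous_on_Re_spectrum(1)[OF S] continuous_on_Re_spectrum(1)[OF S], of f g]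
  by (simp add: functional_calculus_cfc continuous_on_add)

lemma functional_calculus_mult:
  "continuous_on S f \<Longrightarrow> continuous_on S g \<Longrightarrow>
    functional_calculus (\<lambda>t. f t * g t) a = functional_calculus f a * functional_calculus g a"
  using cfc_mult[OF a continuous_on_Re_spectrum(1)[OF S] continuous_on_Re_spectrum(1)[OF S], of f g]
  by (simp add: functional_calculus_cfc continuous_on_mult)

lemma functional_calculus_const: "functional_calculus (\<lambda>t. c) a = c *\<^sub>R 1"
  by (simp add: functional_calculus_cfc continuous_on_const cfc_const[OF a] scaleC_of_real)

lemma functional_calculus_scale:
  "continuous_on S f \<Longrightarrow> functional_calculus (\<lambda>t. c * f t) a = c *\<^sub>R functional_calculus f a"
  using functional_calculus_mult[OF continuous_on_const, of f c] by (simp only: functional_calculus_const mult_scaleR_left mult_1_left)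

lemma functional_calculus_id: "functional_calculus (\<lambda>t. t) a = a"
proof -
  have "functional_calculus (\<lambda>t. t) a = cfc a (\<lambda>z. complex_of_real (Re z))"
    by (rule functional_calculus_cfc) (rule continuous_on_id)
  also have "\<dots> = cfc a (\<lambda>z. z)"
    by (intro cfc_cong a continuous_intros)
      (use self_adjoint_spectrum_real[OF a] in \<open>simp add: complex_eq_iff\<close>)
  finally show ?thesis by (simp add: cfc_id[OF a])
qed

lemma self_adjoint_functional_calculus:
  assumes "continuous_on S f"
  shows "self_adjoint (functional_calculus f a)"
  using cfc_star[OF a continuous_on_Re_spectrum(1)[OF S assms]]
  by (simp add: functional_calculus_cfc[OF assms] self_adjoint_def)

end

section \<open>Positivity, square roots and eigenvectors\<close>

lemma cstar_positive_square:
  assumes c: "self_adjoint (c :: 'a::unital_cstar_algebra)"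
  shows "cstar_positive (c * c)"
  unfolding cstar_positive_def
proof
  show "self_adjoint (c * c)" using c by (simp add: self_adjoint_def star_mult)
  show "cstar_spectrum (c * c) \<subseteq> complex_of_real ` {0..}"
  proof
    fix z assume "z \<in> cstar_spectrum (c * c)"
    then obtain w where w: "w \<in> cstar_spectrum c" "z = w * w"
      using spectrum_peval[OF c, of z "[:0, 0, 1:]"] by auto
    hence "z = complex_of_real ((Re w)\<^sup>2)"
      using self_adjoint_spectrum_real[OF c w(1)] by (simp add: complex_eq_iff power2_eq_square)
    thus "z \<in> complex_of_real ` {0..}" using imageI[of "(Re w)\<^sup>2" "{0..}" complex_of_real] by simp
  qed
qed

text \<open>Writing f(a) as the square of (sqrt f)(a) reduces the claim to squares, for which the
  spectral inclusion for polynomials is enough.\<close>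

lemma cstar_positive_functional_calculus:
  assumes a: "self_adjoint a" and S: "cstar_spectrum a \<subseteq> complex_of_real ` S"
    and f: "continuous_on S f" "\<And>t. t \<in> S \<Longrightarrow> 0 \<le> f t"
  shows "cstar_positive (functional_calculus f a)"
proof -
  have c: "continuous_on S (\<lambda>t. sqrt (f t))" by (intro continuous_intros f)
  have "functional_calculus f a = functional_calculus (\<lambda>t. sqrt (f t) * sqrt (f t)) a"
    by (rule functional_calculus_cong[OF a S f(1)]) (simp add: f)
  also have "\<dots> = functional_calculus (\<lambda>t. sqrt (f t)) a * functional_calculus (\<lambda>t. sqrt (f t)) a"
    by (rule functional_calculus_mult[OF a S c c])
  finally show ?thesis
    using cstar_positive_square[OF self_adjoint_functional_calculus[OF a S c]] by simp
qed

text \<open>Translates a condition on the spectrum into one on forms: the form of c * c at x is the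
  squared norm of c x.\<close>

lemma cstar_positive_sqrt:
  assumes "cstar_positive (b :: 'a::unital_cstar_algebra)"
  shows "\<exists>c. self_adjoint c \<and> b = c * c"
proof -
  have b: "self_adjoint b" "cstar_spectrum b \<subseteq> complex_of_real ` {0..}"
    using assms by (simp_all add: cstar_positive_def)
  have c: "continuous_on {0..} sqrt" by (intro continuous_intros)
  have "b = functional_calculus (\<lambda>t. t) b" by (simp add: functional_calculus_id[OF b])
  also have "\<dots> = functional_calculus (\<lambda>t. sqrt t * sqrt t) b"
    by (rule functional_calculus_cong[OF b]) (simp_all add: continuous_on_id)
  also have "\<dots> = functional_calculus sqrt b * functional_calculus sqrt b"
    by (rule functional_calculus_mult[OF b c c])
  finally show ?thesis using self_adjoint_functional_calculus[OF b c] by blast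
qed

text \<open>Confines a spectrum to an interval by a norm estimate alone. This suits the dilated
  operators, which are only controlled around the midpoint of the interval.\<close>

lemma spectrum_subset_if_norm_le:
  assumes x: "self_adjoint x" and n: "norm (x - c *\<^sub>R 1) \<le> r"
  shows "cstar_spectrum x \<subseteq> complex_of_real ` {c - r..c + r}"
proof (rule spectrum_subset_of_real[OF x], clarify)
  fix z assume z: "z \<in> cstar_spectrum x"
  have e: "x - c *\<^sub>R 1 = x + complex_of_real (- c) *\<^sub>C 1" by (simp only: scaleC_of_real) simp
  have "z - complex_of_real c \<in> cstar_spectrum (x - c *\<^sub>R 1)" using z unfolding e in_spectrum_shift by simp
  hence "cmod (z - complex_of_real c) \<le> r" using norm_le_of_in_spectrum n order_trans by blast
  hence "\<bar>Re z - c\<bar> \<le> r" using abs_Re_le_cmod[of "z - complex_of_real c"] by simp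
  thus "Re z \<in> {c - r..c + r}" by (simp add: abs_le_iff)
qed

(* Applied to L x = x u for an eigenvector u of a with eigenvalue l. *)
lemma functional_calculus_eigen:
  fixes L :: "'a::unital_cstar_algebra \<Rightarrow> 'v::complex_hilbert_space"
  assumes a: "self_adjoint a" and S: "cstar_spectrum a \<subseteq> complex_of_real ` S" and f: "continuous_on S f"
    and L: "bounded_linear L" "\<And>c x. L (c *\<^sub>C x) = c *\<^sub>C L x"
    and eig: "\<And>x. L (x * a) = l *\<^sub>C L x" and l: "l \<in> cstar_spectrum a"
  shows "L (functional_calculus f a) = complex_of_real (f (Re l)) *\<^sub>C L 1"
proof -
  interpret L: bounded_linear L by (rule L(1))

  have P: "L (peval a p) = poly p l *\<^sub>C L 1" for p
    by (induction p) (simp_all add: L.zero L.add L(2) peval_commutes eig scaleC_add_left scaleC_scaleC)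
  let ?g = "\<lambda>z. complex_of_real (f (Re z))"
  obtain P where *: "uniform_limit (cstar_spectrum a) (\<lambda>n. poly (P n)) ?g sequentially"
    "(\<lambda>n. peval a (P n)) \<longlonglongrightarrow> functional_calculus f a"
    using cfc_limit_cfc[OF a continuous_on_Re_spectrum(1)[OF S f]]
    unfolding cfc_limit_def functional_calculus_cfc[OF a S f] by blast
  have 1: "(\<lambda>n. poly (P n) l *\<^sub>C L 1) \<longlonglongrightarrow> L (functional_calculus f a)"
    using L.tendsto[OF *(2)] by (simp add: P)
  have "bounded_linear (\<lambda>c. c *\<^sub>C L 1)"
    by (rule bounded_linear_intro[where K = "norm (L 1)"])
      (simp_all add: scaleC_add_left norm_scaleC_hilbert scaleC_scaleC scaleR_conv_of_real flip: scaleC_of_real)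
  from bounded_linear.tendsto[OF this tendsto_uniform_limitI[OF *(1) l]]
  show ?thesis using 1 LIMSEQ_unique by blast
qed

lemma op_apply_sum: "op_apply (sum T A) x = (\<Sum>i\<in>A. op_apply (T i) x)"
  by (induction A rule: infinite_finite_induct) (simp_all add: op_apply_zero op_apply_add)

lemma functional_calculus_op_eigenvector:
  fixes X :: "'h::complex_hilbert_space bounded_op"
  assumes X: "self_adjoint X" and S: "cstar_spectrum X \<subseteq> complex_of_real ` S" and f: "continuous_on S f"
    and u: "op_apply X u = complex_of_real l *\<^sub>C u" "u \<noteq> 0"
  shows "l \<in> S \<and> op_apply (functional_calculus f X) u = f l *\<^sub>R u"
proof -
  \<comment> \<open>An inverse of X - l would recover the nonzero vector u from its image 0.\<close>
  have l: "complex_of_real l \<in> cstar_spectrum X"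
  proof (rule ccontr)
    assume "complex_of_real l \<notin> cstar_spectrum X"
    then obtain b where "inverse_pair (X - complex_of_real l *\<^sub>C 1) b" using not_in_spectrum_iff by blast
    hence "b * (X - complex_of_real l *\<^sub>C 1) = 1" by (rule inverse_pairD)
    hence "u = op_apply (b * (X - complex_of_real l *\<^sub>C 1)) u" by (simp add: op_apply_one)
    also have "\<dots> = op_apply b (op_apply X u - complex_of_real l *\<^sub>C u)"
      by (simp add: op_apply_mult op_apply_diff op_apply_scaleC_left op_apply_one)
    finally show False using u
      by (simp add: linear_0[OF bounded_linear.linear[OF bounded_linear_op_apply]])
  qed
  have "bounded_linear (\<lambda>T. op_apply T u)"
    by (rule bounded_linear_intro[where K = "norm u"])
      (simp_all add: op_apply_add op_apply_scaleR norm_op_apply)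
  from functional_calculus_eigen[OF X S f this _ _ l] u
  have "op_apply (functional_calculus f X) u = complex_of_real (f l) *\<^sub>C u"
    by (simp add: op_apply_scaleC_left op_apply_mult op_apply_scaleC op_apply_one)
  thus ?thesis using l S by (auto simp: scaleC_of_real)
qed

section \<open>Hermitian matrices and their eigenvalues\<close>

abbreviation mv :: "'n::finite cmatrix \<Rightarrow> complex^'n \<Rightarrow> complex^'n" where
  "mv A \<equiv> op_apply (op_of_matrix A)"

lemma mv_simps:
  "mv 0 x = 0" "mv 1 x = x" "mv (A + B) x = mv A x + mv B x" "mv (A - B) x = mv A x - mv B x"
  "mv (A * B) x = mv A (mv B x)" "mv (r *\<^sub>R A) x = r *\<^sub>R mv A x" "mv (c *\<^sub>C A) x = c *\<^sub>C mv A x"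
  by (simp_all add: op_of_matrix_simps op_apply_zero op_apply_one op_apply_add op_apply_diff op_apply_mult
      op_apply_scaleR op_apply_scaleC_left)

lemma mv_linear:
  "mv A 0 = 0" "mv A (x + y) = mv A x + mv A y" "mv A (x - y) = mv A x - mv A y"
  "mv A (r *\<^sub>R x) = r *\<^sub>R mv A x" "mv A (c *\<^sub>C x) = c *\<^sub>C mv A x"
  "mv A (\<Sum>i\<in>I. h i) = (\<Sum>i\<in>I. mv A (h i))"
proof -
  have lin: "linear (mv A)" by (rule bounded_linear.linear[OF bounded_linear_op_apply])
  show "mv A 0 = 0" "mv A (x + y) = mv A x + mv A y" "mv A (x - y) = mv A x - mv A y"
    "mv A (r *\<^sub>R x) = r *\<^sub>R mv A x" "mv A (c *\<^sub>C x) = c *\<^sub>C mv A x"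
    "mv A (\<Sum>i\<in>I. h i) = (\<Sum>i\<in>I. mv A (h i))"
    by (simp_all add: linear_0[OF lin] linear_add[OF lin] linear_diff[OF lin] linear_cmul[OF lin]
        op_apply_scaleC linear_sum[OF lin])
qed

lemma cinner_mv_self_adjoint:
  "self_adjoint A \<Longrightarrow> cinner (mv A x) y = cinner x (mv A y)"
  using cinner_star_left[of "op_of_matrix A" x y] by (simp add: self_adjoint_def flip: op_of_matrix_star)

lemma functional_calculus_mv_eigenvector:
  fixes A :: "'n::finite cmatrix"
  assumes A: "self_adjoint A" and S: "cstar_spectrum A \<subseteq> complex_of_real ` S" and f: "continuous_on S f"
    and u: "mv A u = complex_of_real l *\<^sub>C u" "u \<noteq> 0"
  shows "l \<in> S \<and> mv (functional_calculus f A) u = f l *\<^sub>R u"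
proof -
  have l: "complex_of_real l \<in> cstar_spectrum A"
  proof (rule ccontr)
    assume "complex_of_real l \<notin> cstar_spectrum A"
    then obtain b where "inverse_pair (A - complex_of_real l *\<^sub>C 1) b" using not_in_spectrum_iff by blast
    hence "b * (A - complex_of_real l *\<^sub>C 1) = 1" by (rule inverse_pairD)
    hence "u = mv (b * (A - complex_of_real l *\<^sub>C 1)) u" by (simp add: mv_simps)
    also have "\<dots> = mv b (mv A u - complex_of_real l *\<^sub>C u)"
      by (simp only: mv_simps)
    finally show False using u by (simp add: mv_linear)
  qed
  have "bounded_linear (\<lambda>T. mv T u)"
    by (rule bounded_linear_intro[where K = "norm u"])
      (simp_all add: mv_simps norm_op_apply flip: norm_op_of_matrix)
  from functional_calculus_eigen[OF A S f this _ _ l] u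
  have "mv (functional_calculus f A) u = complex_of_real (f l) *\<^sub>C u"
    by (simp add: mv_simps mv_linear)
  thus ?thesis using l S by (auto simp: scaleC_of_real)
qed

text \<open>An injective square matrix has a left inverse, which is then two-sided. Hence every
  point of the spectrum of a matrix is an eigenvalue.\<close>

lemma exists_mv_kernel:
  fixes A :: "'n::finite cmatrix"
  assumes "\<nexists>b. inverse_pair A b"
  shows "\<exists>x. x \<noteq> 0 \<and> mv A x = 0"
proof (rule ccontr)
  assume "\<not> ?thesis"
  hence "\<forall>x. array_of A *v x = 0 \<longrightarrow> x = 0" by (auto simp: op_apply_op_of_matrix)
  then obtain B where B: "B ** array_of A = mat 1" using matrix_left_invertible_ker by blast
  hence "array_of A ** B = mat 1" using matrix_left_right_inverse by blast
  with B have "inverse_pair A (Cmatrix B)"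
    by (simp add: inverse_pair_def times_cmatrix_def one_cmatrix_def Cmatrix_inverse)
  thus False using assms by blast
qed

text \<open>For self-adjoint A the inner product is already real; \<open>Re\<close> only makes the
  value comparable.\<close>

definition qform :: "'n::finite cmatrix \<Rightarrow> complex^'n \<Rightarrow> real" where
  "qform A x = Re (cinner x (mv A x))"

lemma qform_simps:
  "qform 0 x = 0" "qform 1 x = (norm x)\<^sup>2" "qform (A + B) x = qform A x + qform B x"
  "qform (A - B) x = qform A x - qform B x" "qform (r *\<^sub>R A) x = r * qform A x"
  unfolding qform_def mv_simps scaleC_of_real[symmetric]
  by (simp_all add: cinner_add_right cinner_diff_right cinner_self cinner_scaleC_right)

lemma qform_sum: "qform (\<Sum>i\<in>I. A i) x = (\<Sum>i\<in>I. qform (A i) x)"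
  by (induction I rule: infinite_finite_induct) (simp_all add: qform_simps)

lemma qform_nonneg:
  assumes "cstar_positive A"
  shows "0 \<le> qform A x"
proof -
  obtain C where C: "self_adjoint C" "A = C * C" using cstar_positive_sqrt[OF assms] by blast
  have "qform A x = Re (cinner (mv C x) (mv C x))"
    by (simp add: qform_def C(2) mv_simps cinner_mv_self_adjoint[OF C(1)])
  thus ?thesis by (simp add: cinner_self)
qed

text \<open>At an eigenvector the form is the eigenvalue times the squared norm. With
  \<open>qform_nonneg\<close> this makes the order of matrices an order of forms.\<close>

lemma cstar_positive_cmatrixI:
  assumes A: "self_adjoint A" and q: "\<And>x. 0 \<le> qform A x"
  shows "cstar_positive A"
  unfolding cstar_positive_def
proof (intro conjI A spectrum_subset_of_real[OF A] subsetI)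
  fix t assume "t \<in> Re ` cstar_spectrum A"
  then obtain z where z: "z \<in> cstar_spectrum A" "t = Re z" by blast
  from exists_mv_kernel[of "A - z *\<^sub>C 1"] not_in_spectrum_iff[of z A] z(1)
  obtain x where x: "x \<noteq> 0" "mv (A - z *\<^sub>C 1) x = 0" by blast
  hence "mv A x = z *\<^sub>C x" by (simp add: mv_simps)
  hence "qform A x = Re z * (norm x)\<^sup>2" by (simp add: qform_def cinner_scaleC_right cinner_self)
  with q[of x] x(1) z(2) show "t \<in> {0..}" by (simp add: zero_le_mult_iff)
qed

section \<open>Orthonormal families and orthogonal complements\<close>

lemma cinner_sum_right: "cinner x (\<Sum>i\<in>I. h i) = (\<Sum>i\<in>I. cinner x (h i))"
  by (induction I rule: infinite_finite_induct) (simp_all add: cinner_add_right)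

lemma cinner_sum_left: "cinner (\<Sum>i\<in>I. h i) x = (\<Sum>i\<in>I. cinner (h i) x)"
  by (induction I rule: infinite_finite_induct) (simp_all add: cinner_add_left)

lemma cinner_scaleR: "cinner (r *\<^sub>R x) y = of_real r * cinner x y" "cinner x (r *\<^sub>R y) = of_real r * cinner x y"
  unfolding scaleC_of_real[symmetric] by (simp_all add: cinner_scaleC_left cinner_scaleC_right)

lemma bounded_bilinear_cinner: "bounded_bilinear (cinner :: 'h::complex_hilbert_space \<Rightarrow> 'h \<Rightarrow> complex)"
  by standard (auto simp: cinner_add_left cinner_add_right cinner_scaleR scaleR_conv_of_real
      intro!: exI[of _ 1] cinner_Cauchy_Schwarz)

definition orthonormal_on :: "'i set \<Rightarrow> ('i \<Rightarrow> 'h::complex_hilbert_space) \<Rightarrow> bool" where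
  "orthonormal_on S u \<longleftrightarrow> (\<forall>i\<in>S. \<forall>j\<in>S. cinner (u i) (u j) = (if i = j then 1 else 0))"

lemma orthonormal_on_cinner:
  "orthonormal_on S u \<Longrightarrow> i \<in> S \<Longrightarrow> j \<in> S \<Longrightarrow> cinner (u i) (u j) = (if i = j then 1 else 0)"
  by (simp add: orthonormal_on_def)

lemma orthonormal_on_subset: "orthonormal_on S u \<Longrightarrow> T \<subseteq> S \<Longrightarrow> orthonormal_on T u"
  by (simp add: orthonormal_on_def subset_iff)

lemma orthonormal_on_compose: "orthonormal_on (e ` S) u \<Longrightarrow> inj_on e S \<Longrightarrow> orthonormal_on S (u \<circ> e)"
  by (auto simp: orthonormal_on_def inj_on_def)

lemma cinner_orthonormal_sum:
  assumes "orthonormal_on S u" "finite S" "j \<in> S"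
  shows "cinner (u j) (\<Sum>i\<in>S. c i *\<^sub>C u i) = c j"
proof -
  have "cinner (u j) (\<Sum>i\<in>S. c i *\<^sub>C u i) = (\<Sum>i\<in>S. c i * cinner (u j) (u i))"
    by (simp add: cinner_sum_right cinner_scaleC_right)
  also have "\<dots> = (\<Sum>i\<in>S. if j = i then c i else 0)"
    by (intro sum.cong refl) (simp add: orthonormal_on_cinner[OF assms(1,3)])
  finally have "cinner (u j) (\<Sum>i\<in>S. c i *\<^sub>C u i) = (\<Sum>i\<in>S. if j = i then c i else 0)" .
  thus ?thesis using assms by simp
qed

lemma cinner_two_orthonormal_sums:
  assumes "orthonormal_on S u" "finite S"
  shows "cinner (\<Sum>i\<in>S. c i *\<^sub>C u i) (\<Sum>i\<in>S. d i *\<^sub>C u i) = (\<Sum>i\<in>S. cnj (c i) * d i)"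
  by (subst cinner_sum_left) (simp add: cinner_scaleC_left cinner_orthonormal_sum[OF assms])

lemma cnj_mult_self: "cnj z * z = of_real ((cmod z)\<^sup>2)"
  using complex_norm_square[of z] by (simp add: mult.commute)

lemma norm_orthonormal_sum:
  assumes "orthonormal_on S u" "finite S"
  shows "(norm (\<Sum>i\<in>S. c i *\<^sub>C u i))\<^sup>2 = (\<Sum>i\<in>S. (cmod (c i))\<^sup>2)"
  by (simp add: norm_sq_cinner cinner_two_orthonormal_sums[OF assms] cnj_mult_self del: of_real_power)

lemma Bessel_inequality:
  assumes "orthonormal_on S u" "finite S"
  shows "(\<Sum>i\<in>S. (cmod (cinner (u i) x))\<^sup>2) \<le> (norm x)\<^sup>2"
proof -
  let ?y = "\<Sum>i\<in>S. cinner (u i) x *\<^sub>C u i"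
  have yx: "cinner ?y x = of_real ((norm ?y)\<^sup>2)"
    unfolding norm_orthonormal_sum[OF assms]
    by (simp add: cinner_sum_left cinner_scaleC_left cnj_mult_self del: of_real_power)
  hence xy: "cinner x ?y = of_real ((norm ?y)\<^sup>2)" by (subst cinner_commute) simp
  have "cinner (x - ?y) (x - ?y) = of_real ((norm x)\<^sup>2 - (norm ?y)\<^sup>2)"
    unfolding cinner_diff_left cinner_diff_right yx xy cinner_self[of x] cinner_self[of ?y] by simp
  hence "(norm (x - ?y))\<^sup>2 = (norm x)\<^sup>2 - (norm ?y)\<^sup>2"
    unfolding cinner_self of_real_eq_iff .
  hence "0 \<le> (norm x)\<^sup>2 - (norm ?y)\<^sup>2" by (metis zero_le_power2)
  thus ?thesis by (simp add: norm_orthonormal_sum[OF assms])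
qed

text \<open>Fewer than n linear conditions have a common nonzero solution: a square matrix with the
  conjugated vectors of W among its rows has a zero row left over, so it has no right inverse and is
  not injective.\<close>

lemma exists_orthogonal:
  fixes W :: "(complex^'n::finite) set"
  assumes fin: "finite W" and card: "card W < CARD('n)"
  shows "\<exists>x. x \<noteq> 0 \<and> (\<forall>w\<in>W. cinner w x = 0)"
proof (rule ccontr)
  assume n: "\<not> ?thesis"
  obtain e :: "complex^'n \<Rightarrow> 'n" where e: "inj_on e W"
    using card_le_inj[of W "UNIV :: 'n set"] fin card by auto
  have "card (e ` W) < CARD('n)" using card e by (simp add: card_image)
  hence "e ` W \<noteq> UNIV" by auto
  then obtain r0 where r0: "r0 \<notin> e ` W" by blast
  define A :: "complex^'n^'n" where
    "A = (\<chi> r s. if r \<in> e ` W then cnj (inv_into W e r $ s) else 0)"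
  have "x = 0" if x: "A *v x = 0" for x
  proof -
    have "cinner w x = 0" if w: "w \<in> W" for w
    proof -
      have "cinner w x = (A *v x) $ e w"
        using w e by (simp add: A_def matrix_vector_mult_def cinner_vec_def cinner_complex_def)
      thus ?thesis by (simp add: x)
    qed
    thus ?thesis using n by blast
  qed
  then obtain B where "B ** A = mat 1" using matrix_left_invertible_ker by blast
  hence "A ** B = mat 1" using matrix_left_right_inverse by blast
  hence "(A ** B) $ r0 $ r0 = 1" by (simp add: mat_def)
  thus False using r0 by (simp add: matrix_matrix_mult_def A_def)
qed

context
  fixes v :: "'n::finite \<Rightarrow> complex^'n"
  assumes v: "orthonormal_on UNIV v"
begin

text \<open>The matrix U with rows conjugate to the \<open>v i\<close> has its adjoint as a right
  inverse, hence as a left inverse. The remainder of the expansion is orthogonal to all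
  \<open>v i\<close>, so it lies in the kernel of U.\<close>

lemma orthonormal_basis_expansion: "x = (\<Sum>i\<in>UNIV. cinner (v i) x *\<^sub>C v i)"
proof (rule ccontr)
  define y where "y = x - (\<Sum>i\<in>UNIV. cinner (v i) x *\<^sub>C v i)"
  assume "\<not> ?thesis"
  hence y0: "y \<noteq> 0" by (simp add: y_def)
  have y: "cinner (v i) y = 0" for i
    by (simp add: y_def cinner_diff_right cinner_orthonormal_sum[OF v])
  define U :: "complex^'n^'n" where "U = (\<chi> r s. cnj (v r $ s))"
  have U: "U *v x = (\<chi> r. cinner (v r) x)" for x
    by (simp add: U_def matrix_vector_mult_def cinner_vec_def cinner_complex_def vec_eq_iff)
  have "U ** (\<chi> s r. v r $ s) = mat 1"
    using v by (simp add: U_def matrix_matrix_mult_def vec_eq_iff mat_def orthonormal_on_def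
        cinner_vec_def cinner_complex_def)
  hence "(\<chi> s r. v r $ s) ** U = mat 1" using matrix_left_right_inverse by blast
  hence "\<forall>x. U *v x = 0 \<longrightarrow> x = 0" using matrix_left_invertible_ker by blast
  moreover have "U *v y = 0" by (simp add: U y vec_eq_iff)
  ultimately show False using y0 by blast
qed

lemma Parseval: "(norm x)\<^sup>2 = (\<Sum>i\<in>UNIV. (cmod (cinner (v i) x))\<^sup>2)"
  by (subst orthonormal_basis_expansion) (simp add: norm_orthonormal_sum[OF v])

lemma qform_eigenbasis:
  assumes eig: "\<And>i. mv A (v i) = complex_of_real (m i) *\<^sub>C v i"
  shows "qform A x = (\<Sum>i\<in>UNIV. m i * (cmod (cinner (v i) x))\<^sup>2)"
proof -
  have "mv A x = mv A (\<Sum>i\<in>UNIV. cinner (v i) x *\<^sub>C v i)" by (simp flip: orthonormal_basis_expansion)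
  hence m: "mv A x = (\<Sum>i\<in>UNIV. (complex_of_real (m i) * cinner (v i) x) *\<^sub>C v i)"
    by (simp add: mv_linear eig scaleC_scaleC mult.commute)
  have "cinner x (mv A x) = cinner (\<Sum>i\<in>UNIV. cinner (v i) x *\<^sub>C v i) (mv A x)"
    by (simp flip: orthonormal_basis_expansion)
  also have "\<dots> = (\<Sum>i\<in>UNIV. cnj (cinner (v i) x) * (complex_of_real (m i) * cinner (v i) x))"
    by (simp add: m cinner_two_orthonormal_sums[OF v])
  also have "\<dots> = (\<Sum>i\<in>UNIV. complex_of_real (m i * (cmod (cinner (v i) x))\<^sup>2))"
    by (intro sum.cong refl) (simp only: mult.left_commute of_real_mult cnj_mult_self)
  finally show ?thesis by (simp add: qform_def del: of_real_mult of_real_power)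
qed

end

(* A maximizer v of the quadratic form on the unit sphere of an invariant subspace is an eigenvector:
   with mu the maximum, the form of mu - A is nonnegative on the subspace and vanishes at v. *)
lemma exists_orthogonal_eigenvector:
  fixes A :: "'n::finite cmatrix" and W :: "(complex^'n) set"
  assumes A: "self_adjoint A" and W: "finite W" "card W < CARD('n)"
    and eigW: "\<And>w. w \<in> W \<Longrightarrow> \<exists>l. mv A w = complex_of_real l *\<^sub>C w"
  shows "\<exists>v l. norm v = 1 \<and> (\<forall>w\<in>W. cinner w v = 0) \<and> mv A v = complex_of_real l *\<^sub>C v"
proof -
  define V where "V = {x. \<forall>w\<in>W. cinner w x = 0}"
  define K where "K = sphere 0 1 \<inter> V"
  have cont1: "continuous_on S (\<lambda>x. cinner w x)" for w :: "complex^'n" and S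
    by (intro bounded_bilinear.continuous_on[OF bounded_bilinear_cinner] continuous_intros)
  have "V = (\<Inter>w\<in>W. {x. cinner w x = 0})" by (auto simp: V_def)
  hence "closed V" by (auto intro!: closed_INT closed_Collect_eq cont1)
  hence K: "compact K" unfolding K_def by (intro compact_Int_closed compact_sphere)
  obtain x where x: "x \<noteq> 0" "x \<in> V" using exists_orthogonal[OF W] by (auto simp: V_def)
  have "(1 / norm x) *\<^sub>R x \<in> K" using x by (simp add: K_def V_def cinner_scaleR)
  hence Kne: "K \<noteq> {}" by blast
  have "continuous_on K (qform A)"
    unfolding qform_def
    by (intro continuous_intros bounded_bilinear.continuous_on[OF bounded_bilinear_cinner]
        bounded_linear.continuous_on[OF bounded_linear_op_apply])
  from continuous_attains_sup[OF K Kne this] obtain v where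
    v: "v \<in> K" "\<And>y. y \<in> K \<Longrightarrow> qform A y \<le> qform A v" by blast
  define l where "l = qform A v"
  have nv: "norm v = 1" and vV: "v \<in> V" using v(1) by (auto simp: K_def)
  define B where "B = l *\<^sub>R 1 - A"
  have B: "self_adjoint B" by (simp add: B_def self_adjoint_simps A)
  have Bpos: "0 \<le> qform B y" if y: "y \<in> V" for y
  proof (cases "y = 0")
    case True
    thus ?thesis by (simp add: qform_def)
  next
    case False
    have "(1 / norm y) *\<^sub>R y \<in> K" using False y by (simp add: K_def V_def cinner_scaleR)
    hence "qform A ((1 / norm y) *\<^sub>R y) \<le> l" unfolding l_def by (rule v(2))
    hence "qform A y \<le> l * (norm y)\<^sup>2"
      using False by (simp add: qform_def mv_linear cinner_scaleR divide_simps power2_eq_square mult_ac)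
    thus ?thesis by (simp add: B_def qform_simps)
  qed
  have Bv: "qform B v = 0" by (simp add: B_def qform_simps nv l_def)
  define y where "y = mv B v"
  have inv: "mv A z \<in> V" if z: "z \<in> V" for z
    unfolding V_def
  proof clarify
    fix w assume w: "w \<in> W"
    then obtain l where "mv A w = complex_of_real l *\<^sub>C w" using eigW by blast
    moreover have "cinner w (mv A z) = cinner (mv A w) z" by (simp add: cinner_mv_self_adjoint[OF A])
    ultimately show "cinner w (mv A z) = 0" using z w by (simp add: cinner_scaleC_left V_def)
  qed
  have yV: "y \<in> V" using inv[OF vV] vV
    by (simp add: y_def B_def mv_simps V_def cinner_diff_right cinner_scaleR)
  have exp: "qform B (v + s *\<^sub>R y) = 2 * s * (norm y)\<^sup>2 + s\<^sup>2 * qform B y" for s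
  proof -
    have "cinner v (mv B y) = cinner y y" by (simp add: y_def flip: cinner_mv_self_adjoint[OF B])
    moreover have "cinner y (mv B v) = cinner y y" by (simp add: y_def)
    ultimately show ?thesis using Bv
      by (simp add: qform_def mv_linear cinner_add_left cinner_add_right cinner_scaleR cinner_self
          power2_eq_square algebra_simps)
  qed
  have ge: "0 \<le> 2 * s * (norm y)\<^sup>2 + s\<^sup>2 * qform B y" for s
  proof -
    have "v + s *\<^sub>R y \<in> V" using vV yV by (simp add: V_def cinner_add_right cinner_scaleR)
    from Bpos[OF this] show ?thesis by (simp add: exp)
  qed
  have "y = 0"
  proof (rule ccontr)
    assume "y \<noteq> 0"
    hence p: "(norm y)\<^sup>2 > 0" by simp
    \<comment> \<open>A step against the gradient y. Division of the inequality by the negative s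
      leaves 2 P + s q \<le> 0, while this s keeps s q \<ge> -P; the 1 in the denominator covers q =
      0.\<close>
    define q P s where "q = qform B y" and "P = (norm y)\<^sup>2" and "s = - P / (q + 1)"
    have q: "0 \<le> q" using Bpos[OF yV] by (simp add: q_def)
    have P: "P > 0" using p by (simp add: P_def)
    have s: "s < 0" "s * q \<ge> - P" using q P by (simp_all add: s_def field_simps)
    have "0 \<le> s * (2 * P + s * q)" using ge[of s]
      by (simp add: q_def P_def power2_eq_square algebra_simps)
    hence "2 * P + s * q \<le> 0" using s(1) by (simp add: zero_le_mult_iff)
    with s(2) P show False by simp
  qed
  hence "mv A v = complex_of_real l *\<^sub>C v" by (simp add: y_def B_def mv_simps scaleC_of_real)
  thus ?thesis using nv vV by (auto simp: V_def)
qed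

text \<open>Eigenvectors are attached to the indices one at a time, each orthogonal to its
  predecessors. While an index is missing, fewer than n vectors have been used, so another one
  exists.\<close>

lemma spectral_theorem:
  fixes A :: "'n::finite cmatrix"
  assumes A: "self_adjoint A"
  shows "\<exists>v m. orthonormal_on (UNIV :: 'n set) v \<and> (\<forall>i. mv A (v i) = complex_of_real (m i) *\<^sub>C v i)"
proof -
  have "\<exists>v m. orthonormal_on F v \<and> (\<forall>i\<in>F. mv A (v i) = complex_of_real (m i) *\<^sub>C v i)" for F :: "'n set"
  proof (induction F rule: infinite_finite_induct)
    case (insert j F)
    then obtain v m where v: "orthonormal_on F v" "\<And>i. i \<in> F \<Longrightarrow> mv A (v i) = complex_of_real (m i) *\<^sub>C v i"
      by blast
    have "card (v ` F) \<le> card F" by (simp add: card_image_le)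
    also have "\<dots> < card (UNIV :: 'n set)" using insert by (intro psubset_card_mono) auto
    finally have c: "card (v ` F) < CARD('n)" .
    have "\<exists>w l. norm w = 1 \<and> (\<forall>x\<in>v ` F. cinner x w = 0) \<and> mv A w = complex_of_real l *\<^sub>C w"
      by (rule exists_orthogonal_eigenvector[OF A _ c]) (use v in auto)
    then obtain w l where w: "norm w = 1" "\<And>i. i \<in> F \<Longrightarrow> cinner (v i) w = 0" "mv A w = complex_of_real l *\<^sub>C w"
      by blast
    have w': "cinner w (v i) = 0" if "i \<in> F" for i using w(2)[OF that] by (subst cinner_commute) simp
    have "orthonormal_on (insert j F) (v(j := w))"
    proof -
      have "cinner w w = 1" using w(1) by (simp add: cinner_self)
      thus ?thesis using v(1) w(2) w' insert by (auto simp: orthonormal_on_def)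
    qed
    moreover have "\<forall>i\<in>insert j F. mv A ((v(j := w)) i) = complex_of_real ((m(j := l)) i) *\<^sub>C (v(j := w)) i"
      using v(2) w(3) insert by auto
    ultimately show ?case by blast
  qed (auto simp: orthonormal_on_def)
  from this[of UNIV] show ?thesis by simp
qed

section \<open>Ordered eigenvalues and their variational bounds\<close>

lemma poly_det: "poly (det M) z = det (\<chi> i j. poly (M $ i $ j) z)" for M :: "complex poly^'n^'n"
  by (simp add: det_def poly_sum poly_prod)

text \<open>At each point z one has (z - A) U = U E, where the columns of U are the eigenvectors and
  E is diagonal. Cancelling the nonzero det U gives equality of values at every z, hence of
  polynomials.\<close>

lemma characteristic_poly_eigenbasis:
  fixes v :: "'n::finite \<Rightarrow> complex^'n"
  assumes v: "orthonormal_on UNIV v" and eig: "\<And>i. mv A (v i) = m i *\<^sub>C v i"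
  shows "characteristic_poly A = (\<Prod>i\<in>UNIV. [:- m i, 1:])"
proof -
  define U D :: "complex^'n^'n" where "U = (\<chi> r s. v s $ r)" and "D = (\<chi> r s. if r = s then m r else 0)"
  have "(\<chi> r s. cnj (v r $ s)) ** U = mat 1"
    using v by (simp add: U_def matrix_matrix_mult_def vec_eq_iff mat_def orthonormal_on_def
        cinner_vec_def cinner_complex_def)
  hence "det (\<chi> r s. cnj (v r $ s)) * det U = 1" by (metis det_I det_mul)
  hence U: "det U \<noteq> 0" by auto
  have AU: "(\<Sum>k\<in>UNIV. array_of A $ r $ k * v s $ k) = m s * v s $ r" for r s
    using arg_cong[OF eig[of s], of "\<lambda>x. x $ r"]
    by (simp add: op_apply_op_of_matrix matrix_vector_mult_def scaleC_vec_def scaleC_complex_def)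
  have "poly (characteristic_poly A) z = poly (\<Prod>i\<in>UNIV. [:- m i, 1:]) z" for z
  proof -
    define Z where "Z = (\<chi> i j. (if i = j then z else 0) - array_of A $ i $ j)"
    define E where "E = (\<chi> r s. if r = s then z - m r else 0)"
    have "poly (characteristic_poly A) z = det Z"
      unfolding characteristic_poly_def poly_det Z_def
      by (intro arg_cong[where f = det]) (simp add: vec_eq_iff mat_def)
    moreover have "Z ** U = U ** E"
      by (simp add: vec_eq_iff matrix_matrix_mult_def Z_def U_def E_def left_diff_distrib
          sum_subtractf AU if_distrib[of "\<lambda>x. x * _"] if_distrib[of "\<lambda>x. _ * x"] sum.delta sum.delta'
          cong: if_cong) (simp add: algebra_simps)
    hence "det Z * det U = det U * det E" by (metis det_mul)
    hence "det Z = det E" using U by simp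
    moreover have "det E = (\<Prod>i\<in>UNIV. z - m i)"
      by (subst det_diagonal) (simp_all add: E_def)
    ultimately show ?thesis by (simp add: poly_prod)
  qed
  thus ?thesis using poly_eq_poly_eq_iff by blast
qed

lemma nth_eigenvalue_eigenbasis:
  fixes v :: "'n::finite \<Rightarrow> complex^'n"
  assumes v: "orthonormal_on UNIV v" and eig: "\<And>i. mv A (v i) = complex_of_real (m i) *\<^sub>C v i"
  shows "\<exists>e. bij_betw e {1..CARD('n)} (UNIV :: 'n set) \<and>
    (\<forall>i\<in>{1..CARD('n)}. nth_eigenvalue i A = m (e i)) \<and>
    (\<forall>i\<in>{1..CARD('n)}. \<forall>j\<in>{1..CARD('n)}. i \<le> j \<longrightarrow> m (e j) \<le> m (e i))"
proof -
  obtain xs0 :: "'n list" where xs0: "set xs0 = UNIV" "distinct xs0"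
    using finite_distinct_list[of "UNIV :: 'n set"] by auto
  \<comment> \<open>The definition of \<open>nth_eigenvalue\<close> sorts upwards and then reverses.
    Treating the indices in the same way lets its list be read off as \<open>map m xs\<close>, whose
    positions start at 0 whereas eigenvalues are counted from 1.\<close>
  define ys where "ys = sort_key m xs0"
  define xs where "xs = rev ys"
  have xs: "set xs = UNIV" "distinct xs" by (simp_all add: xs_def ys_def xs0)
  have len: "length xs = CARD('n)" using xs distinct_card by metis
  have "proots (characteristic_poly A) = (\<Sum>i\<in>UNIV. {#complex_of_real (m i)#})"
    unfolding characteristic_poly_eigenbasis[OF v eig] by (subst proots_prod) auto
  also have "\<dots> = image_mset (\<lambda>i. complex_of_real (m i)) (mset_set UNIV)"
    by (simp add: sum_unfold_sum_mset)
  finally have "image_mset Re (proots (characteristic_poly A)) = image_mset m (mset_set UNIV)"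
    by (simp add: multiset.map_comp o_def)
  also have "\<dots> = mset (map m ys)"
    using mset_set_set[of ys] by (simp add: ys_def xs0)
  finally have "rev (sorted_list_of_multiset (image_mset Re (proots (characteristic_poly A)))) = rev (sort (map m ys))"
    by (simp only: sorted_list_of_multiset_mset)
  also have "sort (map m ys) = map m ys" by (simp add: ys_def sorted_sort_id)
  finally have nth: "nth_eigenvalue i A = map m xs ! (i - 1)" for i
    by (simp add: nth_eigenvalue_def xs_def rev_map)
  show ?thesis
  proof (intro exI[of _ "\<lambda>i. xs ! (i - 1)"] conjI ballI impI)
    have "bij_betw (\<lambda>i. i - 1) {1..CARD('n)} {..<CARD('n)}"
      by (rule bij_betwI[where g = Suc]) auto
    from bij_betw_trans[OF this bij_betw_nth[OF xs(2), of "{..<CARD('n)}" UNIV]] xs(1) len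
    show "bij_betw (\<lambda>i. xs ! (i - 1)) {1..CARD('n)} UNIV" by (simp add: o_def)
  next
    fix i assume "i \<in> {1..CARD('n)}"
    hence "i - 1 < length xs" using len by auto
    thus "nth_eigenvalue i A = m (xs ! (i - 1))" by (simp add: nth)
  next
    fix i j assume ij: "i \<in> {1..CARD('n)}" "j \<in> {1..CARD('n)}" "i \<le> j"
    have "sorted (map m ys)" by (simp add: ys_def)
    hence "sorted_wrt (\<ge>) (map m xs)" by (simp add: xs_def sorted_wrt_rev rev_map[symmetric])
    with ij len show "m (xs ! (j - 1)) \<le> m (xs ! (i - 1))"
      by (cases "i = j") (auto simp: sorted_wrt_iff_nth_less)
  qed
qed

text \<open>The span of the w_j with j in J is described by orthogonality to the other n - i
  vectors. Together with orthogonality to the first i - 1 eigenvectors of A these are at most n - 1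
  conditions, so a nonzero x meets them all, and there the form is at most the i-th eigenvalue times
  the squared norm.\<close>

lemma Courant_Fischer_lower_bound:
  fixes A :: "'n::finite cmatrix" and w :: "'n \<Rightarrow> complex^'n"
  assumes A: "self_adjoint A" and w: "orthonormal_on UNIV w" and J: "card J = i" "1 \<le> i"
    and ge: "\<And>x. (\<And>j. j \<notin> J \<Longrightarrow> cinner (w j) x = 0) \<Longrightarrow> c * (norm x)\<^sup>2 \<le> qform A x"
  shows "c \<le> nth_eigenvalue i A"
proof -
  obtain v m where v: "orthonormal_on (UNIV :: 'n set) v" "\<And>i. mv A (v i) = complex_of_real (m i) *\<^sub>C v i"
    using spectral_theorem[OF A] by blast
  from nth_eigenvalue_eigenbasis[OF v] obtain e where e: "bij_betw e {1..CARD('n)} (UNIV :: 'n set)"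
    "\<And>i. i \<in> {1..CARD('n)} \<Longrightarrow> nth_eigenvalue i A = m (e i)"
    "\<And>i j. i \<in> {1..CARD('n)} \<Longrightarrow> j \<in> {1..CARD('n)} \<Longrightarrow> i \<le> j \<Longrightarrow> m (e j) \<le> m (e i)" by blast
  have in': "i \<in> {1..CARD('n)}" using J card_mono[of UNIV J] by auto
  let ?W = "w ` (- J) \<union> (v \<circ> e) ` {1..<i}"
  have "card ?W \<le> card (w ` (- J)) + card ((v \<circ> e) ` {1..<i})" by (rule card_Un_le)
  also have "\<dots> \<le> card (- J) + card {1..<i}" by (intro add_mono card_image_le) auto
  also have "\<dots> < CARD('n)" using in' J by (simp add: Compl_eq_Diff_UNIV card_Diff_subset)
  finally have "card ?W < CARD('n)" .
  then obtain x where x: "x \<noteq> 0" "\<And>y. y \<in> ?W \<Longrightarrow> cinner y x = 0"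
    using exists_orthogonal[of ?W] by auto
  have "c * (norm x)\<^sup>2 \<le> qform A x" by (rule ge) (use x(2) in auto)
  also have "\<dots> = (\<Sum>k\<in>UNIV. m k * (cmod (cinner (v k) x))\<^sup>2)" by (rule qform_eigenbasis[OF v])
  also have "\<dots> \<le> (\<Sum>k\<in>UNIV. m (e i) * (cmod (cinner (v k) x))\<^sup>2)"
  proof (rule sum_mono)
    fix k
    have "k \<in> e ` {1..CARD('n)}" using e(1) by (simp add: bij_betw_def)
    then obtain j where j: "j \<in> {1..CARD('n)}" "k = e j" by blast
    show "m k * (cmod (cinner (v k) x))\<^sup>2 \<le> m (e i) * (cmod (cinner (v k) x))\<^sup>2"
    proof (cases "j < i")
      case True
      hence "cinner (v k) x = 0" using j by (intro x(2)) auto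
      thus ?thesis by simp
    next
      case False
      thus ?thesis using e(3)[OF in' j(1)] j(2) by (simp add: mult_right_mono)
    qed
  qed
  also have "\<dots> = m (e i) * (norm x)\<^sup>2" by (simp add: Parseval[OF v(1)] sum_distrib_left)
  finally show ?thesis using x(1) e(2)[OF in'] by simp
qed

text \<open>The weight p l is the squared length of the projection of the l-th eigenvector onto the
  span of the w_j. The weights lie in [0, 1] and add up to k, so the weighted sum of eigenvalues is
  largest when the first k of them get weight 1.\<close>

lemma Ky_Fan_lower_bound:
  fixes A :: "'n::finite cmatrix" and w :: "'i \<Rightarrow> complex^'n"
  assumes A: "self_adjoint A" and w: "orthonormal_on K w" and K: "finite K" "card K = k"
    and k: "k \<in> {1..CARD('n)}"
  shows "(\<Sum>j\<in>K. qform A (w j)) \<le> (\<Sum>i=1..k. nth_eigenvalue i A)"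
proof -
  obtain v m where v: "orthonormal_on (UNIV :: 'n set) v" "\<And>i. mv A (v i) = complex_of_real (m i) *\<^sub>C v i"
    using spectral_theorem[OF A] by blast
  from nth_eigenvalue_eigenbasis[OF v] obtain e where e: "bij_betw e {1..CARD('n)} (UNIV :: 'n set)"
    "\<And>i. i \<in> {1..CARD('n)} \<Longrightarrow> nth_eigenvalue i A = m (e i)"
    "\<And>i j. i \<in> {1..CARD('n)} \<Longrightarrow> j \<in> {1..CARD('n)} \<Longrightarrow> i \<le> j \<Longrightarrow> m (e j) \<le> m (e i)" by blast
  let ?N = "{1..CARD('n)}"
  define p where "p l = (\<Sum>j\<in>K. (cmod (cinner (v (e l)) (w j)))\<^sup>2)" for l
  have p1: "p l \<le> 1" for l
  proof -
    have "p l = (\<Sum>j\<in>K. (cmod (cinner (w j) (v (e l))))\<^sup>2)"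
      unfolding p_def by (intro sum.cong refl) (metis cinner_commute complex_mod_cnj)
    also have "\<dots> \<le> (norm (v (e l)))\<^sup>2" by (rule Bessel_inequality[OF w K(1)])
    also have "\<dots> = 1" using orthonormal_on_cinner[OF v(1), of "e l" "e l"] by (simp add: norm_sq_cinner)
    finally show ?thesis .
  qed
  have p0: "0 \<le> p l" for l by (simp add: p_def sum_nonneg)
  have psum: "(\<Sum>l\<in>?N. p l) = real k"
  proof -
    have "(\<Sum>l\<in>?N. p l) = (\<Sum>j\<in>K. \<Sum>l\<in>?N. (cmod (cinner (v (e l)) (w j)))\<^sup>2)"
      unfolding p_def by (rule sum.swap)
    also have "\<dots> = (\<Sum>j\<in>K. (norm (w j))\<^sup>2)"
    proof (intro sum.cong refl)
      fix j show "(\<Sum>l\<in>?N. (cmod (cinner (v (e l)) (w j)))\<^sup>2) = (norm (w j))\<^sup>2"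
        using sum.reindex_bij_betw[OF e(1), of "\<lambda>i. (cmod (cinner (v i) (w j)))\<^sup>2"]
        by (simp add: Parseval[OF v(1)])
    qed
    also have "\<dots> = (\<Sum>j\<in>K. 1)"
      by (intro sum.cong refl) (simp add: norm_sq_cinner orthonormal_on_cinner[OF w])
    finally show ?thesis by (simp add: K)
  qed
  have "(\<Sum>j\<in>K. qform A (w j)) = (\<Sum>j\<in>K. \<Sum>l\<in>?N. m (e l) * (cmod (cinner (v (e l)) (w j)))\<^sup>2)"
  proof (intro sum.cong refl)
    fix j show "qform A (w j) = (\<Sum>l\<in>?N. m (e l) * (cmod (cinner (v (e l)) (w j)))\<^sup>2)"
      using sum.reindex_bij_betw[OF e(1), of "\<lambda>i. m i * (cmod (cinner (v i) (w j)))\<^sup>2"]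
      by (simp add: qform_eigenbasis[OF v])
  qed
  also have "\<dots> = (\<Sum>l\<in>?N. m (e l) * p l)"
    unfolding p_def by (subst sum.swap) (simp add: sum_distrib_left)
  \<comment> \<open>Measured from the k-th eigenvalue, earlier ones have nonnegative excess and p
    \<le> 1, later ones nonpositive excess and p \<ge> 0. Summing the base value over all l then
    produces exactly k times it.\<close>
  also have "\<dots> \<le> (\<Sum>l\<in>?N. m (e k) * p l + (if l \<le> k then m (e l) - m (e k) else 0))"
  proof (rule sum_mono)
    fix l assume l: "l \<in> ?N"
    show "m (e l) * p l \<le> m (e k) * p l + (if l \<le> k then m (e l) - m (e k) else 0)"
    proof (cases "l \<le> k")
      case True
      hence "(m (e l) - m (e k)) * p l \<le> (m (e l) - m (e k)) * 1"
        using e(3)[OF l k] p1 by (intro mult_left_mono) auto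
      thus ?thesis using True by (simp add: algebra_simps)
    next
      case False
      thus ?thesis using e(3)[OF k l] p0[of l] by (simp add: mult_right_mono)
    qed
  qed
  also have "\<dots> = m (e k) * real k + (\<Sum>l\<in>?N. if l \<le> k then m (e l) - m (e k) else 0)"
    using psum by (simp only: sum.distrib flip: sum_distrib_left)
  also have "(\<Sum>l\<in>?N. if l \<le> k then m (e l) - m (e k) else 0) = (\<Sum>l=1..k. m (e l) - m (e k))"
    using k by (intro sum.mono_neutral_cong_right) auto
  also have "m (e k) * real k + \<dots> = (\<Sum>l=1..k. m (e l))" by (simp add: sum_subtractf)
  also have "\<dots> = (\<Sum>i=1..k. nth_eigenvalue i A)" using k by (intro sum.cong) (auto simp: e(2))
  finally show ?thesis .
qed

section \<open>Positive unital maps on an interval\<close>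

text \<open>The slope is the right derivative at x, written as the infimum of the difference
  quotients to the right.\<close>

lemma convex_on_support_line:
  fixes f :: "real \<Rightarrow> real"
  assumes f: "convex_on I f" and I: "open I" "is_interval I" and x: "x \<in> I"
  shows "\<exists>c. \<forall>y\<in>I. f x + c * (y - x) \<le> f y"
proof (intro exI ballI)
  fix y assume y: "y \<in> I"
  have "connected I" using I(2) is_interval_connected_1 by blast
  moreover have "x \<in> interior I" using x I(1) by (simp add: interior_open)
  ultimately show "f x + Inf ((\<lambda>t. (f x - f t) / (x - t)) ` ({x<..} \<inter> I)) * (y - x) \<le> f y"
    using convex_le_Inf_differential[OF f _ y, of x] by simp
qed

text \<open>Total functions stand for elements of C[m, M], which is what \<open>cong\<close>
  expresses. The strict inequality m < M gives the hat functions a positive mesh.\<close>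

locale positive_unital_interval_map =
  fixes \<psi> :: "(real \<Rightarrow> real) \<Rightarrow> 'n::finite cmatrix" and m M :: real
  assumes m_less_M: "m < M"
    and linear: "continuous_on {m..M} g \<Longrightarrow> continuous_on {m..M} h \<Longrightarrow>
      \<psi> (\<lambda>t. c * g t + d * h t) = c *\<^sub>R \<psi> g + d *\<^sub>R \<psi> h"
    and one: "\<psi> (\<lambda>t. 1) = 1"
    and cong: "continuous_on {m..M} g \<Longrightarrow> (\<And>t. t \<in> {m..M} \<Longrightarrow> g t = h t) \<Longrightarrow> \<psi> g = \<psi> h"
    and positive: "continuous_on {m..M} g \<Longrightarrow> (\<And>t. t \<in> {m..M} \<Longrightarrow> 0 \<le> g t) \<Longrightarrow> cstar_positive (\<psi> g)"
begin

lemma diff: "continuous_on {m..M} g \<Longrightarrow> continuous_on {m..M} h \<Longrightarrow> \<psi> (\<lambda>t. h t - g t) = \<psi> h - \<psi> g"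
  using linear[of h g 1 "-1"] by simp

lemma const: "\<psi> (\<lambda>t. c) = c *\<^sub>R 1"
  using linear[of "\<lambda>t. 1" "\<lambda>t. 1" c 0] one by simp

lemma affine: "continuous_on {m..M} g \<Longrightarrow> \<psi> (\<lambda>t. b + c * g t) = b *\<^sub>R 1 + c *\<^sub>R \<psi> g"
  using linear[of "\<lambda>t. 1" g b c] one by simp

lemma sum:
  assumes "\<And>j. j \<in> J \<Longrightarrow> continuous_on {m..M} (h j)"
  shows "\<psi> (\<lambda>t. \<Sum>j\<in>J. c j * h j t) = (\<Sum>j\<in>J. c j *\<^sub>R \<psi> (h j))"
  using assms
proof (induction J rule: infinite_finite_induct)
  case (insert j J)
  have "continuous_on {m..M} (\<lambda>t. \<Sum>j\<in>J. c j * h j t)"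
    using insert by (intro continuous_intros) auto
  from linear[OF _ this, of "h j" "c j" 1] insert show ?case by simp
qed (simp_all add: const)

lemma qform_mono:
  assumes "continuous_on {m..M} g" "continuous_on {m..M} h" "\<And>t. t \<in> {m..M} \<Longrightarrow> g t \<le> h t"
  shows "qform (\<psi> g) x \<le> qform (\<psi> h) x"
proof -
  have "cstar_positive (\<psi> (\<lambda>t. h t - g t))"
    using assms by (intro positive continuous_intros) auto
  from qform_nonneg[OF this, of x] show ?thesis by (simp add: diff[OF assms(1,2)] qform_simps)
qed

abbreviation T :: "'n cmatrix" where
  "T \<equiv> \<psi> (\<lambda>t. t)"

text \<open>Positivity controls only the images of nonnegative functions, so the identity is shifted
  by its lower bound m and shifted back.\<close>

lemma self_adjoint_T: "self_adjoint T"
proof -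
  have "cstar_positive (\<psi> (\<lambda>t. t - m))"
    by (intro positive continuous_intros) auto
  hence "self_adjoint (\<psi> (\<lambda>t. t - m))" by (simp add: cstar_positive_def)
  moreover have "\<psi> (\<lambda>t. t - m) = T - m *\<^sub>R 1"
    using diff[OF continuous_on_const[of _ m] continuous_on_id] by (simp add: const)
  ultimately have "self_adjoint (T - m *\<^sub>R 1 + m *\<^sub>R 1)"
    by (metis self_adjoint_simps(2,3,5))
  thus ?thesis by simp
qed

lemma qform_T_in:
  assumes "norm x = 1"
  shows "qform T x \<in> {m..M}"
proof -
  have c: "qform (\<psi> (\<lambda>t. c)) x = c" for c
    unfolding const qform_simps assms by simp
  have "qform (\<psi> (\<lambda>t. m)) x \<le> qform T x" "qform T x \<le> qform (\<psi> (\<lambda>t. M)) x"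
    by (rule qform_mono; force intro: continuous_intros)+
  thus ?thesis unfolding c by simp
qed

lemma T_eigenbasis:
  obtains v l where "orthonormal_on (UNIV :: 'n set) v"
    "\<And>i. mv T (v i) = complex_of_real (l i) *\<^sub>C v i" "\<And>i. l i \<in> {m..M}" "\<And>i. qform T (v i) = l i"
    "\<And>i. norm (v i) = 1"
proof -
  obtain v l where v: "orthonormal_on (UNIV :: 'n set) v"
    "\<And>i. mv T (v i) = complex_of_real (l i) *\<^sub>C v i" using spectral_theorem[OF self_adjoint_T] by blast
  have c: "cinner (v i) (v i) = 1" for i using orthonormal_on_cinner[OF v(1)] by simp
  have n: "norm (v i) = 1" for i
  proof (rule power2_eq_imp_eq)
    show "(norm (v i))\<^sup>2 = 1\<^sup>2" using norm_sq_cinner[of "v i"] c by simp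
  qed simp_all
  have q: "qform T (v i) = l i" for i by (simp add: qform_def v(2) cinner_scaleC_right c)
  have "l i \<in> {m..M}" for i using qform_T_in[OF n[of i]] by (simp add: q)
  from that[OF v this q n] show ?thesis .
qed

lemma spectrum_T: "cstar_spectrum T \<subseteq> complex_of_real ` {m..M}"
proof (rule spectrum_subset_of_real[OF self_adjoint_T], rule subsetI)
  fix t assume "t \<in> Re ` cstar_spectrum T"
  then obtain z where z: "z \<in> cstar_spectrum T" "t = Re z" by blast
  from exists_mv_kernel[of "T - z *\<^sub>C 1"] not_in_spectrum_iff[of z T] z(1)
  obtain x where x: "x \<noteq> 0" "mv (T - z *\<^sub>C 1) x = 0" by blast
  hence e: "mv T x = z *\<^sub>C x" by (simp add: mv_simps)
  define y where "y = (1 / norm x) *\<^sub>R x"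
  have y: "norm y = 1" using x(1) by (simp add: y_def)
  have "mv T y = z *\<^sub>C y" using e by (simp add: y_def mv_linear scaleC_scaleC mult.commute flip: scaleC_of_real)
  hence "qform T y = t" by (simp add: qform_def cinner_scaleC_right cinner_self y z(2))
  with qform_T_in[OF y] show "t \<in> {m..M}" by simp
qed

section \<open>Eigenvalue inequalities for convex functions\<close>

context
  fixes f :: "real \<Rightarrow> real" and I :: "real set"
  assumes I: "open I" "is_interval I" "{m..M} \<subseteq> I"
    and fcont: "continuous_on I f"
begin

lemma f_cont: "continuous_on {m..M} f"
  by (rule continuous_on_subset[OF fcont I(3)])

lemma functional_calculus_T_eigen:
  assumes "mv T u = complex_of_real l *\<^sub>C u" "u \<noteq> 0"
  shows "mv (functional_calculus f T) u = complex_of_real (f l) *\<^sub>C u"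
  using functional_calculus_mv_eigenvector[OF self_adjoint_T spectrum_T f_cont assms]
  by (simp add: scaleC_of_real)

lemma Jensen_qform:
  assumes f: "convex_on I f" and x: "norm x = 1"
  shows "f (qform T x) \<le> qform (\<psi> f) x"
proof -
  let ?l = "qform T x"
  have "?l \<in> I" using qform_T_in[OF x] I(3) by blast
  then obtain c where c: "\<And>y. y \<in> I \<Longrightarrow> f ?l + c * (y - ?l) \<le> f y"
    using convex_on_support_line[OF f I(1,2)] by blast
  \<comment> \<open>The line touches f at the mean value ?l itself, so at a unit vector its slope
    terms cancel and f ?l remains.\<close>
  have "qform (\<psi> (\<lambda>t. (f ?l - c * ?l) + c * t)) x \<le> qform (\<psi> f) x"
  proof (rule qform_mono)
    fix t assume "t \<in> {m..M}"
    hence "t \<in> I" using I(3) by blast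
    from c[OF this] show "(f ?l - c * ?l) + c * t \<le> f t" by (simp add: algebra_simps)
  qed (intro continuous_intros f_cont)+
  thus ?thesis using x by (simp add: affine[OF continuous_on_id] qform_simps)
qed

text \<open>B will be \<phi>(f(a)). It is kept apart from \<open>\<psi> f\<close> because with a
  nonpositive atom it only dominates \<open>\<psi> f\<close>. The eigenvectors of T serve as trial
  vectors for the Ky Fan bound on B.\<close>

lemma sum_eigenvalues_le:
  assumes f: "convex_on I f" and B: "self_adjoint B" "\<And>x. qform (\<psi> f) x \<le> qform B x"
    and k: "k \<in> {1..CARD('n)}"
  shows "(\<Sum>i=1..k. nth_eigenvalue i (functional_calculus f T)) \<le> (\<Sum>i=1..k. nth_eigenvalue i B)"
proof -
  obtain v l where v: "orthonormal_on (UNIV :: 'n set) v" "\<And>i. mv T (v i) = complex_of_real (l i) *\<^sub>C v i"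
    "\<And>i. l i \<in> {m..M}" "\<And>i. qform T (v i) = l i" "\<And>i. norm (v i) = 1" by (rule T_eigenbasis) (rule that)
  have fv: "mv (functional_calculus f T) (v i) = complex_of_real (f (l i)) *\<^sub>C v i" for i
    using functional_calculus_T_eigen[OF v(2)] v(5)[of i] by force
  from nth_eigenvalue_eigenbasis[OF v(1) fv] obtain e where e: "bij_betw e {1..CARD('n)} (UNIV :: 'n set)"
    "\<And>i. i \<in> {1..CARD('n)} \<Longrightarrow> nth_eigenvalue i (functional_calculus f T) = f (l (e i))" by blast
  have "(\<Sum>i=1..k. nth_eigenvalue i (functional_calculus f T)) = (\<Sum>i=1..k. f (l (e i)))"
    using k by (intro sum.cong) (auto simp: e(2))
  also have "\<dots> \<le> (\<Sum>i=1..k. qform B ((v \<circ> e) i))"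
  proof (intro sum_mono)
    fix i
    have "f (l (e i)) \<le> qform (\<psi> f) (v (e i))" using Jensen_qform[OF f v(5)[of "e i"]] by (simp only: v(4))
    also have "\<dots> \<le> qform B (v (e i))" by (rule B(2))
    finally show "f (l (e i)) \<le> qform B ((v \<circ> e) i)" by simp
  qed
  also have "\<dots> \<le> (\<Sum>i=1..k. nth_eigenvalue i B)"
  proof (rule Ky_Fan_lower_bound[OF B(1) _ _ _ k])
    have "inj_on e {1..k}" using e(1) k by (auto simp: bij_betw_def intro: inj_on_subset)
    thus "orthonormal_on {1..k} (v \<circ> e)"
      by (rule orthonormal_on_compose[rotated]) (rule orthonormal_on_subset[OF v(1)], simp)
  qed simp_all
  finally show ?thesis .
qed

(* On the span of eigenvectors of T belonging to the i largest values of f, the form of T takes values between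
   the eigenvalues used, so that f of it is at least the smallest of these values of f. *)
lemma eigenvalue_le:
  assumes f: "convex_on I f" "mono_on I f \<or> antimono_on I f"
    and B: "self_adjoint B" "\<And>x. qform (\<psi> f) x \<le> qform B x"
    and i: "i \<in> {1..CARD('n)}"
  shows "nth_eigenvalue i (functional_calculus f T) \<le> nth_eigenvalue i B"
proof -
  obtain v l where v: "orthonormal_on (UNIV :: 'n set) v" "\<And>i. mv T (v i) = complex_of_real (l i) *\<^sub>C v i"
    "\<And>i. l i \<in> {m..M}" "\<And>i. qform T (v i) = l i" "\<And>i. norm (v i) = 1" by (rule T_eigenbasis) (rule that)
  have fv: "mv (functional_calculus f T) (v i) = complex_of_real (f (l i)) *\<^sub>C v i" for i
    using functional_calculus_T_eigen[OF v(2)] v(5)[of i] by force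
  from nth_eigenvalue_eigenbasis[OF v(1) fv] obtain e where e: "bij_betw e {1..CARD('n)} (UNIV :: 'n set)"
    "\<And>i. i \<in> {1..CARD('n)} \<Longrightarrow> nth_eigenvalue i (functional_calculus f T) = f (l (e i))"
    "\<And>i j. i \<in> {1..CARD('n)} \<Longrightarrow> j \<in> {1..CARD('n)} \<Longrightarrow> i \<le> j \<Longrightarrow> f (l (e j)) \<le> f (l (e i))" by blast
  define J where "J = e ` {1..i}"
  have J: "card J = i" "finite J" "J \<noteq> {}"
    using e(1) i by (auto simp: J_def bij_betw_def card_image inj_on_subset)
  have Jf: "f (l (e i)) \<le> f (l j)" if "j \<in> J" for j
    using that e(3) i by (auto simp: J_def)
  have "f (l (e i)) \<le> nth_eigenvalue i B"
  proof (rule Courant_Fischer_lower_bound[OF B(1) v(1) J(1)])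
    show "1 \<le> i" using i by simp
    fix x assume x: "\<And>j. j \<notin> J \<Longrightarrow> cinner (v j) x = 0"
    show "f (l (e i)) * (norm x)\<^sup>2 \<le> qform B x"
    proof (cases "x = 0")
      case False
      \<comment> \<open>Jensen's inequality is tied to unit vectors. The squared coefficients p of y
        then add up to 1, so the form of T at y is a mean of the eigenvalues with index in
        J.\<close>
      define y where "y = (1 / norm x) *\<^sub>R x"
      have ny: "norm y = 1" using False by (simp add: y_def)
      have y: "cinner (v j) y = 0" if "j \<notin> J" for j using x[OF that] by (simp add: y_def cinner_scaleR)
      define p where "p j = (cmod (cinner (v j) y))\<^sup>2" for j
      have ps: "(\<Sum>j\<in>J. p j) = 1"
      proof -
        have "(\<Sum>j\<in>J. p j) = (\<Sum>j\<in>UNIV. p j)" by (intro sum.mono_neutral_left) (auto simp: p_def y)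
        thus ?thesis using Parseval[OF v(1), of y] ny by (simp add: p_def)
      qed
      have q: "qform T y = (\<Sum>j\<in>J. l j * p j)"
        unfolding qform_eigenbasis[OF v(1,2)] p_def
        by (intro sum.mono_neutral_right) (auto simp: y)
      have p0: "0 \<le> p j" for j by (simp add: p_def)
      have qI: "qform T y \<in> I" and lI: "l j \<in> I" for j
        using qform_T_in[OF ny] v(3)[of j] I(3) by blast+
      \<comment> \<open>The mean is compared with the smallest of these eigenvalues if f is
        nondecreasing and with the largest if f is nonincreasing; either way f of that extreme is
        one of the i largest values of f.\<close>
      have "f (l (e i)) \<le> f (qform T y)"
        using f(2)
      proof
        assume mono: "mono_on I f"
        have "Min (l ` J) \<in> l ` J" using J by (intro Min_in) auto
        then obtain j0 where j0: "j0 \<in> J" "Min (l ` J) = l j0" by blast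
        have "l j0 = (\<Sum>j\<in>J. l j0 * p j)" by (simp add: ps flip: sum_distrib_left)
        also have "\<dots> \<le> qform T y" unfolding q
          using J p0 by (intro sum_mono mult_right_mono) (auto simp flip: j0(2))
        finally have "f (l j0) \<le> f (qform T y)" using mono qI lI by (auto intro: mono_onD)
        thus ?thesis using Jf[OF j0(1)] by simp
      next
        assume anti: "antimono_on I f"
        have "Max (l ` J) \<in> l ` J" using J by (intro Max_in) auto
        then obtain j0 where j0: "j0 \<in> J" "Max (l ` J) = l j0" by blast
        have "qform T y \<le> (\<Sum>j\<in>J. l j0 * p j)" unfolding q
          using J p0 by (intro sum_mono mult_right_mono) (auto simp flip: j0(2))
        also have "\<dots> = l j0" by (simp add: ps flip: sum_distrib_left)
        finally have "f (l j0) \<le> f (qform T y)" using anti qI lI by (auto intro: monotone_onD)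
        thus ?thesis using Jf[OF j0(1)] by simp
      qed
      also have "\<dots> \<le> qform B y" by (rule order_trans[OF Jensen_qform[OF f(1) ny] B(2)])
      also have "\<dots> = qform B x / (norm x)\<^sup>2"
        by (simp add: y_def qform_def mv_linear cinner_scaleR power2_eq_square)
      finally show ?thesis using False by (simp add: field_simps)
    qed (simp add: qform_def)
  qed
  thus ?thesis using e(2)[OF i] by simp
qed

end

end

section \<open>Operator convexity\<close>

text \<open>In bra-ket notation, the operator |b><a|.\<close>

definition rank_one :: "'h \<Rightarrow> 'h \<Rightarrow> 'h::complex_hilbert_space bounded_op" where
  "rank_one b a = (SOME T. \<forall>x. op_apply T x = cinner a x *\<^sub>C b)"

lemma op_apply_rank_one: "op_apply (rank_one b a) x = cinner a x *\<^sub>C b"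
proof -
  have "bounded_linear (\<lambda>x. cinner a x *\<^sub>C b)"
  proof (rule bounded_linear_intro[where K = "norm a * norm b"])
    fix x show "norm (cinner a x *\<^sub>C b) \<le> norm x * (norm a * norm b)"
      using mult_right_mono[OF cinner_Cauchy_Schwarz norm_ge_zero, of a x b]
      by (simp add: norm_scaleC_hilbert mult_ac)
  qed (simp_all add: cinner_add_right scaleC_add_left cinner_scaleC_right scaleC_scaleC flip: scaleC_of_real)
  hence "\<exists>T. op_apply T = (\<lambda>x. cinner a x *\<^sub>C b)"
    by (rule ex_op) (simp add: cinner_scaleC_right scaleC_scaleC)
  hence "\<exists>T. \<forall>x. op_apply T x = cinner a x *\<^sub>C b" by metis
  from someI_ex[OF this] show ?thesis unfolding rank_one_def by blast
qed

lemma self_adjoint_op_iff: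
  "self_adjoint X \<longleftrightarrow> (\<forall>x y. cinner (op_apply X x) y = cinner x (op_apply X y))"
proof
  assume *: "\<forall>x y. cinner (op_apply X x) y = cinner x (op_apply X y)"
  have "star X = X" by (rule op_eqI, rule cinner_ext_left) (simp add: cinner_star_left *)
  thus "self_adjoint X" by (simp add: self_adjoint_def)
next
  assume "self_adjoint X"
  thus "\<forall>x y. cinner (op_apply X x) y = cinner x (op_apply X y)"
    using cinner_star_left[of X] by (simp add: self_adjoint_def)
qed

lemma self_adjoint_rank_one: "self_adjoint (rank_one a a)"
  unfolding self_adjoint_op_iff
proof clarify
  fix x y
  show "cinner (op_apply (rank_one a a) x) y = cinner x (op_apply (rank_one a a) y)"
    using cinner_commute[of x a]
    by (simp add: op_apply_rank_one cinner_scaleC_left cinner_scaleC_right)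
qed

lemma self_adjoint_sum:
  "(\<And>i. i \<in> I \<Longrightarrow> self_adjoint (X i)) \<Longrightarrow> self_adjoint (\<Sum>i\<in>I. X i)"
  by (induction I rule: infinite_finite_induct) (auto simp: self_adjoint_simps)

lemma cstar_positive_op_cinner:
  assumes "cstar_positive X"
  shows "0 \<le> Re (cinner x (op_apply X x))"
proof -
  obtain C where C: "self_adjoint C" "X = C * C" using cstar_positive_sqrt[OF assms] by blast
  have "cinner x (op_apply X x) = cinner (op_apply C x) (op_apply C x)"
    using C(1) by (simp add: C(2) op_apply_mult self_adjoint_op_iff)
  thus ?thesis by (simp add: cinner_self)
qed

lemma op_apply_linear:
  "op_apply X (\<Sum>i\<in>I. h i) = (\<Sum>i\<in>I. op_apply X (h i))" "op_apply X (x - y) = op_apply X x - op_apply X y"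
  "op_apply X (r *\<^sub>R x) = r *\<^sub>R op_apply X x"
proof -
  have lin: "linear (op_apply X)" by (rule bounded_linear.linear[OF bounded_linear_op_apply])
  show "op_apply X (\<Sum>i\<in>I. h i) = (\<Sum>i\<in>I. op_apply X (h i))" "op_apply X (x - y) = op_apply X x - op_apply X y"
    "op_apply X (r *\<^sub>R x) = r *\<^sub>R op_apply X x"
    by (simp_all add: linear_diff[OF lin] linear_cmul[OF lin] linear_sum[OF lin])
qed

text \<open>On the span of eigenvectors f(X) acts diagonally. The dilation uses this for three
  operators, each with its own expansion of the same vector.\<close>

lemma functional_calculus_op_eigenvectors:
  fixes X :: "'h::complex_hilbert_space bounded_op"
  assumes X: "self_adjoint X" and S: "cstar_spectrum X \<subseteq> complex_of_real ` S" and f: "continuous_on S f"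
    and e: "orthonormal_on P e" "finite P" "\<And>p. p \<in> P \<Longrightarrow> op_apply X (e p) = complex_of_real (t p) *\<^sub>C e p"
    and y: "y = (\<Sum>p\<in>P. c p *\<^sub>C e p)"
  shows "Re (cinner y (op_apply (functional_calculus f X) y)) = (\<Sum>p\<in>P. f (t p) * (cmod (c p))\<^sup>2)"
proof -
  have fe: "op_apply (functional_calculus f X) (e p) = complex_of_real (f (t p)) *\<^sub>C e p" if p: "p \<in> P" for p
  proof -
    have "e p \<noteq> 0" using orthonormal_on_cinner[OF e(1) p p] by auto
    from functional_calculus_op_eigenvector[OF X S f e(3)[OF p] this] show ?thesis by (simp add: scaleC_of_real)
  qed
  have "op_apply (functional_calculus f X) y = (\<Sum>p\<in>P. (complex_of_real (f (t p)) * c p) *\<^sub>C e p)"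
    unfolding y op_apply_linear
    by (intro sum.cong refl) (simp add: op_apply_scaleC fe scaleC_scaleC mult.commute)
  hence "cinner y (op_apply (functional_calculus f X) y) = (\<Sum>p\<in>P. cnj (c p) * (complex_of_real (f (t p)) * c p))"
    by (simp add: y cinner_two_orthonormal_sums[OF e(1,2)])
  also have "\<dots> = (\<Sum>p\<in>P. complex_of_real (f (t p) * (cmod (c p))\<^sup>2))"
    by (intro sum.cong refl) (metis cnj_mult_self mult.left_commute of_real_mult)
  finally show ?thesis by (simp del: of_real_mult of_real_power)
qed

lemma scaleC_sum_left: "(\<Sum>i\<in>I. c i) *\<^sub>C x = (\<Sum>i\<in>I. c i *\<^sub>C (x :: 'b::complex_vector))"
  by (induction I rule: infinite_finite_induct) (simp_all add: scaleC_add_left)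

lemma scaleC_sum_right: "c *\<^sub>C (\<Sum>i\<in>I. h i) = (\<Sum>i\<in>I. c *\<^sub>C (h i :: 'b::complex_vector))"
  by (induction I rule: infinite_finite_induct) (simp_all add: scaleC_add_right)

text \<open>Gram-Schmidt. Since \<open>span\<close> is the real span, the multiples of the e_p by
  the imaginary unit are added, so that it contains all complex combinations.\<close>

lemma exists_orthonormal_family:
  assumes inf: "\<nexists>B :: 'h::complex_hilbert_space set. finite B \<and> span B = UNIV" and P: "finite P"
  shows "\<exists>e :: 'p \<Rightarrow> 'h. orthonormal_on P e"
  using P
proof (induction P rule: finite_induct)
  case (insert p P)
  then obtain e :: "'p \<Rightarrow> 'h" where e: "orthonormal_on P e" by blast
  let ?B = "e ` P \<union> (\<lambda>p. \<i> *\<^sub>C e p) ` P"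
  have "finite ?B" using insert by simp
  with inf have "span ?B \<noteq> UNIV" by blast
  then obtain x where x: "x \<notin> span ?B" by blast
  define z where "z = x - (\<Sum>q\<in>P. cinner (e q) x *\<^sub>C e q)"
  have sp: "c *\<^sub>C e q \<in> span ?B" if "q \<in> P" for c q
  proof -
    have "c *\<^sub>C e q = Re c *\<^sub>R e q + Im c *\<^sub>R (\<i> *\<^sub>C e q)"
      by (simp add: scaleC_scaleC flip: scaleC_of_real scaleC_add_left)
        (metis complex_eq mult.commute)
    also have "\<dots> \<in> span ?B" using that by (intro span_add span_scale span_base) auto
    finally show ?thesis .
  qed
  have "z \<noteq> 0"
  proof
    assume "z = 0"
    hence "x = (\<Sum>q\<in>P. cinner (e q) x *\<^sub>C e q)" by (simp add: z_def)
    also have "\<dots> \<in> span ?B" by (intro span_sum sp)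
    finally show False using x by blast
  qed
  have ez: "cinner (e q) z = 0" if "q \<in> P" for q
    using that by (simp add: z_def cinner_diff_right cinner_orthonormal_sum[OF e insert(1)])
  define w where "w = (1 / norm z) *\<^sub>R z"
  have w1: "cinner w w = 1" using \<open>z \<noteq> 0\<close> by (simp add: w_def cinner_self)
  have ew: "cinner (e q) w = 0" if "q \<in> P" for q using ez[OF that] by (simp add: w_def cinner_scaleR)
  have we: "cinner w (e q) = 0" if "q \<in> P" for q using ew[OF that] by (subst cinner_commute) simp
  have "orthonormal_on (insert p P) (e(p := w))"
    using e w1 ew we insert by (auto simp: orthonormal_on_def)
  thus ?case by blast
qed (simp add: orthonormal_on_def)

(* Dilation: V x = sum_p <u_p, x> e_p is an isometry into the infinite-dimensional space, D is the
   operator with eigenvectors e_p and eigenvalues t_p (and c on the complement), and U is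
   the reflection 2 V V^* - 1. The average X of D and U D U satisfies X V = V T, and U V = V. *)
lemma operator_convex_dilation:
  fixes u :: "'p \<Rightarrow> complex^'n::finite" and f :: "real \<Rightarrow> real"
  assumes f: "operator_convex TYPE('h::complex_hilbert_space) I f"
    and I: "{m..M} \<subseteq> I" "m \<le> M" and P: "finite P" and t: "\<And>p. p \<in> P \<Longrightarrow> t p \<in> {m..M}"
    and res: "\<And>x. (\<Sum>p\<in>P. cinner (u p) x *\<^sub>C u p) = x"
    and v: "orthonormal_on (UNIV :: 'n set) v"
    and l: "\<And>i. (\<Sum>p\<in>P. complex_of_real (t p) *\<^sub>C cinner (u p) (v i) *\<^sub>C u p) = complex_of_real (l i) *\<^sub>C v i"
  shows "(\<Sum>i\<in>UNIV. f (l i) * (cmod (cinner (v i) x))\<^sup>2) \<le> (\<Sum>p\<in>P. f (t p) * (cmod (cinner (u p) x))\<^sup>2)"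
proof -
  have inf: "\<nexists>B :: 'h set. finite B \<and> span B = UNIV" and fI: "continuous_on I f"
    using f by (simp_all add: operator_convex_def)
  have fc: "continuous_on {m..M} f" by (rule continuous_on_subset[OF fI I(1)])
  obtain e :: "'p \<Rightarrow> 'h" where e: "orthonormal_on P e" using exists_orthonormal_family[OF inf P] by blast
  \<comment> \<open>Midpoint and half length of the interval. With the value c off the span of the
    e_p, D stays within distance r of c; so do U D U and the average, which places all three spectra
    in [m, M].\<close>
  define c where "c = (m + M) / 2"
  define r where "r = (M - m) / 2"
  have r0: "0 \<le> r" using I by (simp add: r_def)
  have mM: "{c - r..c + r} = {m..M}" by (simp add: c_def r_def field_simps)
  define D where "D = c *\<^sub>R 1 + (\<Sum>p\<in>P. (t p - c) *\<^sub>R rank_one (e p) (e p))"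
  define V where "V x = (\<Sum>p\<in>P. cinner (u p) x *\<^sub>C e p)" for x
  define w where "w i = V (v i)" for i
  define U where "U = 2 *\<^sub>R (\<Sum>i\<in>UNIV. rank_one (w i) (w i)) - 1"
  have Dsa: "self_adjoint D" unfolding D_def
    by (intro self_adjoint_simps self_adjoint_sum self_adjoint_rank_one)
  have Usa: "self_adjoint U" unfolding U_def
    by (intro self_adjoint_simps self_adjoint_sum self_adjoint_rank_one)
  \<comment> \<open>That V is isometric is the resolution of the identity by the u_p, read in
    coordinates.\<close>
  have VV: "cinner (V x) (V y) = cinner x y" for x y
  proof -
    have "cinner x y = cinner (\<Sum>p\<in>P. cinner (u p) x *\<^sub>C u p) y" by (simp add: res)
    thus ?thesis unfolding V_def cinner_two_orthonormal_sums[OF e P]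
      by (simp add: cinner_sum_left cinner_scaleC_left)
  qed
  have w: "orthonormal_on UNIV w" using v by (simp add: orthonormal_on_def w_def VV)
  have Vx: "V x = (\<Sum>i\<in>UNIV. cinner (v i) x *\<^sub>C w i)" for x
  proof -
    have "V x = V (\<Sum>i\<in>UNIV. cinner (v i) x *\<^sub>C v i)" by (simp flip: orthonormal_basis_expansion[OF v])
    also have "\<dots> = (\<Sum>p\<in>P. \<Sum>i\<in>UNIV. (cinner (v i) x * cinner (u p) (v i)) *\<^sub>C e p)"
      unfolding V_def cinner_sum_right cinner_scaleC_right by (simp add: scaleC_sum_left)
    also have "\<dots> = (\<Sum>i\<in>UNIV. cinner (v i) x *\<^sub>C w i)"
      unfolding w_def V_def by (subst sum.swap) (simp add: scaleC_sum_right scaleC_scaleC)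
    finally show ?thesis .
  qed
  have Uy: "op_apply U y = 2 *\<^sub>R (\<Sum>i\<in>UNIV. cinner (w i) y *\<^sub>C w i) - y" for y
    by (simp add: U_def op_apply_diff op_apply_scaleR op_apply_sum op_apply_rank_one op_apply_one)
  have Uw: "op_apply U (w j) = w j" for j
    by (simp add: Uy orthonormal_on_cinner[OF w] if_distrib[of "\<lambda>c. c *\<^sub>C _"] cong: if_cong)
      (simp add: scaleR_2)
  have UVx: "op_apply U (V x) = V x" for x
    by (simp add: Vx op_apply_linear op_apply_scaleC Uw)
  have UU: "U * U = 1"
  proof (rule op_eqI)
    fix y
    let ?z = "\<Sum>i\<in>UNIV. cinner (w i) y *\<^sub>C w i"
    have "op_apply U ?z = ?z" by (simp add: op_apply_linear op_apply_scaleC Uw)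
    hence "op_apply U (2 *\<^sub>R ?z - y) = y" by (simp add: op_apply_linear Uy[of y])
    thus "op_apply (U * U) y = op_apply 1 y" by (simp add: op_apply_mult op_apply_one flip: Uy)
  qed
  have UUx: "op_apply U (op_apply U y) = y" for y
    using arg_cong[OF UU, of "\<lambda>T. op_apply T y"] by (simp add: op_apply_mult op_apply_one)
  define D' where "D' = U * D * U"
  have D'sa: "self_adjoint D'" using Dsa Usa by (simp add: D'_def self_adjoint_def star_mult mult.assoc)
  have nD: "norm (D - c *\<^sub>R 1) \<le> r"
  proof (rule norm_op_bound[OF r0])
    fix y
    have "op_apply (D - c *\<^sub>R 1) y = (\<Sum>p\<in>P. (complex_of_real (t p - c) * cinner (e p) y) *\<^sub>C e p)"
      by (simp add: D_def op_apply_sum op_apply_scaleR op_apply_rank_one) (simp add: scaleC_scaleC flip: scaleC_of_real)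
    hence "(norm (op_apply (D - c *\<^sub>R 1) y))\<^sup>2 = (\<Sum>p\<in>P. (t p - c)\<^sup>2 * (cmod (cinner (e p) y))\<^sup>2)"
      by (simp only: norm_orthonormal_sum[OF e P] norm_mult norm_of_real power_mult_distrib power2_abs)
    also have "\<dots> \<le> (\<Sum>p\<in>P. r\<^sup>2 * (cmod (cinner (e p) y))\<^sup>2)"
    proof (intro sum_mono mult_right_mono)
      fix p assume "p \<in> P"
      with t mM have "t p \<in> {c - r..c + r}" by blast
      hence "\<bar>t p - c\<bar> \<le> \<bar>r\<bar>" using r0 by auto
      thus "(t p - c)\<^sup>2 \<le> r\<^sup>2" by (simp add: abs_le_square_iff)
    qed simp
    also have "\<dots> \<le> (r * norm y)\<^sup>2"
      using mult_left_mono[OF Bessel_inequality[OF e P], of "r\<^sup>2" y]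
      by (simp add: sum_distrib_left power_mult_distrib)
    finally show "norm (op_apply (D - c *\<^sub>R 1) y) \<le> r * norm y"
      by (rule power2_le_imp_le) (simp add: r0)
  qed
  have nU: "norm U \<le> 1"
  proof -
    have "(norm U)\<^sup>2 = norm (1 :: 'h bounded_op)" using norm_self_adjoint_square[OF Usa] by (simp add: UU)
    also have "\<dots> \<le> 1\<^sup>2" using norm_one_le by simp
    finally show ?thesis by (rule power2_le_imp_le) simp
  qed
  have nD': "norm (D' - c *\<^sub>R 1) \<le> r"
  proof -
    have "D' - c *\<^sub>R 1 = U * (D - c *\<^sub>R 1) * U"
      by (simp add: D'_def left_diff_distrib right_diff_distrib UU)
    also have "norm \<dots> \<le> norm U * norm (D - c *\<^sub>R 1) * norm U"
      by (rule order_trans[OF norm_mult_ineq mult_right_mono[OF norm_mult_ineq norm_ge_zero]])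
    also have "\<dots> \<le> 1 * r * 1" using nU nD r0 by (intro mult_mono) auto
    finally show ?thesis by simp
  qed
  define X where "X = (1/2) *\<^sub>R D + (1 - 1/2) *\<^sub>R D'"
  have Xsa: "self_adjoint X" unfolding X_def by (intro self_adjoint_simps Dsa D'sa)
  have nX: "norm (X - c *\<^sub>R 1) \<le> r"
  proof -
    have "X - c *\<^sub>R 1 = (1/2) *\<^sub>R ((D - c *\<^sub>R 1) + (D' - c *\<^sub>R 1))"
      by (simp add: X_def algebra_simps flip: scaleR_add_left)
    thus ?thesis using norm_triangle_ineq[of "D - c *\<^sub>R 1" "D' - c *\<^sub>R 1"] nD nD' by simp
  qed
  note sp = spectrum_subset_if_norm_le[OF Dsa nD, unfolded mM] spectrum_subset_if_norm_le[OF D'sa nD', unfolded mM]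
    spectrum_subset_if_norm_le[OF Xsa nX, unfolded mM]
  have De: "op_apply D (e p) = complex_of_real (t p) *\<^sub>C e p" if p: "p \<in> P" for p
  proof -
    have "op_apply D (e p) = c *\<^sub>R e p + (\<Sum>q\<in>P. if q = p then (t p - c) *\<^sub>R e p else 0)"
      unfolding D_def op_apply_add op_apply_sum op_apply_scaleR op_apply_one op_apply_rank_one
      by (intro arg_cong2[where f = "(+)"] refl sum.cong) (simp_all add: orthonormal_on_cinner[OF e _ p])
    also have "\<dots> = complex_of_real (t p) *\<^sub>C e p"
      using p P by (simp add: scaleC_of_real flip: scaleR_add_left)
    finally show ?thesis .
  qed
  have Dw: "op_apply D (w i) = (\<Sum>p\<in>P. (complex_of_real (t p) * cinner (u p) (v i)) *\<^sub>C e p)" for i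
    by (simp add: w_def V_def op_apply_linear op_apply_scaleC De scaleC_scaleC mult.commute)
  \<comment> \<open>These are the matrix entries of the compression V^* D V, which is T in its
    eigenbasis.\<close>
  have wDw: "cinner (w j) (op_apply D (w i)) = (if i = j then complex_of_real (l i) else 0)" for i j
  proof -
    have "cinner (w j) (op_apply D (w i))
        = (\<Sum>p\<in>P. cnj (cinner (u p) (v j)) * (complex_of_real (t p) * cinner (u p) (v i)))"
      unfolding Dw by (simp add: w_def V_def cinner_two_orthonormal_sums[OF e P])
    also have "\<dots> = cinner (v j) (\<Sum>p\<in>P. complex_of_real (t p) *\<^sub>C cinner (u p) (v i) *\<^sub>C u p)"
      unfolding cinner_sum_right cinner_scaleC_right
      by (intro sum.cong refl) (subst cinner_commute[of "v j"], simp)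
    also have "\<dots> = (if i = j then complex_of_real (l i) else 0)"
      unfolding l by (simp add: cinner_scaleC_right orthonormal_on_cinner[OF v])
    finally show ?thesis .
  qed
  \<comment> \<open>Adding a vector and its reflection leaves twice its projection onto the range of
    V, so averaging removes the part of D w_i outside the range.\<close>
  have Xw: "op_apply X (w i) = complex_of_real (l i) *\<^sub>C w i" for i
  proof -
    have s: "(\<Sum>j\<in>UNIV. cinner (w j) (op_apply D (w i)) *\<^sub>C w j) = complex_of_real (l i) *\<^sub>C w i"
      by (simp add: wDw if_distrib[of "\<lambda>c. c *\<^sub>C _"] cong: if_cong)
    have "op_apply X (w i) = (1/2) *\<^sub>R (op_apply D (w i) + op_apply U (op_apply D (w i)))"
      by (simp add: X_def D'_def op_apply_add op_apply_scaleR op_apply_mult Uw scaleR_add_right)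
    also have "\<dots> = complex_of_real (l i) *\<^sub>C w i" by (simp add: Uy s)
    finally show ?thesis .
  qed
  let ?y = "V x"
  have e': "orthonormal_on P (\<lambda>p. op_apply U (e p))"
  proof -
    have "cinner (op_apply U (e p)) (op_apply U (e q)) = cinner (e p) (e q)" for p q
      using Usa UUx by (simp add: self_adjoint_op_iff)
    thus ?thesis using e by (simp add: orthonormal_on_def)
  qed
  have D'e: "op_apply D' (op_apply U (e p)) = complex_of_real (t p) *\<^sub>C op_apply U (e p)" if "p \<in> P" for p
    using De[OF that] by (simp add: D'_def op_apply_mult UUx op_apply_scaleC)
  \<comment> \<open>As U fixes V x, this vector has the same coefficients in the eigenvectors of U D
    U as in those of D. Hence f(D) and f(U D U) have equal forms at it.\<close>
  have y': "?y = (\<Sum>p\<in>P. cinner (u p) x *\<^sub>C op_apply U (e p))"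
  proof -
    have "?y = op_apply U ?y" by (simp add: UVx)
    also have "\<dots> = (\<Sum>p\<in>P. cinner (u p) x *\<^sub>C op_apply U (e p))"
      unfolding V_def op_apply_linear op_apply_scaleC ..
    finally show ?thesis .
  qed
  have "functional_calculus f X
      \<preceq> (1/2) *\<^sub>R functional_calculus f D + (1 - 1/2) *\<^sub>R functional_calculus f D'"
  proof -
    have "(1/2::real) \<in> {0..1}" by simp
    moreover have "cstar_spectrum D \<subseteq> complex_of_real ` I" "cstar_spectrum D' \<subseteq> complex_of_real ` I"
      using sp(1,2) I(1) by blast+
    ultimately show ?thesis using f Dsa D'sa unfolding operator_convex_def X_def by blast
  qed
  from cstar_positive_op_cinner[OF this[unfolded cstar_le_def], of ?y]
  have "Re (cinner ?y (op_apply (functional_calculus f X) ?y)) \<le>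
    (1/2) * Re (cinner ?y (op_apply (functional_calculus f D) ?y))
    + (1/2) * Re (cinner ?y (op_apply (functional_calculus f D') ?y))"
    by (simp add: op_apply_diff op_apply_add op_apply_scaleR cinner_diff_right cinner_add_right cinner_scaleR)
  also have "Re (cinner ?y (op_apply (functional_calculus f D) ?y)) = (\<Sum>p\<in>P. f (t p) * (cmod (cinner (u p) x))\<^sup>2)"
    by (rule functional_calculus_op_eigenvectors[OF Dsa sp(1) fc e P De V_def])
  also have "Re (cinner ?y (op_apply (functional_calculus f D') ?y)) = (\<Sum>p\<in>P. f (t p) * (cmod (cinner (u p) x))\<^sup>2)"
    by (rule functional_calculus_op_eigenvectors[OF D'sa sp(2) fc e' P D'e y'])
  also have "Re (cinner ?y (op_apply (functional_calculus f X) ?y)) = (\<Sum>i\<in>UNIV. f (l i) * (cmod (cinner (v i) x))\<^sup>2)"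
    by (rule functional_calculus_op_eigenvectors[OF Xsa sp(3) fc w finite Xw Vx])
  finally show ?thesis by simp
qed

(* Piecewise linear hat functions: they interpolate the identity exactly, so psi(id) needs no limit. *)
lemma hat_function_partition:
  fixes f :: "real \<Rightarrow> real"
  assumes mM: "m < M" and f: "continuous_on {m..M} f" and e: "e > 0"
  shows "\<exists>(N::nat) h s. (\<forall>j. continuous_on {m..M} (h j) \<and> (\<forall>t. 0 \<le> h j t)) \<and> (\<forall>j\<le>N. s j \<in> {m..M}) \<and>
    (\<forall>t\<in>{m..M}. (\<Sum>j\<le>N. h j t) = 1 \<and> (\<Sum>j\<le>N. s j * h j t) = t \<and> (\<Sum>j\<le>N. f (s j) * h j t) \<le> f t + e)"
proof -
  have "uniformly_continuous_on {m..M} f" by (rule compact_uniformly_continuous[OF f]) simp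
  then obtain d where d: "d > 0" and
    fd: "\<And>t t'. t \<in> {m..M} \<Longrightarrow> t' \<in> {m..M} \<Longrightarrow> \<bar>t' - t\<bar> < d \<Longrightarrow> \<bar>f t' - f t\<bar> < e"
    using e unfolding uniformly_continuous_on_def dist_real_def by metis
  obtain N0 where N0: "(M - m) / d < real N0" using reals_Archimedean2 by blast
  define N where "N = max 1 N0"
  define \<delta> where "\<delta> = (M - m) / real N"
  have N: "1 \<le> N" "(M - m) / d < real N" using N0 by (auto simp: N_def)
  have del: "0 < \<delta>" "\<delta> < d" using N mM d by (simp_all add: \<delta>_def field_simps)
  define s where "s j = m + real j * \<delta>" for j
  define h where "h j t = max 0 (1 - \<bar>t - s j\<bar> / \<delta>)" for j t
  have sM: "s N = M" using N(1) by (simp add: s_def \<delta>_def)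
  have sj: "s j \<in> {m..M}" if "j \<le> N" for j
    using that del mult_right_mono[of "real j" "real N" \<delta>] by (simp add: s_def flip: sM)
  \<comment> \<open>The right end is separated because there the floor would be N, one past the last
    cell.\<close>
  have key: "\<exists>i<N. s i \<le> t \<and> t \<le> s (Suc i)" if t: "t \<in> {m..M}" for t
  proof (cases "t = M")
    case True
    have "s (N - 1) \<le> s N" using del by (simp add: s_def mult_right_mono)
    thus ?thesis using True N(1) sM by (intro exI[of _ "N - 1"]) auto
  next
    case False
    define i where "i = nat \<lfloor>(t - m) / \<delta>\<rfloor>"
    have y: "0 \<le> (t - m) / \<delta>" using t del by simp
    have i: "real i \<le> (t - m) / \<delta>" "(t - m) / \<delta> \<le> real i + 1"
      using y by (simp_all add: i_def)
    have "(t - m) / \<delta> < real N" using False t del sM by (simp add: s_def field_simps)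
    hence "i < N" using i(1) by linarith
    moreover have "s i \<le> t" "t \<le> s (Suc i)" using i del by (simp_all add: s_def field_simps)
    ultimately show ?thesis by blast
  qed
  \<comment> \<open>Only the two hats around t are nonzero. Taking g constant, the identity and f
    yields the three required sums.\<close>
  have interp: "(\<Sum>j\<le>N. g (s j) * h j t) = g (s i) * ((s (Suc i) - t) / \<delta>) + g (s (Suc i)) * ((t - s i) / \<delta>)"
    if i: "i < N" "s i \<le> t" "t \<le> s (Suc i)" for g t i
  proof -
    have z: "h j t = 0" if j: "j \<le> N" "j \<noteq> i" "j \<noteq> Suc i" for j
    proof -
      have "\<delta> \<le> \<bar>t - s j\<bar>"
      proof (cases "j < i")
        case True
        hence "(real j + 1) * \<delta> \<le> real i * \<delta>" using del by (intro mult_right_mono) auto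
        thus ?thesis using i(2) by (simp add: s_def algebra_simps)
      next
        case False
        hence "(real i + 2) * \<delta> \<le> real j * \<delta>" using j del by (intro mult_right_mono) auto
        thus ?thesis using i(3) by (simp add: s_def algebra_simps)
      qed
      thus ?thesis using del by (simp add: h_def field_simps)
    qed
    have si: "s (Suc i) = s i + \<delta>" by (simp add: s_def algebra_simps)
    have "h i t = (s (Suc i) - t) / \<delta>" "h (Suc i) t = (t - s i) / \<delta>"
      using i del si by (simp_all add: h_def field_simps)
    moreover have "(\<Sum>j\<le>N. g (s j) * h j t) = (\<Sum>j\<in>{i, Suc i}. g (s j) * h j t)"
      using i(1) z by (intro sum.mono_neutral_right) auto
    ultimately show ?thesis by simp
  qed
  show ?thesis
  proof (intro exI[of _ N] exI[of _ h] exI[of _ s] conjI allI ballI impI)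
    fix j show "continuous_on {m..M} (h j)" unfolding h_def using del by (intro continuous_intros) auto
  next
    fix j t show "0 \<le> h j t" by (simp add: h_def)
  next
    fix j assume "j \<le> N"
    thus "s j \<in> {m..M}" by (rule sj)
  next
    fix t assume t: "t \<in> {m..M}"
    from key[OF this] obtain i where i: "i < N" "s i \<le> t" "t \<le> s (Suc i)" by blast
    have si: "s (Suc i) = s i + \<delta>" by (simp add: s_def algebra_simps)
    show "(\<Sum>j\<le>N. h j t) = 1"
      using interp[OF i, of "\<lambda>_. 1"] del si by (simp flip: add_divide_distrib)
    show "(\<Sum>j\<le>N. s j * h j t) = t"
      using interp[OF i, of "\<lambda>y. y"] del si by (simp add: field_simps)
    define p where "p = (t - s i) / \<delta>"
    have p: "0 \<le> p" "0 \<le> 1 - p" "(s (Suc i) - t) / \<delta> = 1 - p" using i si del by (simp_all add: p_def field_simps)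
    have "f (s i) \<le> f t + e" "f (s (Suc i)) \<le> f t + e"
      using fd[OF t sj[of i]] fd[OF t sj[of "Suc i"]] i si del by (simp_all add: abs_less_iff)
    hence "f (s i) * (1 - p) + f (s (Suc i)) * p \<le> (f t + e) * (1 - p) + (f t + e) * p"
      using p by (intro add_mono mult_right_mono) auto
    thus "(\<Sum>j\<le>N. f (s j) * h j t) \<le> f t + e"
      unfolding interp[OF i] p(3) p_def[symmetric] by (simp add: algebra_simps)
  qed
qed

lemma mv_sum: "mv (\<Sum>j\<in>J. A j) x = (\<Sum>j\<in>J. mv (A j) x)"
  by (induction J rule: infinite_finite_induct) (simp_all add: mv_simps)

text \<open>The left side involves T only, which the hats reproduce without error; the approximation
  of f costs an error on the right side alone, and in one direction. The rank one pieces come from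
  the spectral decompositions of the matrices \<psi>(h_j).\<close>

lemma (in positive_unital_interval_map) operator_convex_qform_le:
  fixes f :: "real \<Rightarrow> real"
  assumes f: "operator_convex TYPE('h::complex_hilbert_space) I f" and I: "{m..M} \<subseteq> I"
  shows "qform (functional_calculus f T) x \<le> qform (\<psi> f) x"
proof (rule field_le_epsilon)
  fix e :: real assume e: "e > 0"
  have fI: "continuous_on I f" using f by (simp add: operator_convex_def)
  have fc: "continuous_on {m..M} f" by (rule continuous_on_subset[OF fI I])
  \<comment> \<open>Scaled so that the error d times the squared norm of x is at most e; the 1
    covers x = 0.\<close>
  define d where "d = e / ((norm x)\<^sup>2 + 1)"
  have d: "d > 0" "d * (norm x)\<^sup>2 \<le> e"
    using e by (simp_all add: d_def divide_pos_pos add_nonneg_pos mult_le_cancel_left_pos divide_le_eq)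
  from hat_function_partition[OF m_less_M fc d(1)]
  obtain N :: nat and h s where
    h: "\<And>j. continuous_on {m..M} (h j)" "\<And>j t. 0 \<le> h j t" and s: "\<And>j. j \<le> N \<Longrightarrow> s j \<in> {m..M}" and
    part: "\<And>t. t \<in> {m..M} \<Longrightarrow> (\<Sum>j\<le>N. h j t) = 1" "\<And>t. t \<in> {m..M} \<Longrightarrow> (\<Sum>j\<le>N. s j * h j t) = t"
      "\<And>t. t \<in> {m..M} \<Longrightarrow> (\<Sum>j\<le>N. f (s j) * h j t) \<le> f t + d"
    by blast
  define A where "A j = \<psi> (h j)" for j
  have Apos: "cstar_positive (A j)" for j unfolding A_def by (rule positive[OF h])
  have "\<exists>v b. orthonormal_on (UNIV :: 'n set) v \<and> (\<forall>i. mv (A j) (v i) = complex_of_real (b i) *\<^sub>C v i)" for j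
    using Apos by (intro spectral_theorem) (simp add: cstar_positive_def)
  then obtain w b where w: "\<And>j. orthonormal_on (UNIV :: 'n set) (w j)"
    and Aw: "\<And>j i. mv (A j) (w j i) = complex_of_real (b j i) *\<^sub>C w j i" by metis
  have b0: "0 \<le> b j i" for j i
  proof -
    have "cinner (w j i) (w j i) = 1" using orthonormal_on_cinner[OF w] by simp
    thus ?thesis using qform_nonneg[OF Apos, of j "w j i"] by (simp add: qform_def Aw cinner_scaleC_right)
  qed
  define P where "P = {..N} \<times> (UNIV :: 'n set)"
  \<comment> \<open>Square roots of eigenvalues are absorbed into the eigenvectors, so each A j is
    the sum over i of the rank one matrices of u (j, i). All vectors from the j-th hat share the
    point s j.\<close>
  define u where "u = (\<lambda>(j, i). sqrt (b j i) *\<^sub>R w j i)"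
  define t where "t = (\<lambda>(j, i :: 'n). s j)"
  have uu: "cinner (u (j, i)) y *\<^sub>C u (j, i) = complex_of_real (b j i) *\<^sub>C cinner (w j i) y *\<^sub>C w j i" for j i y
  proof -
    have u: "u (j, i) = complex_of_real (sqrt (b j i)) *\<^sub>C w j i" by (simp add: u_def scaleC_of_real)
    have "cinner (u (j, i)) y *\<^sub>C u (j, i)
        = (complex_of_real (sqrt (b j i)) * complex_of_real (sqrt (b j i)) * cinner (w j i) y) *\<^sub>C w j i"
      unfolding u cinner_scaleC_left scaleC_scaleC by (simp add: mult_ac)
    thus ?thesis using b0[of j i] by (simp add: scaleC_scaleC flip: of_real_mult)
  qed
  have Ay: "mv (A j) y = (\<Sum>i\<in>UNIV. cinner (u (j, i)) y *\<^sub>C u (j, i))" for j y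
  proof -
    have "mv (A j) y = mv (A j) (\<Sum>i\<in>UNIV. cinner (w j i) y *\<^sub>C w j i)"
      by (simp flip: orthonormal_basis_expansion[OF w])
    thus ?thesis by (simp add: mv_linear Aw uu scaleC_scaleC mult.commute)
  qed
  \<comment> \<open>With c = 1 this is the resolution of the identity, with c = s the decomposition
    of T.\<close>
  have Psum: "(\<Sum>p\<in>P. complex_of_real (c (fst p)) *\<^sub>C cinner (u p) y *\<^sub>C u p)
      = mv (\<psi> (\<lambda>r. \<Sum>j\<le>N. c j * h j r)) y" for c y
  proof -
    have "(\<Sum>p\<in>P. complex_of_real (c (fst p)) *\<^sub>C cinner (u p) y *\<^sub>C u p)
        = (\<Sum>j\<le>N. \<Sum>i\<in>UNIV. complex_of_real (c j) *\<^sub>C cinner (u (j, i)) y *\<^sub>C u (j, i))"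
      unfolding P_def by (simp add: sum.cartesian_product case_prod_beta')
    also have "\<dots> = (\<Sum>j\<le>N. c j *\<^sub>R mv (A j) y)"
      by (simp add: Ay scaleC_sum_right flip: scaleC_of_real)
    also have "\<dots> = mv (\<psi> (\<lambda>r. \<Sum>j\<le>N. c j * h j r)) y"
      by (subst sum) (simp_all add: h mv_sum mv_simps A_def)
    finally show ?thesis .
  qed
  have hc: "continuous_on {m..M} (\<lambda>r. \<Sum>j\<le>N. c j * h j r)" for c by (intro continuous_intros h)
  have res: "(\<Sum>p\<in>P. cinner (u p) y *\<^sub>C u p) = y" for y
  proof -
    have "\<psi> (\<lambda>r. \<Sum>j\<le>N. 1 * h j r) = \<psi> (\<lambda>r. 1)" by (rule cong[OF hc]) (simp add: part)
    thus ?thesis using Psum[of "\<lambda>_. 1" y] by (simp add: one mv_simps)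
  qed
  obtain v l where v: "orthonormal_on (UNIV :: 'n set) v" "\<And>i. mv T (v i) = complex_of_real (l i) *\<^sub>C v i"
    "\<And>i. l i \<in> {m..M}" "\<And>i. qform T (v i) = l i" "\<And>i. norm (v i) = 1" by (rule T_eigenbasis) (rule that)
  have fv: "mv (functional_calculus f T) (v i) = complex_of_real (f (l i)) *\<^sub>C v i" for i
  proof -
    have "v i \<noteq> 0" using v(5)[of i] by auto
    from functional_calculus_mv_eigenvector[OF self_adjoint_T spectrum_T fc v(2) this]
    show ?thesis by (simp add: scaleC_of_real)
  qed
  have l: "(\<Sum>p\<in>P. complex_of_real (t p) *\<^sub>C cinner (u p) (v i) *\<^sub>C u p) = complex_of_real (l i) *\<^sub>C v i" for i
  proof -
    have "t = (\<lambda>p. s (fst p))" by (simp add: t_def case_prod_beta')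
    moreover have "\<psi> (\<lambda>r. \<Sum>j\<le>N. s j * h j r) = T" by (rule cong[OF hc]) (simp add: part)
    ultimately show ?thesis using Psum[of s "v i"] v(2) by simp
  qed
  have "qform (functional_calculus f T) x = (\<Sum>i\<in>UNIV. f (l i) * (cmod (cinner (v i) x))\<^sup>2)"
    by (rule qform_eigenbasis[OF v(1) fv])
  also have "\<dots> \<le> (\<Sum>p\<in>P. f (t p) * (cmod (cinner (u p) x))\<^sup>2)"
    by (rule operator_convex_dilation[OF f I less_imp_le[OF m_less_M] _ _ res v(1) l])
      (use s in \<open>auto simp: P_def t_def\<close>)
  also have "\<dots> = (\<Sum>j\<le>N. f (s j) * (\<Sum>i\<in>UNIV. (cmod (cinner (u (j, i)) x))\<^sup>2))"
    by (simp add: P_def t_def sum.cartesian_product case_prod_beta' sum_distrib_left)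
  also have "\<dots> = (\<Sum>j\<le>N. f (s j) * qform (A j) x)"
    by (intro sum.cong refl arg_cong2[where f = "(*)"])
      (simp add: qform_eigenbasis[OF w Aw] u_def cinner_scaleR norm_mult power_mult_distrib b0)
  also have "\<dots> = qform (\<psi> (\<lambda>r. \<Sum>j\<le>N. f (s j) * h j r)) x"
    by (subst sum) (simp_all add: h qform_sum qform_simps A_def)
  also have "\<dots> \<le> qform (\<psi> (\<lambda>r. d + 1 * f r)) x"
    by (rule qform_mono[OF hc]) (use part(3) in \<open>auto intro!: continuous_intros fc simp: add.commute\<close>)
  also have "\<dots> = qform (\<psi> f) x + d * (norm x)\<^sup>2" unfolding affine[OF fc] by (simp add: qform_simps)
  finally show "qform (functional_calculus f T) x \<le> qform (\<psi> f) x + e" using d(2) by simp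
qed

section \<open>Reduction of the theorem to interval maps\<close>

lemma positive_map_self_adjoint:
  fixes \<phi> :: "'a::unital_cstar_algebra \<Rightarrow> 'b::unital_cstar_algebra"
  assumes \<phi>: "complex_linear \<phi>" "positive_map \<phi>" and x: "self_adjoint x"
  shows "self_adjoint (\<phi> x)"
proof -
  \<comment> \<open>A self-adjoint x is the difference of the positive element x + |x| 1 and a
    multiple of 1, and 1 is itself the case x = 0, r = 1.\<close>
  have pos: "cstar_positive (x + complex_of_real r *\<^sub>C 1)" if x: "self_adjoint x" and r: "norm x \<le> r" for x :: 'a and r
    unfolding cstar_positive_def
  proof
    show sa: "self_adjoint (x + complex_of_real r *\<^sub>C 1)" by (intro self_adjoint_simps x)
    have "norm (x - 0 *\<^sub>R 1) \<le> r" using r by simp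
    note sp = spectrum_subset_if_norm_le[OF x this]
    show "cstar_spectrum (x + complex_of_real r *\<^sub>C 1) \<subseteq> complex_of_real ` {0..}"
    proof (rule spectrum_subset_of_real[OF sa], rule subsetI)
      fix t assume "t \<in> Re ` cstar_spectrum (x + complex_of_real r *\<^sub>C 1)"
      then obtain z where z: "z - complex_of_real r \<in> cstar_spectrum x" "t = Re z"
        by (auto simp: in_spectrum_shift)
      with sp obtain q where "q \<in> {0 - r..0 + r}" "z - complex_of_real r = complex_of_real q" by blast
      hence "t = q + r" "- r \<le> q" using z(2) by (auto simp: complex_eq_iff)
      thus "t \<in> {0..}" by simp
    qed
  qed
  have sa: "self_adjoint (\<phi> y)" if "cstar_positive y" for y
    using \<phi>(2) that by (simp add: positive_map_def cstar_positive_def)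
  have "\<phi> x = \<phi> (x + complex_of_real (norm x) *\<^sub>C 1) - complex_of_real (norm x) *\<^sub>C \<phi> 1"
    using \<phi>(1) by (simp add: complex_linear_def)
  moreover have "self_adjoint (\<phi> 1)"
    using sa[OF pos[of 0 1]] self_adjoint_simps(1) by simp
  ultimately show ?thesis using sa[OF pos[OF x order_refl]] by (simp add: self_adjoint_simps)
qed

text \<open>The right end is pushed slightly into the open set I, so that m < M holds even when K is
  a single point.\<close>

lemma compact_subset_open_interval:
  fixes K I :: "real set"
  assumes K: "compact K" "K \<noteq> {}" "K \<subseteq> I" and I: "open I" "is_interval I"
  shows "\<exists>m M. m < M \<and> K \<subseteq> {m..M} \<and> {m..M} \<subseteq> I"
proof -
  obtain m where m: "m \<in> K" "\<And>t. t \<in> K \<Longrightarrow> m \<le> t" using compact_attains_inf[OF K(1,2)] by blast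
  obtain M where M: "M \<in> K" "\<And>t. t \<in> K \<Longrightarrow> t \<le> M" using compact_attains_sup[OF K(1,2)] by blast
  obtain e where e: "e > 0" "ball M e \<subseteq> I" using I(1) M(1) K(3) by (meson openE subsetD)
  have Me: "M + e / 2 \<in> I" using e by (intro subsetD[OF e(2)]) (simp add: dist_real_def)
  have "{m..M + e / 2} \<subseteq> I"
    using I(2) m(1) K(3) Me unfolding is_interval_1 by (meson atLeastAtMost_iff subsetD subsetI)
  moreover have "m < M + e / 2" "K \<subseteq> {m..M + e / 2}" using m M e(1) by force+
  ultimately show ?thesis by blast
qed

(* The atom is placed at t0 = 0 for contractive maps, which leaves phi(a) unchanged. *)
lemma Jensen_extended:
  fixes \<phi> :: "'a::unital_cstar_algebra \<Rightarrow> 'n::finite cmatrix" and f :: "real \<Rightarrow> real"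
  assumes \<phi>: "complex_linear \<phi>" "positive_map \<phi>"
    and a: "self_adjoint a" and I: "open I" "is_interval I" "cstar_spectrum a \<subseteq> complex_of_real ` I"
    and t0: "t0 \<in> I" "t0 *\<^sub>R (1 - \<phi> 1) = 0" "cstar_positive (1 - \<phi> 1)" "\<phi> 1 = 1 \<or> f t0 \<le> 0"
  shows "(operator_convex TYPE('h::complex_hilbert_space) I f \<longrightarrow>
           functional_calculus f (\<phi> a) \<preceq> \<phi> (functional_calculus f a)) \<and>
        (convex_on I f \<and> (mono_on I f \<or> antimono_on I f) \<longrightarrow>
           (\<forall>i\<in>{1..CARD('n)}.
              nth_eigenvalue i (functional_calculus f (\<phi> a))
                \<le> nth_eigenvalue i (\<phi> (functional_calculus f a)))) \<and>
        (convex_on I f \<longrightarrow>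
           (\<forall>k\<in>{1..CARD('n)}.
              (\<Sum>i=1..k. nth_eigenvalue i (functional_calculus f (\<phi> a)))
                \<le> (\<Sum>i=1..k. nth_eigenvalue i (\<phi> (functional_calculus f a)))))"
proof -
  \<comment> \<open>Including t0 makes evaluation at the atom depend only on values in
    [m, M].\<close>
  have "compact (insert t0 (Re ` cstar_spectrum a))"
    by (intro compact_insert compact_continuous_image compact_spectrum continuous_intros)
  moreover have "insert t0 (Re ` cstar_spectrum a) \<subseteq> I" using t0(1) Re_spectrum_subset[OF I(3)] by simp
  ultimately obtain m M where mM: "m < M" "insert t0 (Re ` cstar_spectrum a) \<subseteq> {m..M}" "{m..M} \<subseteq> I"
    using compact_subset_open_interval[OF _ _ _ I(1,2), of "insert t0 (Re ` cstar_spectrum a)"] by blast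
  have S: "cstar_spectrum a \<subseteq> complex_of_real ` {m..M}" using mM(2) by (intro spectrum_subset_of_real a) simp
  have t0m: "t0 \<in> {m..M}" using mM(2) by simp
  have lin: "\<phi> (x + y) = \<phi> x + \<phi> y" "\<phi> (r *\<^sub>R x) = r *\<^sub>R \<phi> x" for x y r
    using \<phi>(1) by (simp_all add: complex_linear_def flip: scaleC_of_real)
  note fc = functional_calculus_add[OF a S] functional_calculus_scale[OF a S] functional_calculus_const[OF a S]
  define \<psi> where "\<psi> g = \<phi> (functional_calculus g a) + g t0 *\<^sub>R (1 - \<phi> 1)" for g
  interpret positive_unital_interval_map \<psi> m M
  proof
    show "m < M" by (rule mM(1))
  next
    fix g h :: "real \<Rightarrow> real" and c d :: real
    assume gh: "continuous_on {m..M} g" "continuous_on {m..M} h"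
    have "functional_calculus (\<lambda>t. c * g t + d * h t) a = c *\<^sub>R functional_calculus g a + d *\<^sub>R functional_calculus h a"
      using gh by (subst fc(1)) (auto intro!: continuous_intros simp: fc(2))
    thus "\<psi> (\<lambda>t. c * g t + d * h t) = c *\<^sub>R \<psi> g + d *\<^sub>R \<psi> h"
      by (simp add: \<psi>_def lin algebra_simps)
  next
    show "\<psi> (\<lambda>t. 1) = 1" by (simp add: \<psi>_def fc(3))
  next
    fix g h :: "real \<Rightarrow> real"
    assume g: "continuous_on {m..M} g" and gh: "\<And>t. t \<in> {m..M} \<Longrightarrow> g t = h t"
    have "functional_calculus g a = functional_calculus h a" by (rule functional_calculus_cong[OF a S g gh])
    thus "\<psi> g = \<psi> h" by (simp only: \<psi>_def gh[OF t0m])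
  next
    fix g :: "real \<Rightarrow> real"
    assume g: "continuous_on {m..M} g" "\<And>t. t \<in> {m..M} \<Longrightarrow> 0 \<le> g t"
    have p: "cstar_positive (\<phi> (functional_calculus g a))"
      using \<phi>(2) cstar_positive_functional_calculus[OF a S g] by (simp add: positive_map_def)
    show "cstar_positive (\<psi> g)"
    proof (rule cstar_positive_cmatrixI)
      show "self_adjoint (\<psi> g)" using p t0(3) by (simp add: \<psi>_def cstar_positive_def self_adjoint_simps)
      fix x show "0 \<le> qform (\<psi> g) x"
        unfolding \<psi>_def qform_simps(3,5)
        by (intro add_nonneg_nonneg mult_nonneg_nonneg qform_nonneg p t0(3) g(2) t0m)
    qed
  qed
  let ?B = "\<phi> (functional_calculus f a)"
  have T: "\<psi> (\<lambda>t. t) = \<phi> a" by (simp add: \<psi>_def functional_calculus_id[OF a S] t0(2))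
  \<comment> \<open>The two sides differ by \<open>f t0\<close> times the form of
    \<open>1 - \<phi> 1\<close>.\<close>
  have le: "qform (\<psi> f) x \<le> qform ?B x" for x
    using t0(4)
  proof
    assume "f t0 \<le> 0"
    hence "f t0 * qform (1 - \<phi> 1) x \<le> 0" using qform_nonneg[OF t0(3)] by (rule mult_nonpos_nonneg)
    thus ?thesis by (simp add: \<psi>_def qform_simps)
  qed (simp add: \<psi>_def)
  have Bsa: "self_adjoint ?B" if "continuous_on I f"
    by (intro positive_map_self_adjoint[OF \<phi>] self_adjoint_functional_calculus[OF a S]
        continuous_on_subset[OF that mM(3)])
  have conv: "continuous_on I f" if "convex_on I f" using convex_on_continuous[OF I(1) that] .
  show ?thesis
  proof (intro conjI impI ballI)
    assume oc: "operator_convex TYPE('h) I f"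
    hence fI: "continuous_on I f" by (simp add: operator_convex_def)
    show "functional_calculus f (\<phi> a) \<preceq> ?B"
      unfolding cstar_le_def
    proof (rule cstar_positive_cmatrixI)
      have "self_adjoint (functional_calculus f (\<phi> a))"
        using self_adjoint_functional_calculus[OF self_adjoint_T spectrum_T continuous_on_subset[OF fI mM(3)]]
        by (simp add: T)
      thus "self_adjoint (?B - functional_calculus f (\<phi> a))" using Bsa[OF fI] by (simp add: self_adjoint_simps)
      fix x
      show "0 \<le> qform (?B - functional_calculus f (\<phi> a)) x"
        using operator_convex_qform_le[OF oc mM(3), of x] le[of x] by (simp add: T qform_simps)
    qed
  next
    fix i assume "convex_on I f \<and> (mono_on I f \<or> antimono_on I f)" and i: "i \<in> {1..CARD('n)}"
    thus "nth_eigenvalue i (functional_calculus f (\<phi> a)) \<le> nth_eigenvalue i ?B"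
      using eigenvalue_le[OF I(1,2) mM(3) conv _ _ Bsa[OF conv] le i] by (simp add: T)
  next
    fix k assume f: "convex_on I f" and k: "k \<in> {1..CARD('n)}"
    show "(\<Sum>i=1..k. nth_eigenvalue i (functional_calculus f (\<phi> a))) \<le> (\<Sum>i=1..k. nth_eigenvalue i ?B)"
      using sum_eigenvalues_le[OF I(1,2) mM(3) conv[OF f] f Bsa[OF conv[OF f]] le k] by (simp add: T)
  qed
qed

theorem proposition5p2:
  fixes \<phi> :: "'a::unital_cstar_algebra \<Rightarrow> 'n::finite cmatrix"
    and a :: 'a
    and f :: "real \<Rightarrow> real"
    and I :: "real set"
  assumes "complex_linear \<phi>"
    and "positive_map \<phi>"
    and "self_adjoint a"
    and "open I" and "is_interval I"
    and "cstar_spectrum a \<subseteq> complex_of_real ` I"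
  shows
    "(\<phi> 1 = 1 \<longrightarrow>
        (operator_convex TYPE('h::complex_hilbert_space) I f \<longrightarrow>
           functional_calculus f (\<phi> a) \<preceq> \<phi> (functional_calculus f a)) \<and>
        (convex_on I f \<and> (mono_on I f \<or> antimono_on I f) \<longrightarrow>
           (\<forall>i\<in>{1..CARD('n)}.
              nth_eigenvalue i (functional_calculus f (\<phi> a))
                \<le> nth_eigenvalue i (\<phi> (functional_calculus f a)))) \<and>
        (convex_on I f \<longrightarrow>
           (\<forall>k\<in>{1..CARD('n)}.
              (\<Sum>i=1..k. nth_eigenvalue i (functional_calculus f (\<phi> a)))
                \<le> (\<Sum>i=1..k. nth_eigenvalue i (\<phi> (functional_calculus f a)))))) \<and>
     (0 \<in> I \<and> f 0 \<le> 0 \<and> contractive \<phi> \<longrightarrow>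
        (operator_convex TYPE('h) I f \<longrightarrow>
           functional_calculus f (\<phi> a) \<preceq> \<phi> (functional_calculus f a)) \<and>
        (convex_on I f \<and> (mono_on I f \<or> antimono_on I f) \<longrightarrow>
           (\<forall>i\<in>{1..CARD('n)}.
              nth_eigenvalue i (functional_calculus f (\<phi> a))
                \<le> nth_eigenvalue i (\<phi> (functional_calculus f a)))) \<and>
        (convex_on I f \<longrightarrow>
           (\<forall>k\<in>{1..CARD('n)}.
              (\<Sum>i=1..k. nth_eigenvalue i (functional_calculus f (\<phi> a)))
                \<le> (\<Sum>i=1..k. nth_eigenvalue i (\<phi> (functional_calculus f a))))))"
proof -
  define atom where "atom t0 \<longleftrightarrow> t0 \<in> I \<and> t0 *\<^sub>R (1 - \<phi> 1) = 0 \<and> cstar_positive (1 - \<phi> 1) \<and>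
    (\<phi> 1 = 1 \<or> f t0 \<le> 0)" for t0
  note J = Jensen_extended[OF assms, where 'h = 'h]
  have 1: "\<exists>t0. atom t0" if one: "\<phi> 1 = 1"
  proof -
    \<comment> \<open>A unital map cannot start from the zero algebra, since the index type 'n is
      nonempty and so the identity matrix is nonzero. Hence the spectrum of a is nonempty, and any
      of its points can carry the atom of weight 0.\<close>
    have "(1 :: 'a) \<noteq> 0"
    proof
      assume "(1 :: 'a) = 0"
      hence "\<phi> (0 *\<^sub>C 1) = 1" using one by simp
      moreover have "\<phi> (0 *\<^sub>C 1) = 0 *\<^sub>C \<phi> 1" using assms(1) by (simp only: complex_linear_def)
      ultimately have "(1 :: 'n cmatrix) = 0" by simp
      hence "mv 1 x = mv 0 x" for x :: "complex^'n" by simp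
      hence "(\<chi> i. 1) = (0 :: complex^'n)" unfolding mv_simps .
      thus False by (simp add: vec_eq_iff)
    qed
    from norm_attained_on_spectrum[OF assms(3) this] assms(6) obtain t0 where t0: "t0 \<in> I" by blast
    have "cstar_positive (0 :: 'n cmatrix)"
      by (rule cstar_positive_cmatrixI) (simp_all add: self_adjoint_simps qform_simps)
    thus ?thesis using t0 one by (auto simp: atom_def)
  qed
  have 2: "\<exists>t0. atom t0" if c: "0 \<in> I \<and> f 0 \<le> 0 \<and> contractive \<phi>"
  proof -
    have sa: "self_adjoint (1 - \<phi> 1)"
      by (intro self_adjoint_simps positive_map_self_adjoint[OF assms(1,2)])
    have "norm (\<phi> 1) \<le> norm (1::'a)" using c by (simp add: contractive_def)
    hence n: "norm (\<phi> 1) \<le> 1" using norm_one_le order_trans by blast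
    \<comment> \<open>Contractivity at the single element 1 bounds the form of
      \<open>\<phi> 1\<close> by that of the identity, which is the positivity of the missing
      mass.\<close>
    have "qform (\<phi> 1) x \<le> (norm x)\<^sup>2" for x
    proof -
      have "qform (\<phi> 1) x \<le> cmod (cinner x (mv (\<phi> 1) x))" unfolding qform_def by (rule complex_Re_le_cmod)
      also have "\<dots> \<le> norm x * norm (mv (\<phi> 1) x)" by (rule cinner_Cauchy_Schwarz)
      also have "norm (mv (\<phi> 1) x) \<le> norm (\<phi> 1) * norm x"
        using norm_op_apply[of "op_of_matrix (\<phi> 1)" x] by (simp add: norm_op_of_matrix)
      also have "\<dots> \<le> 1 * norm x" by (rule mult_right_mono[OF n norm_ge_zero])
      finally show ?thesis by (simp add: mult_left_mono power2_eq_square)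
    qed
    hence "cstar_positive (1 - \<phi> 1)" by (intro cstar_positive_cmatrixI sa) (simp add: qform_simps)
    thus ?thesis using c by (auto simp: atom_def intro!: exI[of _ 0])
  qed
  show ?thesis
    by (rule conjI; rule impI; (drule 1 | drule 2); unfold atom_def; elim exE conjE; rule J; assumption)
qed

end
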